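(* There exists an infinite family of virtual knots $\{VK_n\}_{n\ge 1}$ such that $d_A(VK_t,VK_s)=1$ for all distinct $t,s\ge 1$.
   Context: A virtual knot diagram is a generic closed curve in the plane (one component) each of whose double points is marked either as a classical crossing (with over/under information) or as a virtual crossing (drawn encircled). A virtual knot is an equivalence class of virtual knot diagrams modulo the generalized Reidemeister moves (classical RI, RII, RIII, virtual VRI, VRII, VRIII, and the mixed move with one classical and two virtual crossings). An arc $(a,b)$ in a virtual knot diagram $D$ is a segment of the diagram, with end points $a,b$, passing through exactly one pair of (consecutive) crossings, each of which may be classical or virtual. An arc shift move on the arc $(a,b)$ consists of cutting the diagram at two points, one near each of the two crossings (so that the cut-out segment contains the passages through both crossings), and joining the free ends again after switching sides. That is, the cut-out segment is left in place with the two crossings unchanged as over/under/virtual crossings, but the loose end of the rest of the diagram near $a$ is joined to the end of the segment near $b$ and vice versa, so that the segment is traversed in the opposite direction; all new crossings created by the connecting strands are virtual. In terms of signed Gauss diagrams, the order of the passages through the two crossings along the segment is reversed and the signs of those among the two crossings that are classical are changed, over/under being preserved. Any virtual knot can be transformed into any other by arc shift moves together with generalized Reidemeister moves. For two virtual knots $K_1,K_2$, $d_A(K_1,K_2)$ denotes the minimum number of arc shift moves needed to convert a diagram of $K_1$ into a diagram of $K_2$ (generalized Reidemeister moves being allowed freely). *)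

theory Defs
  imports Main "HOL-Library.Extended_Nat"
begin

section \<open>Virtual knot diagrams\<close>

text \<open>
  A generic closed curve in the plane is recorded by the cyclic sequence of its passages through
  its double points.  To cut the cycle open, and to fix the unbounded region, choose an edge of the
  curve on the boundary of the unbounded region and traverse the curve, starting in the middle of
  that edge (the base edge), in the direction that has the unbounded region on the right.  Each
  passage records the crossing, whether the strand being followed is the over strand, the under
  strand, or a strand of a virtual crossing, and whether the other strand crosses it from left to
  right.  Up to renaming crossings, such words are the planar isotopy classes of (unoriented)
  diagrams together with a base edge on the unbounded region; the choice of the base edge is
  removed by \<open>rebase_forward\<close> and \<open>rebase_backward\<close> below.
\<close>

datatype level = Over | Under | Virtual

datatype passage = Passage (crossing: nat) (level: level) (from_left: bool)

fun opposite :: "level \<Rightarrow> level" where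
  "opposite Over = Under"
| "opposite Under = Over"
| "opposite Virtual = Virtual"

definition gauss_word :: "passage list \<Rightarrow> bool" where
  "gauss_word w \<longleftrightarrow>
     (\<forall>i<length w. card {j. j < length w \<and> crossing (w ! j) = crossing (w ! i)} = 2) \<and>
     (\<forall>i<length w. \<forall>j<length w. i \<noteq> j \<and> crossing (w ! i) = crossing (w ! j) \<longrightarrow>
        level (w ! j) = opposite (level (w ! i)) \<and> from_left (w ! j) = (\<not> from_left (w ! i)))"

definition partner :: "passage list \<Rightarrow> nat \<Rightarrow> nat" where
  "partner w i = (THE j. j < length w \<and> j \<noteq> i \<and> crossing (w ! j) = crossing (w ! i))"

text \<open>
  Edge \<open>i\<close> leads from passage \<open>i\<close> to the cyclically next passage, so the base edge has the index
  \<open>length w - 1\<close>.  A dart \<open>(i, b)\<close> is edge \<open>i\<close> travelled in the direction of the word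
  (\<open>b = True\<close>) or against it (\<open>b = False\<close>).  Turning right at every crossing travels around the
  region to the right of the dart.
\<close>

fun turn_right :: "passage list \<Rightarrow> nat \<times> bool \<Rightarrow> nat \<times> bool" where
  "turn_right w (i, b) =
     (let n = length w; j = (if b then Suc i mod n else i); k = partner w j
      in if from_left (w ! j) = b then (k, True) else ((k + n - 1) mod n, False))"

definition face :: "passage list \<Rightarrow> nat \<times> bool \<Rightarrow> (nat \<times> bool) set" where
  "face w d = {(turn_right w ^^ m) d | m. True}"

definition faces :: "passage list \<Rightarrow> (nat \<times> bool) set set" where
  "faces w = face w ` ({..<length w} \<times> UNIV)"

definition unbounded_face :: "passage list \<Rightarrow> (nat \<times> bool) set" where
  "unbounded_face w = face w (length w - 1, True)"

text \<open>
  With \<open>n\<close> crossings there are \<open>n\<close> vertices and \<open>2 * n\<close> edges, so Euler's formula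
  \<open>V - E + F = 2\<close> reads \<open>F = n + 2\<close>.  The empty word is the circle without double points.
\<close>

definition planar :: "passage list \<Rightarrow> bool" where
  "planar w \<longleftrightarrow> w = [] \<or> card (faces w) = length w div 2 + 2"

definition virtual_diagram :: "passage list \<Rightarrow> bool" where
  "virtual_diagram w \<longleftrightarrow> gauss_word w \<and> planar w"


section \<open>Generalized Reidemeister moves\<close>

text \<open>
  The three pairs are the passages of the three strands of a triangle.  If some strand is virtual
  at both of its crossings, this is VRIII or the mixed move, according to the kind of the third
  crossing.  The classical RIII needs a strand lying over the two others.  The remaining case,
  exactly one virtual crossing, is one of the forbidden moves.
\<close>

definition triangle_levels :: "(passage \<times> passage) set \<Rightarrow> bool" where
  "triangle_levels T \<longleftrightarrow>
     (\<exists>(p, q)\<in>T. level p = Virtual \<and> level q = Virtual) \<or>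
     (\<exists>(p, q)\<in>T. level p = Over \<and> level q = Over) \<and>
     (\<forall>(p, q)\<in>T. level p \<noteq> Virtual \<and> level q \<noteq> Virtual)"

text \<open>
  The rules below are only used between diagrams (see \<open>diagram_step\<close>), so that the new passages in
  \<open>R1\<close> and \<open>R2\<close> belong to new crossings and have matching levels and directions, and so that the
  two strands in \<open>R2\<close> are adjacent to a common region.  Virtual and classical versions of
  these moves are distinguished by the levels alone.  In \<open>R2\<close> the condition on \<open>from_left\<close> says
  that the second strand crosses the first one and then returns.  In all rules the base edge stays
  outside the disc in which the move takes place.
\<close>

inductive move :: "passage list \<Rightarrow> passage list \<Rightarrow> bool" where
  rename: "inj_on f (crossing ` set w) \<Longrightarrow>
    move w (map (\<lambda>p. Passage (f (crossing p)) (level p) (from_left p)) w)"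
| rebase_forward: "(i, True) \<in> unbounded_face w \<Longrightarrow> move w (rotate (Suc i) w)"
| rebase_backward: "(i, False) \<in> unbounded_face w \<Longrightarrow> move w (rev (rotate (Suc i) w))"
| R1: "crossing p = crossing q \<Longrightarrow> move (A @ B) (A @ [p, q] @ B)"
| R2: "\<lbrakk>crossing p1 \<noteq> crossing p2;
        {crossing q1, crossing q2} = {crossing p1, crossing p2};
        level p1 = level p2; from_left p1 \<noteq> from_left p2\<rbrakk> \<Longrightarrow>
    move (A @ B @ C) (A @ [p1, p2] @ B @ [q1, q2] @ C)"
| R3: "\<lbrakk>w = A @ [p1, p2] @ B @ [q1, q2] @ C @ [r1, r2] @ D;
        card (crossing ` {p1, p2, q1, q2, r1, r2}) = 3;
        F \<in> faces w;
        fst ` F = {length A, length (A @ [p1, p2] @ B), length (A @ [p1, p2] @ B @ [q1, q2] @ C)};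
        triangle_levels {(p1, p2), (q1, q2), (r1, r2)}\<rbrakk> \<Longrightarrow>
    move w (A @ [p2, p1] @ B @ [q2, q1] @ C @ [r2, r1] @ D)"

definition diagram_step :: "passage list \<Rightarrow> passage list \<Rightarrow> bool" where
  "diagram_step w w' \<longleftrightarrow> virtual_diagram w \<and> virtual_diagram w' \<and> move w w'"

definition virtual_equiv :: "(passage list \<times> passage list) set" where
  "virtual_equiv = {(w, w'). virtual_diagram w \<and> virtual_diagram w' \<and> equivclp diagram_step w w'}"

definition virtual_knots :: "passage list set set" where
  "virtual_knots = Collect virtual_diagram // virtual_equiv"


section \<open>Arc shift moves\<close>

text \<open>
  The arc passes through \<open>x\<close> and then \<open>y\<close>.  It is kept in place and traversed backwards, so at both
  crossings exactly one of the two strands is reversed: \<open>from_left\<close> changes in both passages of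
  each crossing.  The strand joining the end of \<open>A\<close> to the far end of the arc runs parallel to the
  arc on one side of it (on the left if \<open>s\<close>, on the right otherwise) and meets the two transverse
  strands in new virtual crossings \<open>a1\<close> and \<open>a2\<close>.  The strand joining the near end of the arc to the
  beginning of \<open>B\<close> runs on the other side and meets them in \<open>b1\<close> and \<open>b2\<close>.  Each transverse
  strand thus passes through three crossings in place of one.
\<close>

definition flip :: "passage \<Rightarrow> passage" where
  "flip p = Passage (crossing p) (level p) (\<not> from_left p)"

definition transverse :: "bool \<Rightarrow> passage \<Rightarrow> nat \<Rightarrow> nat \<Rightarrow> passage \<Rightarrow> passage list" where
  "transverse s x a b p =
     (let t = [Passage a Virtual (\<not> from_left x), flip p, Passage b Virtual (\<not> from_left x)]
      in if from_left x = s then t else rev t)"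

inductive arc_shift :: "passage list \<Rightarrow> passage list \<Rightarrow> bool" where
  "\<lbrakk>w = A @ [x, y] @ B; virtual_diagram w; crossing x \<noteq> crossing y;
    distinct [a1, a2, b1, b2]; {a1, a2, b1, b2} \<inter> crossing ` set w = {};
    g = (\<lambda>p. if crossing p = crossing x then transverse s x a1 b1 p
             else if crossing p = crossing y then transverse s y a2 b2 p
             else [p])\<rbrakk> \<Longrightarrow>
   arc_shift w
     (concat (map g A) @
      [Passage a1 Virtual (from_left x), Passage a2 Virtual (from_left y), flip y, flip x,
       Passage b1 Virtual (from_left x), Passage b2 Virtual (from_left y)] @
      concat (map g B))"

definition arc_shift_rel :: "(passage list \<times> passage list) set" where
  "arc_shift_rel = {(w, w'). arc_shift w w'}"

definition arc_shift_distance :: "passage list set \<Rightarrow> passage list set \<Rightarrow> enat" where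
  "arc_shift_distance K L =
     Inf {enat n | n. \<exists>w\<in>K. \<exists>w'\<in>L. (w, w') \<in> (virtual_equiv O arc_shift_rel) ^^ n O virtual_equiv}"

end

theory Submission
  imports Defs "HOL-Combinatorics.Transposition"
begin

text \<open>
  The knots form a crocheted chain. A \<^emph>\<open>tie\<close> takes a diagram with two edges on
  a common region, the base edge and a second one, pulls a loop out of each of them over a new
  strand, and clasps the two loops with each other by four crossings that are alternately virtual
  and classical. Ties can be nested, and \<open>chain n\<close> consists of \<open>n\<close>
  nested ties around a diagram of the virtual trefoil (\<open>lock\<close>). The family of the
  theorem is \<open>chain (2 * t)\<close>.

  \<^emph>\<open>One arc shift is enough.\<close> Let \<open>m < n\<close>, and consider the tie
  of \<open>chain n\<close> that makes \<open>chain (m + 1)\<close> out of \<open>chain m\<close>.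
  An arc shift on the two middle crossings of its clasp produces a clasp that Reidemeister moves
  of the second kind undo completely (\<open>arc_shift_tied\<close>, \<open>fits_zigzag\<close>,
  \<open>untie\<close>). The two edges from which the next tie has pulled its loops are then the
  same edge, and all later ties unravel one after the other (\<open>tie_trivial\<close>,
  \<open>tower_trivial\<close>): what remains is \<open>chain m\<close>. A second arc shift at the
  same place yields a diagram that is again equivalent to \<open>chain n\<close>
  (\<open>arc_shift_zigzag\<close>, \<open>fits_double_zigzag\<close>), so one arc shift also
  leads from \<open>chain m\<close> to \<open>chain n\<close>. Hence any two members of the chain
  that are different as virtual knots have distance exactly one
  (\<open>arc_shift_distance_chain\<close>).

  \<^emph>\<open>Infinitely many of them are different.\<close> A coloring of a diagram by a
  quandle is surjective if its colors generate the quandle; having a surjective coloring by a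
  quandle or by its dual is invariant under all moves
  (\<open>quandle_quotient_virtual_equiv\<close>). The dual is needed since a change of the base
  edge may reverse the traversal. The quandles used are the linear ones on the integers modulo an
  odd \<open>m\<close> with operation \<open>2 * a - b\<close>. In a coloring of a tower of ties
  the color changes along the two halves by multiples of one number, the change inside the lock,
  and each tie transforms the two factors linearly (\<open>tower_drift\<close>). For \<open>2 * (k
  + 1)\<close> ties the closing condition says that \<open>m\<close> divides \<open>135 * 9 ^ k -
  124 * 8 ^ k\<close>, a strictly increasing sequence of odd numbers prime to 3. Taking these
  numbers as \<open>m\<close> distinguishes the knots (\<open>chain_not_equiv\<close>);
  coprimality to 3 excludes colorings by the dual quandle (\<open>chain_dual_coloring\<close>).

  \<^emph>\<open>All words are planar.\<close> Faces are orbits of the permutation that turns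
  right at each crossing. A Reidemeister insertion leads this permutation on a detour through the
  new crossings, so the faces are counted by comparing it with its first-return map to the old
  darts (\<open>card_orbits_first_return\<close>). Inserting a bigon across a region composes the
  first-return map with a transposition of two darts of the same orbit, which splits that orbit
  (\<open>card_orbits_transpose\<close>). All diagrams of the construction arise by such
  insertions.
\<close>

section \<open>Orbits and first returns\<close>

definition orbit :: "('a \<Rightarrow> 'a) \<Rightarrow> 'a \<Rightarrow> 'a set" where
  "orbit f x = {(f ^^ m) x | m. True}"

lemma orbit_refl: "x \<in> orbit f x"
  unfolding orbit_def by (auto intro: exI[of _ 0])

lemma orbitI: "(f ^^ m) x = y \<Longrightarrow> y \<in> orbit f x"
  unfolding orbit_def by blast

lemma orbit_step: "y \<in> orbit f x \<Longrightarrow> f y \<in> orbit f x"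
  unfolding orbit_def by (smt (verit) comp_apply funpow.simps(2) mem_Collect_eq)

lemma orbit_trans: "y \<in> orbit f x \<Longrightarrow> z \<in> orbit f y \<Longrightarrow> z \<in> orbit f x"
  unfolding orbit_def by (smt (verit) comp_apply funpow_add mem_Collect_eq)

lemma orbit_induct [consumes 1, case_names base step]:
  assumes "y \<in> orbit f x" "P x" "\<And>z. z \<in> orbit f x \<Longrightarrow> P z \<Longrightarrow> P (f z)"
  shows "P y"
proof -
  have "P ((f ^^ m) x)" for m
  proof (induction m)
    case (Suc m)
    have "(f ^^ m) x \<in> orbit f x" by (auto simp: orbit_def)
    with Suc assms(3) show ?case by simp
  qed (use assms in simp)
  with assms(1) show ?thesis by (auto simp: orbit_def)
qed

lemma orbit_subset: "f ` D \<subseteq> D \<Longrightarrow> x \<in> D \<Longrightarrow> orbit f x \<subseteq> D"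
  by (rule subsetI, erule orbit_induct) (assumption, blast)

lemma orbit_sym:
  assumes "finite D" "f ` D \<subseteq> D" "inj_on f D" "x \<in> D" "y \<in> orbit f x"
  shows "x \<in> orbit f y"
  using assms(5)
proof (induction rule: orbit_induct)
  case base
  show ?case by (rule orbit_refl)
next
  case (step z)
  have z: "z \<in> D" using orbit_subset[OF assms(2,4)] step by blast
  have "\<exists>k>0. (f ^^ k) z = z"
  proof -
    have sub: "f ` orbit f z \<subseteq> orbit f z" by (auto intro: orbit_step)
    have oD: "orbit f z \<subseteq> D" using orbit_subset[OF assms(2) z] .
    have "inj_on f (orbit f z)" using assms(3) oD inj_on_subset by blast
    then have "f ` orbit f z = orbit f z"
      using sub finite_subset[OF oD assms(1)] by (simp add: endo_inj_surj)
    then obtain u where u: "u \<in> orbit f z" "f u = z" using orbit_refl[of z f] by force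
    then obtain k where "u = (f ^^ k) z" by (auto simp: orbit_def)
    then have "(f ^^ Suc k) z = z" using u by simp
    then show ?thesis by blast
  qed
  then obtain k where k: "(f ^^ Suc k) z = z" using gr0_implies_Suc by blast
  have "(f ^^ k) (f z) = z" using k by (metis funpow_simps_right(2) o_apply)
  then have "z \<in> orbit f (f z)" by (rule orbitI)
  then show ?case using step(2) orbit_trans by fast
qed

lemma orbit_eq:
  assumes "finite D" "f ` D \<subseteq> D" "inj_on f D" "x \<in> D" "y \<in> orbit f x"
  shows "orbit f y = orbit f x"
  using assms orbit_sym[OF assms] by (blast intro: orbit_trans)

text \<open>
  The faces are defined with positions in the word; this transports them to passages.
\<close>

lemma orbit_conjugate:
  assumes "f ` D \<subseteq> D" "x \<in> D" "\<And>d. d \<in> D \<Longrightarrow> h (f d) = g (h d)"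
  shows "h ` orbit f x = orbit g (h x)"
proof -
  have 1: "h ((f ^^ m) x) = (g ^^ m) (h x) \<and> (f ^^ m) x \<in> D" for m
    by (induction m) (use assms in auto)
  then show ?thesis unfolding orbit_def by (auto simp: image_iff) metis
qed

text \<open>
  The iterates of \<open>d\<close> avoid \<open>D\<close> until \<open>e\<close> is reached; for
  \<open>e \<in> D\<close> this is the first return of \<open>d\<close> to \<open>D\<close>.
\<close>

definition returns :: "('a \<Rightarrow> 'a) \<Rightarrow> 'a set \<Rightarrow> 'a \<Rightarrow> 'a \<Rightarrow> bool" where
  "returns f D d e \<longleftrightarrow> (\<exists>k. (f ^^ Suc k) d = e \<and> (\<forall>j<k. (f ^^ Suc j) d \<notin> D))"

lemma returns_now: "f d = e \<Longrightarrow> returns f D d e"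
  unfolding returns_def by (rule exI[of _ 0]) simp

lemma returns_later:
  assumes "f d \<notin> D" "returns f D (f d) e"
  shows "returns f D d e"
proof -
  obtain k where k: "(f ^^ Suc k) (f d) = e" "\<forall>j<k. (f ^^ Suc j) (f d) \<notin> D"
    using assms(2) by (auto simp: returns_def)
  have "(f ^^ Suc (Suc k)) d = e" using k(1) by (metis funpow_simps_right(2) o_apply)
  moreover have "(f ^^ Suc j) d \<notin> D" if "j < Suc k" for j
  proof (cases j)
    case 0 then show ?thesis using assms(1) by simp
  next
    case (Suc i)
    then show ?thesis using k(2) that by (metis Suc_less_eq funpow_simps_right(2) o_apply)
  qed
  ultimately show ?thesis unfolding returns_def by blast
qed

text \<open>
  Passing to the first-return map cuts every orbit down to its part in \<open>D\<close>.
\<close>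

lemma orbit_first_return:
  assumes "g ` D \<subseteq> D" "\<And>d. d \<in> D \<Longrightarrow> returns f D d (g d)" "d \<in> D"
  shows "orbit f d \<inter> D = orbit g d"
proof
  show "orbit g d \<subseteq> orbit f d \<inter> D"
  proof
    fix y assume "y \<in> orbit g d"
    then show "y \<in> orbit f d \<inter> D"
    proof (induction rule: orbit_induct)
      case base
      show ?case using assms(3) orbit_refl[of d f] by simp
    next
      case (step z)
      then have "returns f D z (g z)" using assms(2) by simp
      then obtain k where "(f ^^ Suc k) z = g z" unfolding returns_def by blast
      then have "g z \<in> orbit f z" by (rule orbitI)
      then have "g z \<in> orbit f d" using step(2) orbit_trans[of z f d] by simp
      moreover have "g z \<in> D" using step(2) assms(1) by auto
      ultimately show ?case by simp
    qed
  qed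
next
  have "d \<in> D \<Longrightarrow> (f ^^ m) d \<in> D \<Longrightarrow> (f ^^ m) d \<in> orbit g d" for m d
  proof (induction m arbitrary: d rule: less_induct)
    case (less m)
    obtain k where k: "(f ^^ Suc k) d = g d" "\<forall>j<k. (f ^^ Suc j) d \<notin> D"
      using assms(2)[OF less(2)] by (auto simp: returns_def)
    show ?case
    proof (cases m)
      case 0
      then show ?thesis by (simp add: orbit_refl)
    next
      case (Suc j)
      have "\<not> j < k" using k(2) less(3) unfolding Suc by blast
      then have le: "Suc k \<le> m" using Suc by simp
      have "(f ^^ (m - Suc k + Suc k)) d = (f ^^ (m - Suc k)) ((f ^^ Suc k) d)"
        unfolding funpow_add comp_apply ..
      then have e: "(f ^^ m) d = (f ^^ (m - Suc k)) (g d)"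
        unfolding k(1) using le by simp
      have gd: "g d \<in> D" using less(2) assms(1) by blast
      have lt: "m - Suc k < m" using le by simp
      have "(f ^^ (m - Suc k)) (g d) \<in> orbit g (g d)"
        by (rule less(1)[OF lt gd]) (use less(3) e in simp)
      moreover have "g d \<in> orbit g d" using orbit_step[OF orbit_refl] .
      ultimately show ?thesis using e orbit_trans[of "g d" g d] by simp
    qed
  qed
  then show "orbit f d \<inter> D \<subseteq> orbit g d" using assms(3) by (fastforce simp: orbit_def[of f])
qed

text \<open>
  The points outside \<open>D\<close> split into those visited on an excursion from
  \<open>D\<close> (in \<open>C\<close>), which add no orbit, and those that never meet
  \<open>D\<close> (in \<open>E\<close>), whose orbits come on top.
\<close>

lemma card_orbits_first_return:
  assumes fin: "finite D'" and f: "f ` D' \<subseteq> D'" "inj_on f D'"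
    and D': "D' = D \<union> C \<union> E" and g: "g ` D \<subseteq> D"
    and ret: "\<And>d. d \<in> D \<Longrightarrow> returns f D d (g d)"
    and C: "\<And>c. c \<in> C \<Longrightarrow> \<exists>d\<in>D. c \<in> orbit f d"
    and E: "\<And>e. e \<in> E \<Longrightarrow> orbit f e \<inter> D = {}"
  shows "card (orbit f ` D') = card (orbit g ` D) + card (orbit f ` E)"
proof -
  note eq = orbit_eq[OF fin f]
  have "orbit f ` C \<subseteq> orbit f ` D"
  proof
    fix z assume "z \<in> orbit f ` C"
    then obtain c where c: "c \<in> C" "z = orbit f c" by blast
    then obtain d where "d \<in> D" "c \<in> orbit f d" using C by blast
    then show "z \<in> orbit f ` D" using eq[of d c] c D' by auto
  qed
  then have 1: "orbit f ` D' = orbit f ` D \<union> orbit f ` E" using D' by auto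
  have 2: "orbit f ` D \<inter> orbit f ` E = {}"
    using E orbit_refl by (fastforce simp: disjoint_iff)
  have fr: "orbit f d \<inter> D = orbit g d" if "d \<in> D" for d
    using orbit_first_return[OF g ret that] .
  have "bij_betw (\<lambda>X. X \<inter> D) (orbit f ` D) (orbit g ` D)"
    unfolding bij_betw_def
  proof
    show "inj_on (\<lambda>X. X \<inter> D) (orbit f ` D)"
    proof (rule inj_onI, clarsimp)
      fix x y assume xy: "x \<in> D" "y \<in> D" "orbit f x \<inter> D = orbit f y \<inter> D"
      then have "x \<in> orbit f y" using orbit_refl[of x f] by auto
      then show "orbit f x = orbit f y" using eq[of y x] xy D' by auto
    qed
    show "(\<lambda>X. X \<inter> D) ` orbit f ` D = orbit g ` D" using fr by (auto simp: image_image)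
  qed
  then have 3: "card (orbit f ` D) = card (orbit g ` D)" by (rule bij_betw_same_card)
  have "finite D" "finite E" using fin D' by auto
  then show ?thesis using 1 2 3 by (simp add: card_Un_disjoint)
qed

text \<open>
  The orbit of \<open>x\<close> is a cycle through \<open>y\<close>. Exchanging the arrows into
  \<open>x\<close> and \<open>y\<close> closes up the stretch from \<open>x\<close> to just before
  \<open>y\<close> and the stretch from \<open>y\<close> to just before \<open>x\<close> as two
  separate cycles.
\<close>

lemma card_orbits_transpose:
  assumes fin: "finite D" and f: "f ` D \<subseteq> D" "inj_on f D"
    and xy: "x \<in> D" "x \<noteq> y" "y \<in> orbit f x"
  shows "card (orbit (\<lambda>d. transpose x y (f d)) ` D) = card (orbit f ` D) + 1"
proof -
  define g where "g = (\<lambda>d. transpose x y (f d))"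
  note eqf = orbit_eq[OF fin f]
  define X where "X = orbit f x"
  have XD: "X \<subseteq> D" unfolding X_def using orbit_subset[OF f(1) xy(1)] .
  have y: "y \<in> D" "y \<in> X" "x \<in> X" using xy XD orbit_refl[of x f] unfolding X_def by blast+
  have gD: "g ` D \<subseteq> D" using f(1) xy(1) y(1) by (auto simp: g_def transpose_def)
  have gi: "inj_on g D" using f(2) by (auto simp: g_def inj_on_def dest!: transpose_eq_imp_eq)
  note eqg = orbit_eq[OF fin gD gi]
  have gX: "g ` X \<subseteq> X" using y orbit_step[of _ f x] unfolding g_def X_def[symmetric] transpose_def by auto
  have out: "orbit g z = orbit f z" if "z \<in> D - X" for z
  proof -
    have o: "orbit f z \<inter> X = {}"
    proof (rule ccontr)
      assume "orbit f z \<inter> X \<noteq> {}"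
      then obtain u where u: "u \<in> orbit f z" "u \<in> X" by blast
      have "orbit f u = orbit f z" using eqf[of z u] that u(1) by blast
      moreover have "orbit f u = X" unfolding X_def by (rule eqf[OF xy(1)]) (use u(2) X_def in blast)
      ultimately
      have "z \<in> X" using orbit_refl[of z f] by simp
      then show False using that by simp
    qed
    have "(g ^^ m) z = (f ^^ m) z" for m
    proof (induction m)
      case (Suc m)
      have "f ((f ^^ m) z) \<in> orbit f z" by (rule orbitI[of "Suc m"]) simp
      then have "f ((f ^^ m) z) \<noteq> x" "f ((f ^^ m) z) \<noteq> y" using o y by auto
      then show ?case using Suc by (simp add: g_def)
    qed simp
    then show ?thesis by (simp add: orbit_def)
  qed
  \<comment> \<open>Following \<open>g\<close> from \<open>x\<close> means following \<open>f\<close> until just before \<open>y\<close>, and then jumping back to \<open>x\<close>.\<close>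
  have yn: "y \<notin> orbit g x"
  proof -
    obtain k where "(f ^^ k) x = y" using xy(3) by (auto simp: orbit_def)
    then have ex: "\<exists>k. (f ^^ k) x = y" by blast
    define k where "k = (LEAST k. (f ^^ k) x = y)"
    have k: "(f ^^ k) x = y" "\<And>j. j < k \<Longrightarrow> (f ^^ j) x \<noteq> y"
      using LeastI_ex[OF ex] not_less_Least k_def by auto
    have k0: "k > 0" using k(1) xy(2) by (cases k) auto
    define A where "A = {(f ^^ j) x | j. j < k}"
    have "g z \<in> A" if zA: "z \<in> A" for z
    proof -
      obtain j where j: "z = (f ^^ j) x" "j < k" using zA unfolding A_def by blast
      show ?thesis
      proof (cases "Suc j = k")
        case True
        then have "f z = y" using k j by auto
        then have "g z = x" by (simp add: g_def)
        then show ?thesis using k0 unfolding A_def by (metis (mono_tags, lifting) funpow_0 mem_Collect_eq)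
      next
        case False
        then have s: "Suc j < k" using j by simp
        have "f z \<noteq> y" using k(2)[OF s] j by simp
        moreover have "f z \<noteq> x"
        proof
          assume "f z = x"
          then have "(f ^^ Suc j) x = x" using j by simp
          then have "(f ^^ (k - Suc j)) x = (f ^^ (k - Suc j)) ((f ^^ Suc j) x)" by simp
          also have "\<dots> = y" using k(1) s
            by (metis comp_apply funpow_add le_add_diff_inverse2 less_imp_le_nat)
          finally show False using k(2)[of "k - Suc j"] s by auto
        qed
        ultimately have "g z = f z" by (simp add: g_def)
        then have "g z = (f ^^ Suc j) x" using j by simp
        then show ?thesis using s unfolding A_def by blast
      qed
    qed
    then have gA: "g ` A \<subseteq> A" by blast
    have "(f ^^ 0) x \<in> A" using k0 unfolding A_def by blast
    then have "orbit g x \<subseteq> A" using orbit_subset[OF gA] by simp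
    moreover have "y \<notin> A" using k(2) unfolding A_def by blast
    ultimately show ?thesis by blast
  qed
  have cov: "X \<subseteq> orbit g x \<union> orbit g y"
  proof
    fix z assume "z \<in> X"
    then show "z \<in> orbit g x \<union> orbit g y" unfolding X_def
    proof (induction rule: orbit_induct)
      case (step z)
      show ?case
      proof (cases "f z = x \<or> f z = y")
        case True then show ?thesis using orbit_refl[of x g] orbit_refl[of y g] by auto
      next
        case False
        then have "g z = f z" by (simp add: g_def)
        then show ?thesis using step(2) orbit_step[of z g x] orbit_step[of z g y] by auto
      qed
    qed (simp add: orbit_refl)
  qed
  have gXi: "orbit g ` X = {orbit g x, orbit g y}"
  proof
    show "orbit g ` X \<subseteq> {orbit g x, orbit g y}"
    proof (rule image_subsetI)
      fix z assume "z \<in> X"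
      then have "z \<in> orbit g x \<or> z \<in> orbit g y" using cov by blast
      then show "orbit g z \<in> {orbit g x, orbit g y}"
        using eqg[OF xy(1), of z] eqg[OF y(1), of z] by fast
    qed
    show "{orbit g x, orbit g y} \<subseteq> orbit g ` X" using y by simp
  qed
  have ne: "orbit g x \<noteq> orbit g y" using yn orbit_refl[of y g] by blast
  have sub: "orbit g z \<subseteq> X" if "z \<in> X" for z using orbit_subset[OF gX that] .
  have "orbit f z = X" if "z \<in> X" for z
    unfolding X_def by (rule eqf[OF xy(1)]) (use that X_def in blast)
  then have fX: "orbit f ` X = {X}" using y by auto
  have D: "D = X \<union> (D - X)" using XD by blast
  have dis: "orbit f z \<noteq> X" "orbit f z \<noteq> orbit g x" "orbit f z \<noteq> orbit g y" if "z \<in> D - X" for z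
    using that orbit_refl[of z f] sub[OF y(3)] sub[OF y(2)] by blast+
  have "orbit g ` D = {orbit g x, orbit g y} \<union> orbit f ` (D - X)"
  proof -
    have "orbit g ` D = orbit g ` X \<union> orbit g ` (D - X)" using D by (metis image_Un)
    moreover have "orbit g ` (D - X) = orbit f ` (D - X)" using out by (rule image_cong[OF refl])
    ultimately show ?thesis using gXi by simp
  qed
  moreover have "card ({orbit g x, orbit g y} \<union> orbit f ` (D - X)) = 2 + card (orbit f ` (D - X))"
    using dis fin ne by (subst card_Un_disjoint) auto
  moreover have "orbit f ` D = {X} \<union> orbit f ` (D - X)"
    using fX D by (metis image_Un)
  moreover have "card ({X} \<union> orbit f ` (D - X)) = 1 + card (orbit f ` (D - X))"
    using dis fin by (subst card_Un_disjoint) auto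
  ultimately show ?thesis unfolding g_def by simp
qed

section \<open>Gauss words as sets of passages\<close>

text \<open>
  The other passage through the same crossing.
\<close>

definition opp :: "passage \<Rightarrow> passage" where
  "opp p = Passage (crossing p) (opposite (level p)) (\<not> from_left p)"

lemma opposite_opposite [simp]: "opposite (opposite l) = l"
  by (cases l) auto

lemma opp_simps [simp]:
  "opp (opp p) = p" "crossing (opp p) = crossing p" "from_left (opp p) = (\<not> from_left p)"
  "level (opp p) = opposite (level p)" "opp p \<noteq> p" "p \<noteq> opp p"
  by (cases p; simp add: opp_def)+

lemma opp_Passage [simp]: "opp (Passage n l b) = Passage n (opposite l) (\<not> b)"
  by (simp add: opp_def)

lemma opp_eq_iff [simp]: "opp p = opp q \<longleftrightarrow> p = q"
  by (metis opp_simps(1))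

text \<open>
  Positions and cardinalities are awkward when words are cut and glued. In a Gauss word each
  passage occurs once, so the word is determined as a cyclic order on a set of passages closed
  under \<open>opp\<close>.
\<close>

lemma gauss_word_iff:
  "gauss_word w \<longleftrightarrow> distinct w \<and> (\<forall>p\<in>set w. opp p \<in> set w) \<and>
     (\<forall>p\<in>set w. \<forall>q\<in>set w. crossing p = crossing q \<longrightarrow> q = p \<or> q = opp p)"
  (is "?L \<longleftrightarrow> ?R")
proof
  assume L: ?L
  have opp: "w ! j = opp (w ! i)"
    if "i < length w" "j < length w" "i \<noteq> j" "crossing (w ! i) = crossing (w ! j)" for i j
  proof -
    have "level (w ! j) = opposite (level (w ! i)) \<and> from_left (w ! j) = (\<not> from_left (w ! i))"
      using L that unfolding gauss_word_def by blast
    then show ?thesis using that(4) by (cases "w ! j") (simp add: opp_def)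
  qed
  have "distinct w"
    unfolding distinct_conv_nth using opp opp_simps(6) by metis
  moreover have "opp p \<in> set w" if pw: "p \<in> set w" for p
  proof -
    obtain i where i: "i < length w" "p = w ! i" using pw by (auto simp: in_set_conv_nth)
    have "card {j. j < length w \<and> crossing (w ! j) = crossing (w ! i)} = 2" (is "card ?S = 2")
      using L i unfolding gauss_word_def by blast
    then obtain j where "j \<in> ?S" "j \<noteq> i"
      by (metis (no_types, lifting) card_2_iff' )
    then have "j < length w" "w ! j = opp p" using opp[of i j] i by auto
    then show ?thesis using nth_mem[of j w] by simp
  qed
  moreover have "q = p \<or> q = opp p" if "p \<in> set w" "q \<in> set w" "crossing p = crossing q" for p q
    using that opp by (metis in_set_conv_nth)
  ultimately show ?R by blast
next
  assume R: ?R
  then have d: "distinct w" by blast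
  have ex: "\<exists>j<length w. j \<noteq> i \<and> w ! j = opp (w ! i) \<and>
      {k. k < length w \<and> crossing (w ! k) = crossing (w ! i)} = {i, j}" if i: "i < length w" for i
  proof -
    obtain j where j: "j < length w" "w ! j = opp (w ! i)"
      using R i by (metis in_set_conv_nth nth_mem)
    have "j \<noteq> i" using j opp_simps(5) by metis
    moreover have "k = i \<or> k = j" if "k < length w" "crossing (w ! k) = crossing (w ! i)" for k
      using R i j that d by (metis nth_eq_iff_index_eq nth_mem)
    ultimately show ?thesis using i j by (intro exI[of _ j]) auto
  qed
  show ?L unfolding gauss_word_def
  proof (intro conjI allI impI)
    fix i assume "i < length w"
    with ex[OF this] show "card {j. j < length w \<and> crossing (w ! j) = crossing (w ! i)} = 2"
      by (metis (no_types, lifting) card_2_iff)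
  next
    fix i j assume a: "i < length w" "j < length w" "i \<noteq> j \<and> crossing (w ! i) = crossing (w ! j)"
    then have "w ! j = w ! i \<or> w ! j = opp (w ! i)" using R by (metis nth_mem)
    then have "w ! j = opp (w ! i)" using a d by (metis nth_eq_iff_index_eq)
    then show "level (w ! j) = opposite (level (w ! i))"
      "from_left (w ! j) = (\<not> from_left (w ! i))" by auto
  qed
qed

lemma nth_partner:
  assumes "gauss_word w" "i < length w"
  shows "partner w i < length w" "w ! partner w i = opp (w ! i)"
proof -
  have g: "distinct w" "opp (w ! i) \<in> set w"
    "\<And>p q. p \<in> set w \<Longrightarrow> q \<in> set w \<Longrightarrow> crossing p = crossing q \<Longrightarrow> q = p \<or> q = opp p"
    using assms gauss_word_iff by (auto simp: gauss_word_iff)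
  obtain j where j: "j < length w" "w ! j = opp (w ! i)"
    using g(2) by (metis in_set_conv_nth)
  have "partner w i = j" unfolding partner_def
  proof (rule the_equality)
    show "j < length w \<and> j \<noteq> i \<and> crossing (w ! j) = crossing (w ! i)"
      using j opp_simps(5) by (metis opp_simps(2))
  next
    fix k assume "k < length w \<and> k \<noteq> i \<and> crossing (w ! k) = crossing (w ! i)"
    then show "k = j" using g j assms(2) by (metis nth_eq_iff_index_eq nth_mem)
  qed
  then show "partner w i < length w" "w ! partner w i = opp (w ! i)" using j by auto
qed

text \<open>
  Cyclic successor of a passage in a word without repetitions.
\<close>

definition nxt :: "'a list \<Rightarrow> 'a \<Rightarrow> 'a" where
  "nxt w p = (case dropWhile (\<lambda>z. z \<noteq> p) w of _ # q # _ \<Rightarrow> q | _ \<Rightarrow> hd w)"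

definition prv :: "'a list \<Rightarrow> 'a \<Rightarrow> 'a" where
  "prv w = nxt (rev w)"

lemma nxt_middle: "p \<notin> set A \<Longrightarrow> nxt (A @ p # q # B) p = q"
proof -
  assume "p \<notin> set A"
  then have "dropWhile (\<lambda>z. z \<noteq> p) (A @ p # q # B) = p # q # B"
    by (subst dropWhile_append2) auto
  then show ?thesis by (simp add: nxt_def)
qed

lemma nxt_end: "p \<notin> set A \<Longrightarrow> nxt (A @ [p]) p = hd (A @ [p])"
proof -
  assume "p \<notin> set A"
  then have "dropWhile (\<lambda>z. z \<noteq> p) (A @ [p]) = [p]"
    by (subst dropWhile_append2) auto
  then show ?thesis by (simp add: nxt_def)
qed

lemma nxt_nth:
  assumes "distinct w" "i < length w"
  shows "nxt w (w ! i) = w ! (Suc i mod length w)"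
proof -
  have n: "w ! i \<notin> set (take i w)"
    using assms by (auto simp: in_set_conv_nth nth_eq_iff_index_eq)
  show ?thesis
  proof (cases "Suc i < length w")
    case True
    then have "w = take i w @ w ! i # w ! Suc i # drop (Suc (Suc i)) w"
      by (metis Cons_nth_drop_Suc Suc_lessD append_take_drop_id)
    then show ?thesis using nxt_middle[OF n] True by (metis mod_less)
  next
    case False
    then have l: "Suc i = length w" using assms by simp
    then have w: "w = take i w @ [w ! i]"
      by (metis assms(2) order_refl take_Suc_conv_app_nth take_all)
    have "nxt w (w ! i) = hd w" using nxt_end[OF n] w by metis
    then show ?thesis using l by (metis assms(2) hd_conv_nth list.size(3) mod_self not_less_zero)
  qed
qed

lemma prv_nth:
  assumes "distinct w" "i < length w"
  shows "prv w (w ! i) = w ! ((i + length w - 1) mod length w)"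
proof -
  define n where "n = length w"
  have i: "i < n" using assms n_def by simp
  have w: "w ! i = rev w ! (n - 1 - i)" using i by (simp add: rev_nth n_def)
  have "prv w (w ! i) = rev w ! (Suc (n - 1 - i) mod n)"
    unfolding prv_def w using nxt_nth[of "rev w" "n - 1 - i"] assms i n_def by simp
  also have "Suc (n - 1 - i) = n - i" using i by simp
  also have "rev w ! ((n - i) mod n) = w ! ((i + n - 1) mod n)"
  proof (cases i)
    case 0
    then show ?thesis using i by (simp add: rev_nth n_def)
  next
    case (Suc k)
    have "(i + n - 1) mod n = k" using Suc i by simp
    moreover have "(n - i) mod n = n - i" using Suc i by simp
    ultimately show ?thesis using i Suc by (simp add: rev_nth n_def)
  qed
  finally show ?thesis by (simp add: n_def)
qed

lemma nxt_prv:
  assumes "distinct w" "p \<in> set w"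
  shows "nxt w p \<in> set w" "prv w p \<in> set w" "nxt w (prv w p) = p" "prv w (nxt w p) = p"
proof -
  obtain i where i: "i < length w" "p = w ! i" using assms by (auto simp: in_set_conv_nth)
  define n where "n = length w"
  have n: "n > 0" "i < n" using i n_def by auto
  show "nxt w p \<in> set w" "prv w p \<in> set w"
    using nxt_nth[OF assms(1) i(1)] prv_nth[OF assms(1) i(1)] i n n_def by auto
  have "Suc ((i + n - 1) mod n) mod n = Suc (i + n - 1) mod n" by (simp add: mod_Suc_eq)
  also have "\<dots> = i" using n by simp
  finally show "nxt w (prv w p) = p"
    using prv_nth[OF assms(1) i(1)] nxt_nth[OF assms(1), of "(i + n - 1) mod n"] n i n_def by simp
  have "(Suc i mod n + n - 1) mod n = i"
  proof (cases "Suc i = n")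
    case True then show ?thesis using n by auto
  next
    case False then show ?thesis using n by auto
  qed
  then show "prv w (nxt w p) = p"
    using nxt_nth[OF assms(1) i(1)] prv_nth[OF assms(1), of "Suc i mod n"] n i n_def by simp
qed

lemma nxt_rotate:
  assumes "distinct (A @ B)" "p \<in> set (A @ B)"
  shows "nxt (B @ A) p = nxt (A @ B) p"
proof -
  define w where "w = A @ B"
  have r: "B @ A = rotate (length A) w" by (simp add: w_def rotate_append)
  obtain i where i: "i < length w" "p = w ! i" using assms w_def by (metis in_set_conv_nth)
  define n where "n = length w"
  have n: "n > 0" using i n_def by auto
  define k where "k = (i + (n - length A)) mod n"
  have k: "k < n" using n by (simp add: k_def)
  have a: "length A \<le> n" by (simp add: n_def w_def)
  have e: "(length A + k) mod n = i"
  proof -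
    have "(length A + k) mod n = (length A + (i + (n - length A))) mod n"
      by (simp add: k_def mod_add_right_eq)
    also have "length A + (i + (n - length A)) = i + n" using a by simp
    finally show ?thesis using i n_def by simp
  qed
  have p: "p = rotate (length A) w ! k"
    using nth_rotate[of k w "length A"] k e i n_def by simp
  have "nxt (B @ A) p = rotate (length A) w ! (Suc k mod n)"
    unfolding r p using nxt_nth[of "rotate (length A) w" k] assms k n_def w_def by simp
  also have "\<dots> = w ! ((length A + Suc k mod n) mod n)"
    using nth_rotate[of "Suc k mod n" w "length A"] n n_def by simp
  also have "(length A + Suc k mod n) mod n = Suc ((length A + k) mod n) mod n"
    by (simp add: mod_simps)
  also have "\<dots> = Suc i mod n" using e by simp
  finally show ?thesis using nxt_nth[of w i] assms i n_def w_def by simp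
qed

section \<open>Faces as orbits of darts named by passages\<close>

text \<open>
  A dart is named here by the passage it arrives at, together with its direction; \<open>n\<close>
  and \<open>p\<close> give the next and the previous passage. In this form the turn depends only
  on the cyclic order, not on positions, and an insertion changes it only near the new passages.
\<close>

definition turning :: "(passage \<Rightarrow> passage) \<Rightarrow> (passage \<Rightarrow> passage) \<Rightarrow> passage \<times> bool \<Rightarrow> passage \<times> bool" where
  "turning n p d = (if from_left (fst d) = snd d then (n (opp (fst d)), True) else (p (opp (fst d)), False))"

definition cyclic :: "passage set \<Rightarrow> (passage \<Rightarrow> passage) \<Rightarrow> (passage \<Rightarrow> passage) \<Rightarrow> bool" where
  "cyclic S n p \<longleftrightarrow> finite S \<and> opp ` S \<subseteq> S \<and>
     (\<forall>z\<in>S. n z \<in> S \<and> p z \<in> S \<and> n (p z) = z \<and> p (n z) = z)"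

abbreviation turn :: "passage list \<Rightarrow> passage \<times> bool \<Rightarrow> passage \<times> bool" where
  "turn w \<equiv> turning (nxt w) (prv w)"

lemma turning_permutes:
  assumes "cyclic S n p"
  shows "turning n p ` (S \<times> UNIV) \<subseteq> S \<times> UNIV" "inj_on (turning n p) (S \<times> UNIV)"
proof -
  have o: "opp q \<in> S" if "q \<in> S" for q using assms that by (auto simp: cyclic_def)
  have c: "n z \<in> S" "p z \<in> S" "n (p z) = z" "p (n z) = z" if "z \<in> S" for z
    using assms that by (auto simp: cyclic_def)
  show "turning n p ` (S \<times> UNIV) \<subseteq> S \<times> UNIV" using o c by (auto simp: turning_def)
  show "inj_on (turning n p) (S \<times> UNIV)"
  proof (rule inj_onI)
    fix x y assume x: "x \<in> S \<times> UNIV" and y: "y \<in> S \<times> UNIV" and e: "turning n p x = turning n p y"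
    obtain q b where xq: "x = (q, b)" "q \<in> S" using x by auto
    obtain r c' where yq: "y = (r, c')" "r \<in> S" using y by auto
    have 1: "(from_left q = b) = (from_left r = c')"
      using e xq yq by (auto simp: turning_def split: if_splits)
    have "opp q = opp r"
    proof (cases "from_left q = b")
      case True
      then have "n (opp q) = n (opp r)" using e 1 unfolding xq yq turning_def by simp
      then show ?thesis using c(4)[OF o[OF xq(2)]] c(4)[OF o[OF yq(2)]] by metis
    next
      case False
      then have "p (opp q) = p (opp r)" using e 1 unfolding xq yq turning_def by simp
      then show ?thesis using c(3)[OF o[OF xq(2)]] c(3)[OF o[OF yq(2)]] by metis
    qed
    then have "q = r" by simp
    then show "x = y" using 1 xq yq by auto
  qed
qed

lemma cyclic_gauss_word: "gauss_word w \<Longrightarrow> cyclic (set w) (nxt w) (prv w)"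
  using nxt_prv by (auto simp: gauss_word_iff cyclic_def)

text \<open>
  The edge \<open>i\<close> travelled forwards arrives at passage \<open>Suc i\<close>, travelled
  backwards at passage \<open>i\<close>. This renaming of darts conjugates
  \<open>turn_right\<close> to \<open>turn\<close>.
\<close>

lemma card_faces:
  assumes "gauss_word w" "w \<noteq> []"
  shows "card (faces w) = card (orbit (turn w) ` (set w \<times> UNIV))"
proof -
  define n where "n = length w"
  have n: "n > 0" using assms n_def by simp
  define D :: "(nat \<times> bool) set" where "D = {..<n} \<times> UNIV"
  define h where "h = (\<lambda>(i, b). (w ! (if b then Suc i mod n else i), b :: bool))"
  have d: "distinct w" using assms gauss_word_iff by blast
  have T: "\<exists>j k. turn_right w x = (if from_left (w ! j) = snd x then (k, True) else ((k + n - 1) mod n, False)) \<and>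
      h x = (w ! j, snd x) \<and> j < n \<and> k < n \<and> w ! k = opp (w ! j)" if x: "x \<in> D" for x
  proof -
    obtain i b where ib: "x = (i, b)" "i < n" using x by (auto simp: D_def)
    define j where "j = (if b then Suc i mod n else i)"
    have j: "j < n" using ib n j_def by auto
    define k where "k = partner w j"
    have k: "k < n" "w ! k = opp (w ! j)"
      using nth_partner[OF assms(1), of j] j n_def k_def by auto
    have t: "turn_right w x = (if from_left (w ! j) = b then (k, True) else ((k + n - 1) mod n, False))"
      by (simp add: ib Let_def n_def[symmetric] j_def[symmetric] k_def[symmetric])
    have hx: "h x = (w ! j, b)" by (simp add: h_def ib j_def)
    show ?thesis
      by (rule exI[of _ j], rule exI[of _ k]) (use t hx j k in \<open>simp only: ib(1) snd_conv simp_thms\<close>)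
  qed
  have 1: "turn_right w ` D \<subseteq> D"
  proof (rule image_subsetI)
    fix x assume "x \<in> D"
    from T[OF this] obtain j k
      where "turn_right w x = (if from_left (w ! j) = snd x then (k, True) else ((k + n - 1) mod n, False))"
        "k < n" by blast
    then show "turn_right w x \<in> D" using n by (simp add: D_def)
  qed
  have 2: "h (turn_right w x) = turn w (h x)" if "x \<in> D" for x
  proof -
    from T[OF that] obtain j k
      where t: "turn_right w x = (if from_left (w ! j) = snd x then (k, True) else ((k + n - 1) mod n, False))"
        and hx: "h x = (w ! j, snd x)" and k: "j < n" "k < n" "w ! k = opp (w ! j)" by blast
    show ?thesis
      unfolding t hx using nxt_nth[OF d, of k] prv_nth[OF d, of k] k n_def
      by (simp add: h_def turning_def)
  qed
  have inj: "inj_on h D"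
  proof (rule inj_onI)
    fix x y assume x: "x \<in> D" and y: "y \<in> D" and e: "h x = h y"
    obtain i b where ib: "x = (i, b)" "i < n" using x by (auto simp: D_def)
    obtain k c where kc: "y = (k, c)" "k < n" using y by (auto simp: D_def)
    have bc: "b = c" using e ib kc by (simp add: h_def)
    have "(if b then Suc i mod n else i) = (if b then Suc k mod n else k)"
      using e bc ib kc n d by (simp add: h_def nth_eq_iff_index_eq n_def split: if_splits)
    moreover have "i = k" if "Suc i mod n = Suc k mod n"
      using that ib kc by (metis Suc_lessI mod_less mod_self nat.distinct(1) old.nat.inject)
    ultimately show "x = y" using bc ib kc by (auto split: if_splits)
  qed
  have img: "h ` D = set w \<times> UNIV"
  proof
    show "h ` D \<subseteq> set w \<times> UNIV" using n by (auto simp: h_def D_def n_def)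
    show "set w \<times> UNIV \<subseteq> h ` D"
    proof
      fix y assume y: "y \<in> set w \<times> (UNIV :: bool set)"
      then obtain k b where kb: "y = (w ! k, b)" "k < n" by (auto simp: in_set_conv_nth n_def)
      define i where "i = (if b then (k + n - 1) mod n else k)"
      have "(if b then Suc i mod n else i) = k"
        using kb n by (simp add: i_def mod_Suc_eq)
      then have "h (i, b) = y" using kb by (simp add: h_def)
      moreover have "(i, b) \<in> D" using kb n by (simp add: i_def D_def)
      ultimately show "y \<in> h ` D" by force
    qed
  qed
  have f: "faces w = orbit (turn_right w) ` D"
    by (auto simp: faces_def face_def orbit_def D_def n_def)
  have "(\<lambda>X. h ` X) ` faces w = orbit (turn w) ` (set w \<times> UNIV)"
    unfolding f img[symmetric] image_image
  proof (rule image_cong[OF refl])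
    fix x assume "x \<in> D"
    then show "h ` orbit (turn_right w) x = orbit (turn w) (h x)"
      by (intro orbit_conjugate[of "turn_right w" D x h "turn w"] 1 2)
  qed
  moreover have "inj_on (\<lambda>X. h ` X) (faces w)"
  proof -
    have "faces w \<subseteq> Pow D" unfolding f using orbit_subset[OF 1] by blast
    then show ?thesis using inj inj_on_image_Pow inj_on_subset by blast
  qed
  ultimately show ?thesis by (metis card_image)
qed

text \<open>
  The common part of all insertions. The edges from \<open>u\<close> to \<open>n u\<close> with
  \<open>u \<in> K\<close> are cut open, and new passages are put into the gaps. A dart that used
  such an edge now makes an excursion through the new crossings; \<open>t\<close> tells where it
  comes back, compared with where it would have arrived. The set \<open>E\<close> collects the
  darts of the faces that consist of new edges only.
\<close>

lemma card_orbits_cut_edges: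
  assumes S: "cyclic S n p" and S': "cyclic S' n' p'" and sub: "S \<subseteq> S'" "K \<subseteq> S"
    and cut: "\<And>u. u \<in> K \<Longrightarrow> n' u \<notin> S" "\<And>u. u \<in> K \<Longrightarrow> p' (n u) \<notin> S"
    and uncut: "\<And>u. u \<in> S - K \<Longrightarrow> n' u = n u"
    and ret: "\<And>u. u \<in> K \<Longrightarrow> returns (turning n' p') (S \<times> UNIV) (n' u, True) (t (n u, True))"
      "\<And>u. u \<in> K \<Longrightarrow> returns (turning n' p') (S \<times> UNIV) (p' (n u), False) (t (u, False))"
    and t: "t ` (S \<times> UNIV) \<subseteq> S \<times> UNIV"
      "\<And>u. u \<in> S - K \<Longrightarrow> t (n u, True) = (n u, True)" "\<And>u. u \<in> S - K \<Longrightarrow> t (u, False) = (u, False)"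
    and cov: "S' \<times> UNIV = S \<times> UNIV \<union> C \<union> E"
    and C: "\<And>c. c \<in> C \<Longrightarrow>
      \<exists>u\<in>K. c \<in> orbit (turning n' p') (n' u, True) \<or> c \<in> orbit (turning n' p') (p' (n u), False)"
    and E: "\<And>e. e \<in> E \<Longrightarrow> orbit (turning n' p') e \<inter> S \<times> UNIV = {}"
  shows "card (orbit (turning n' p') ` (S' \<times> UNIV)) =
      card (orbit (\<lambda>d. t (turning n p d)) ` (S \<times> UNIV)) + card (orbit (turning n' p') ` E)"
    and "\<And>d. d \<in> S \<times> UNIV \<Longrightarrow>
      orbit (turning n' p') d \<inter> S \<times> UNIV = orbit (\<lambda>d. t (turning n p d)) d"
proof -
  define f where "f = turning n' p'"
  define D where "D = S \<times> (UNIV :: bool set)"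
  have o: "opp q \<in> S" if "q \<in> S" for q using S that by (auto simp: cyclic_def)
  have c: "n z \<in> S" "p z \<in> S" "n (p z) = z" "p (n z) = z" if "z \<in> S" for z
    using S that by (auto simp: cyclic_def)
  have c': "n' z \<in> S'" "p' z \<in> S'" "n' (p' z) = z" "p' (n' z) = z" if "z \<in> S'" for z
    using S' that by (auto simp: cyclic_def)
  have uncut': "p' r = p r" if "r \<in> S" "p r \<notin> K" for r
  proof -
    have "n' (p r) = n (p r)" using uncut[of "p r"] c(2)[OF that(1)] that(2) by simp
    then show ?thesis using c'(4)[of "p r"] c(2,3)[OF that(1)] sub by auto
  qed
  note ret' = ret[folded f_def D_def]
  have r: "returns f D d (t (turning n p d))" if d: "d \<in> D" for d
  proof -
    obtain q b where qb: "d = (q, b)" "q \<in> S" using d by (auto simp: D_def)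
    show ?thesis
    proof (cases "from_left q = b")
      case True
      show ?thesis
      proof (cases "opp q \<in> K")
        case True
        have fd: "f d = (n' (opp q), True)" using \<open>from_left q = b\<close> qb by (simp add: f_def turning_def)
        have td: "t (turning n p d) = t (n (opp q), True)"
          using \<open>from_left q = b\<close> qb by (simp add: turning_def)
        have "f d \<notin> D" using cut(1)[OF True] fd by (simp add: D_def)
        moreover have "returns f D (f d) (t (turning n p d))" unfolding fd td by (rule ret'(1)[OF True])
        ultimately show ?thesis by (rule returns_later)
      next
        case False
        then have k: "opp q \<in> S - K" using o qb by blast
        show ?thesis
          by (rule returns_now) (use qb \<open>from_left q = b\<close> uncut[OF k] t(2)[OF k] in \<open>simp add: f_def turning_def\<close>)
      qed
    next
      case False
      define s where "s = p (opp q)"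
      have s: "s \<in> S" "n s = opp q" using c o qb s_def by auto
      have fd: "f d = (p' (n s), False)" using False qb s by (simp add: f_def turning_def)
      have td: "t (turning n p d) = t (s, False)" using False qb by (simp add: turning_def s_def)
      show ?thesis
      proof (cases "s \<in> K")
        case True
        have "f d \<notin> D" using cut(2)[OF True] fd by (simp add: D_def)
        moreover have "returns f D (f d) (t (turning n p d))" unfolding fd td by (rule ret'(2)[OF True])
        ultimately show ?thesis by (rule returns_later)
      next
        case False
        then have k: "s \<in> S - K" using s by blast
        have "p' (n s) = s" using uncut'[of "n s"] c(4)[OF s(1)] c(1)[OF s(1)] False by simp
        then show ?thesis unfolding td by (intro returns_now) (use fd t(3)[OF k] in simp)
      qed
    qed
  qed
  have g: "(\<lambda>d. t (turning n p d)) ` D \<subseteq> D"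
  proof (rule image_subsetI)
    fix d assume "d \<in> D"
    then have "turning n p d \<in> S \<times> UNIV"
      unfolding D_def by (rule subsetD[OF turning_permutes(1)[OF S] imageI])
    then show "t (turning n p d) \<in> D"
      unfolding D_def by (rule subsetD[OF t(1) imageI])
  qed
  have fin: "finite (S' \<times> (UNIV :: bool set))" using S' by (simp add: cyclic_def)
  have C': "\<exists>d\<in>D. x \<in> orbit f d" if x: "x \<in> C" for x
  proof -
    obtain u where u: "u \<in> K" "x \<in> orbit f (n' u, True) \<or> x \<in> orbit f (p' (n u), False)"
      using C[OF x] f_def by blast
    have uS: "u \<in> S" using u sub by blast
    have a: "f (opp u, from_left (opp u)) = (n' u, True)" by (simp add: f_def turning_def)
    have b: "f (opp (n u), \<not> from_left (opp (n u))) = (p' (n u), False)" by (simp add: f_def turning_def)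
    have m: "(opp u, from_left (opp u)) \<in> D" "(opp (n u), \<not> from_left (opp (n u))) \<in> D"
      using o c uS by (auto simp: D_def)
    have later: "x \<in> orbit f y" if "x \<in> orbit f (f y)" for y
      by (rule orbit_trans[OF orbit_step[OF orbit_refl] that])
    from u(2) show ?thesis
    proof
      assume "x \<in> orbit f (n' u, True)"
      then show ?thesis using later m(1) a by metis
    next
      assume "x \<in> orbit f (p' (n u), False)"
      then show ?thesis using later m(2) b by metis
    qed
  qed
  show "card (orbit (turning n' p') ` (S' \<times> UNIV)) =
      card (orbit (\<lambda>d. t (turning n p d)) ` (S \<times> UNIV)) + card (orbit (turning n' p') ` E)"
    unfolding f_def[symmetric] D_def[symmetric]
  proof (rule card_orbits_first_return[OF fin _ _ _ g r C'])
    show "f ` (S' \<times> UNIV) \<subseteq> S' \<times> UNIV" "inj_on f (S' \<times> UNIV)"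
      unfolding f_def by (rule turning_permutes[OF S'])+
    show "S' \<times> UNIV = D \<union> C \<union> E" using cov by (simp only: D_def)
    show "orbit f e \<inter> D = {}" if "e \<in> E" for e using E[OF that] by (simp only: f_def D_def)
  qed
  show "orbit (turning n' p') d \<inter> S \<times> UNIV = orbit (\<lambda>d. t (turning n p d)) d" if "d \<in> S \<times> UNIV" for d
    unfolding f_def[symmetric] D_def[symmetric]
    by (rule orbit_first_return[OF g r]) (use that in \<open>simp_all only: D_def\<close>)
qed

section \<open>Faces created by monogons, fingers and bigons\<close>

lemma returns2: "f d = d1 \<Longrightarrow> d1 \<notin> D \<Longrightarrow> f d1 = e \<Longrightarrow> returns f D d e"
  by (metis returns_now returns_later)

lemma returns4: "f d = d1 \<Longrightarrow> d1 \<notin> D \<Longrightarrow> f d1 = d2 \<Longrightarrow> d2 \<notin> D \<Longrightarrow> f d2 = d3 \<Longrightarrow> d3 \<notin> D \<Longrightarrow>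
    f d3 = e \<Longrightarrow> returns f D d e"
  by (metis returns_now returns_later)

lemma orbit_fixpoint: "f d = d \<Longrightarrow> orbit f d = {d}"
proof -
  assume "f d = d"
  then have "orbit f d \<subseteq> {d}" by (intro orbit_subset) auto
  then show ?thesis using orbit_refl[of d f] by blast
qed

lemma orbit_two_cycle: "f d = e \<Longrightarrow> f e = d \<Longrightarrow> orbit f d = {d, e}"
proof -
  assume a: "f d = e" "f e = d"
  then have "orbit f d \<subseteq> {d, e}" by (intro orbit_subset) auto
  then show ?thesis using orbit_refl[of d f] orbit_step[OF orbit_refl[of d f]] a by auto
qed

text \<open>
  The loop of the kink bounds the one new face; all other faces keep their identity.
\<close>

lemma card_orbits_monogon:
  assumes S: "cyclic S n p" and S': "cyclic S' n' p'" and u: "u \<in> S"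
    and Z: "S' = S \<union> {x, opp x}" "x \<notin> S" "opp x \<notin> S"
    and n': "n' u = x" "n' x = opp x" "n' (opp x) = n u"
    and uncut: "\<And>z. z \<in> S - {u} \<Longrightarrow> n' z = n z"
  shows "card (orbit (turning n' p') ` (S' \<times> UNIV)) = card (orbit (turning n p) ` (S \<times> UNIV)) + 1"
proof -
  define f where "f = turning n' p'"
  have nu: "n u \<in> S" using S u by (simp add: cyclic_def)
  have c': "p' (n' z) = z" if "z \<in> S'" for z using S' that by (auto simp: cyclic_def)
  have p': "p' x = u" "p' (opp x) = x" "p' (n u) = opp x"
    using c'[of u] c'[of x] c'[of "opp x"] n' Z u by auto
  have "\<exists>e. e \<in> {x, opp x} \<times> UNIV \<and> f e = e \<and>
    returns f (S \<times> UNIV) (x, True) (n u, True) \<and> returns f (S \<times> UNIV) (opp x, False) (u, False) \<and>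
    (\<forall>c\<in>{x, opp x} \<times> UNIV - {e}. c = (x, True) \<or> c = f (x, True) \<or> c = (opp x, False) \<or> c = f (opp x, False))"
  proof (cases "from_left x")
    case True
    have v: "f (x, True) = (n u, True)" "f (opp x, False) = (opp x, True)" "f (opp x, True) = (u, False)"
      "f (x, False) = (x, False)"
      using True n' p' by (auto simp: f_def turning_def)
    show ?thesis
      \<comment> \<open>The dart \<open>(x, False)\<close> runs around the new monogon; it is the opposite one on the other branch.\<close>
      by (intro exI[of _ "(x, False)"] conjI returns_now[of f, OF v(1)] returns2[of f, OF v(2) _ v(3)])
        (use v Z in \<open>auto simp: UNIV_bool\<close>)
  next
    case False
    have v: "f (x, True) = (x, False)" "f (x, False) = (n u, True)" "f (opp x, False) = (u, False)"
      "f (opp x, True) = (opp x, True)"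
      using False n' p' by (auto simp: f_def turning_def)
    show ?thesis
      by (intro exI[of _ "(opp x, True)"] conjI returns_now[of f, OF v(3)] returns2[of f, OF v(1) _ v(2)])
        (use v Z in \<open>auto simp: UNIV_bool\<close>)
  qed
  then obtain e where e: "e \<in> {x, opp x} \<times> UNIV" "f e = e"
    and r: "returns f (S \<times> UNIV) (x, True) (n u, True)" "returns f (S \<times> UNIV) (opp x, False) (u, False)"
    and cov: "\<forall>c\<in>{x, opp x} \<times> UNIV - {e}.
      c = (x, True) \<or> c = f (x, True) \<or> c = (opp x, False) \<or> c = f (opp x, False)"
    by (elim exE conjE) (rule that)
  have "card (orbit (turning n' p') ` (S' \<times> UNIV)) =
      card (orbit (\<lambda>d. id (turning n p d)) ` (S \<times> UNIV)) + card (orbit (turning n' p') ` {e})"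
  proof (rule card_orbits_cut_edges(1)[OF S S', where K = "{u}" and C = "{x, opp x} \<times> UNIV - {e}"])
    show "S' \<times> UNIV = S \<times> UNIV \<union> ({x, opp x} \<times> UNIV - {e}) \<union> {e}" using Z e by auto
    show "\<exists>u\<in>{u}. c \<in> orbit (turning n' p') (n' u, True) \<or> c \<in> orbit (turning n' p') (p' (n u), False)"
      if "c \<in> {x, opp x} \<times> UNIV - {e}" for c
      using bspec[OF cov that] n' p' orbit_refl[of _ f] orbit_step[OF orbit_refl[of _ f]]
      unfolding f_def[symmetric] by auto
    show "orbit (turning n' p') d \<inter> S \<times> UNIV = {}" if "d \<in> {e}" for d
      using that orbit_fixpoint[of f, OF e(2)] e(1) Z unfolding f_def[symmetric] by auto
  qed (use u Z n' p' uncut r in \<open>auto simp: f_def\<close>)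
  then show ?thesis by (simp add: id_def)
qed

text \<open>
  A strand is folded over its own beginning. The bend bounds a new monogon, the two branches bound
  a new bigon, and all other darts near the finger continue old faces.
\<close>

lemma card_orbits_finger:
  assumes S: "cyclic S n p" and S': "cyclic S' n' p'" and u: "u \<in> S"
    and Z: "S' = S \<union> {x1, x2, opp x1, opp x2}" "{x1, x2, opp x1, opp x2} \<inter> S = {}"
      "distinct [x1, x2, opp x1, opp x2]"
    and n': "n' u = x1" "n' x1 = x2" "n' x2 = opp x2" "n' (opp x2) = opp x1" "n' (opp x1) = n u"
    and uncut: "\<And>z. z \<in> S - {u} \<Longrightarrow> n' z = n z"
    and fl: "from_left x1 \<noteq> from_left x2"
  shows "card (orbit (turning n' p') ` (S' \<times> UNIV)) = card (orbit (turning n p) ` (S \<times> UNIV)) + 2"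
    and "\<And>d. d \<in> S \<times> UNIV \<Longrightarrow> orbit (turning n' p') d \<inter> S \<times> UNIV = orbit (turning n p) d"
proof -
  define f where "f = turning n' p'"
  define Y where "Y = {x1, x2, opp x1, opp x2}"
  have nu: "n u \<in> S" using S u by (simp add: cyclic_def)
  have c': "p' (n' z) = z" if "z \<in> S'" for z using S' that by (auto simp: cyclic_def)
  have p': "p' x1 = u" "p' x2 = x1" "p' (opp x2) = x2" "p' (opp x1) = opp x2" "p' (n u) = opp x1"
    using c'[of u] c'[of x1] c'[of x2] c'[of "opp x2"] c'[of "opp x1"] n' Z u by auto
  have yn: "x1 \<notin> S" "x2 \<notin> S" "opp x1 \<notin> S" "opp x2 \<notin> S" using Z(2) by blast+
  have dn: "x1 \<noteq> x2" "opp x1 \<noteq> x2" "opp x2 \<noteq> x1" using Z(3) by auto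
  have "\<exists>e e' e''. {e, e', e''} \<subseteq> Y \<times> UNIV \<and> f e = e \<and> f e' = e'' \<and> f e'' = e' \<and> e \<noteq> e' \<and> e \<noteq> e'' \<and>
    returns f (S \<times> UNIV) (x1, True) (n u, True) \<and> returns f (S \<times> UNIV) (opp x1, False) (u, False) \<and>
    (\<forall>c\<in>Y \<times> UNIV - {e, e', e''}. c \<in> orbit f (x1, True) \<or> c \<in> orbit f (opp x1, False))"
  proof (cases "from_left x1")
    case True
    have v: "f (x1, True) = (n u, True)"
      "f (opp x1, False) = (x2, True)" "f (x2, True) = (x2, False)" "f (x2, False) = (opp x1, True)"
      "f (opp x1, True) = (u, False)"
      "f (x1, False) = (opp x2, False)" "f (opp x2, False) = (x1, False)" "f (opp x2, True) = (opp x2, True)"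
      using True fl n' p' by (auto simp: f_def turning_def)
    have o: "(opp x1, False) \<in> orbit f (opp x1, False)" "(x2, True) \<in> orbit f (opp x1, False)"
      "(x2, False) \<in> orbit f (opp x1, False)" "(opp x1, True) \<in> orbit f (opp x1, False)"
      "(x1, True) \<in> orbit f (x1, True)"
      using orbit_refl orbit_step v by metis+
    show ?thesis
      by (rule exI[of _ "(opp x2, True)"], rule exI[of _ "(x1, False)"], rule exI[of _ "(opp x2, False)"], intro conjI
          returns_now[of f, OF v(1)] returns4[of f, OF v(2) _ v(3) _ v(4) _ v(5)])
        (use v yn dn o in \<open>auto simp: Y_def UNIV_bool\<close>)
  next
    case False
    have v: "f (opp x1, False) = (u, False)"
      "f (x1, True) = (opp x2, False)" "f (opp x2, False) = (opp x2, True)" "f (opp x2, True) = (x1, False)"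
      "f (x1, False) = (n u, True)"
      "f (opp x1, True) = (x2, True)" "f (x2, True) = (opp x1, True)" "f (x2, False) = (x2, False)"
      using False fl n' p' by (auto simp: f_def turning_def)
    have o: "(x1, True) \<in> orbit f (x1, True)" "(opp x2, False) \<in> orbit f (x1, True)"
      "(opp x2, True) \<in> orbit f (x1, True)" "(x1, False) \<in> orbit f (x1, True)"
      "(opp x1, False) \<in> orbit f (opp x1, False)"
      using orbit_refl orbit_step v by metis+
    show ?thesis
      by (rule exI[of _ "(x2, False)"], rule exI[of _ "(opp x1, True)"], rule exI[of _ "(x2, True)"], intro conjI
          returns_now[of f, OF v(1)] returns4[of f, OF v(2) _ v(3) _ v(4) _ v(5)])
        (use v yn dn o in \<open>auto simp: Y_def UNIV_bool\<close>)
  qed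
  then obtain e e' e'' where e: "{e, e', e''} \<subseteq> Y \<times> UNIV" "f e = e" "f e' = e''" "f e'' = e'" "e \<noteq> e'" "e \<noteq> e''"
    and r: "returns f (S \<times> UNIV) (x1, True) (n u, True)" "returns f (S \<times> UNIV) (opp x1, False) (u, False)"
    and cov: "\<forall>c\<in>Y \<times> UNIV - {e, e', e''}. c \<in> orbit f (x1, True) \<or> c \<in> orbit f (opp x1, False)"
    by (elim exE conjE) (rule that)
  have oE: "orbit f e = {e}" "orbit f e' = {e', e''}" "orbit f e'' = {e', e''}"
    using orbit_fixpoint[of f, OF e(2)] orbit_two_cycle[of f, OF e(3,4)] orbit_two_cycle[of f, OF e(4,3)] by auto
  have YS: "Y \<inter> S = {}" using Z(2) Y_def by simp
  have 1: "S' \<times> UNIV = S \<times> UNIV \<union> (Y \<times> UNIV - {e, e', e''}) \<union> {e, e', e''}"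
    using Z(1) e(1) unfolding Y_def[symmetric] by blast
  have 2: "\<exists>w\<in>{u}. c \<in> orbit (turning n' p') (n' w, True) \<or> c \<in> orbit (turning n' p') (p' (n w), False)"
    if "c \<in> Y \<times> UNIV - {e, e', e''}" for c
    using bspec[OF cov that] n' p' unfolding f_def[symmetric] by simp
  have 3: "orbit (turning n' p') d \<inter> S \<times> UNIV = {}" if "d \<in> {e, e', e''}" for d
  proof -
    have "orbit f d \<subseteq> Y \<times> UNIV" using that oE e(1) by auto
    then show ?thesis using YS unfolding f_def[symmetric] by blast
  qed
  have sub: "S \<subseteq> S'" using Z(1) by blast
  note cut = card_orbits_cut_edges[OF S S' sub, where K = "{u}" and t = id and C = "Y \<times> UNIV - {e, e', e''}" and E = "{e, e', e''}"]
  have "card (orbit (turning n' p') ` (S' \<times> UNIV)) =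
      card (orbit (\<lambda>d. id (turning n p d)) ` (S \<times> UNIV)) + card (orbit (turning n' p') ` {e, e', e''})"
    by (rule cut(1)) (use u Z n' p' uncut r 1 2 3 in \<open>simp_all add: f_def\<close>)
  moreover have "card (orbit f ` {e, e', e''}) = 2"
    using oE e(5,6) by (simp add: card_insert_if)
  ultimately show "card (orbit (turning n' p') ` (S' \<times> UNIV)) = card (orbit (turning n p) ` (S \<times> UNIV)) + 2"
    by (simp add: id_def f_def)
  have "orbit (turning n' p') d \<inter> S \<times> UNIV = orbit (\<lambda>d. id (turning n p d)) d" if "d \<in> S \<times> UNIV" for d
    by (rule cut(2)) (use that u Z n' p' uncut r 1 2 3 in \<open>simp_all add: f_def\<close>)
  then show "orbit (turning n' p') d \<inter> S \<times> UNIV = orbit (turning n p) d" if "d \<in> S \<times> UNIV" for d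
    using that by (simp add: id_def)
qed

text \<open>
  A face lies to the right of its darts. So this dart of the edge from \<open>p\<close> to
  \<open>q\<close> belongs to the face on the right of the edge if \<open>s\<close> holds and on
  its left otherwise.
\<close>

definition side :: "bool \<Rightarrow> passage \<Rightarrow> passage \<Rightarrow> passage \<times> bool" where
  "side s p q = (if s then (q, True) else (p, False))"

text \<open>
  Two different edges are pushed across each other. Both border a common face, on the sides
  described by \<open>a\<close> and \<open>b\<close>; the push cuts this face in two, which is the
  transposition of \<open>a\<close> and \<open>b\<close> in the first-return map. The bigon
  between the strands is the second new face. The two alternatives for \<open>y1\<close> and
  \<open>y2\<close> are strands running in opposite and in equal directions.
\<close>

lemma card_orbits_bigon:
  assumes S: "cyclic S n p" and S': "cyclic S' n' p'" and u: "u \<in> S" "v \<in> S" "u \<noteq> v"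
    and Z: "S' = S \<union> {x1, x2, y1, y2}" "{x1, x2, y1, y2} \<inter> S = {}" "distinct [x1, x2, y1, y2]"
    and n': "n' u = x1" "n' x1 = x2" "n' x2 = n u" "n' v = y1" "n' y1 = y2" "n' y2 = n v"
    and uncut: "\<And>z. z \<in> S - {u, v} \<Longrightarrow> n' z = n z"
    and fl: "from_left x1 \<noteq> from_left x2"
    and y: "y1 = opp x2 \<and> y2 = opp x1 \<and> a = side (from_left x1) u (n u) \<or>
            y1 = opp x1 \<and> y2 = opp x2 \<and> a = side (\<not> from_left x1) u (n u)"
    and b: "b = side (from_left x1) v (n v)" "b \<in> orbit (turning n p) a"
  shows "card (orbit (turning n' p') ` (S' \<times> UNIV)) = card (orbit (turning n p) ` (S \<times> UNIV)) + 2"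
proof -
  define f where "f = turning n' p'"
  define Y where "Y = {x1, x2, y1, y2}"
  define t where "t = transpose a b"
  have c: "p (n z) = z" "n z \<in> S" if "z \<in> S" for z using S that by (auto simp: cyclic_def)
  have nuv: "n u \<noteq> n v" using c u by metis
  have c': "p' (n' z) = z" if "z \<in> S'" for z using S' that by (auto simp: cyclic_def)
  have p': "p' x1 = u" "p' x2 = x1" "p' (n u) = x2" "p' y1 = v" "p' y2 = y1" "p' (n v) = y2"
    using c'[of u] c'[of x1] c'[of x2] c'[of v] c'[of y1] c'[of y2] n' Z u by auto
  \<comment> \<open>In each of the four cases \<open>e\<close> and \<open>e'\<close> are the two darts around the bigon, and the other new darts lie on excursions of length one or two.\<close>
  have YS: "Y \<inter> S = {}" using Z(2) Y_def by simp
  then have yn: "\<And>z w. z \<in> Y \<Longrightarrow> (z, w) \<notin> S \<times> UNIV" by blast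
  have "\<exists>e e'. {e, e'} \<subseteq> Y \<times> UNIV \<and> f e = e' \<and> f e' = e \<and>
    returns f (S \<times> UNIV) (x1, True) (t (n u, True)) \<and> returns f (S \<times> UNIV) (x2, False) (t (u, False)) \<and>
    returns f (S \<times> UNIV) (y1, True) (t (n v, True)) \<and> returns f (S \<times> UNIV) (y2, False) (t (v, False)) \<and>
    (\<forall>c\<in>Y \<times> UNIV - {e, e'}. \<exists>d\<in>{(x1, True), (x2, False), (y1, True), (y2, False)}. c = d \<or> c = f d)"
    using y
  proof (elim disjE conjE)
    assume y': "y1 = opp x2" "y2 = opp x1" "a = side (from_left x1) u (n u)"
    show ?thesis
    proof (cases "from_left x1")
      case True
      have t': "t (n u, True) = (n v, True)" "t (u, False) = (u, False)" "t (n v, True) = (n u, True)" "t (v, False) = (v, False)"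
        using True y' b(1) nuv by (auto simp: t_def side_def transpose_def)
      have v: "f (x1, True) = (n v, True)" "f (y1, True) = (n u, True)" "f (x2, False) = (y2, True)"
        "f (y2, True) = (u, False)" "f (y2, False) = (x2, True)" "f (x2, True) = (v, False)"
        "f (x1, False) = (y1, False)" "f (y1, False) = (x1, False)"
        using True fl n' p' y' by (auto simp: f_def turning_def)
      show ?thesis unfolding t'
        by (rule exI[of _ "(x1, False)"], rule exI[of _ "(y1, False)"], intro conjI
          returns_now[of f, OF v(1)] returns_now[of f, OF v(2)] returns2[of f, OF v(3) _ v(4)] returns2[of f, OF v(5) _ v(6)])
         (use v yn in \<open>auto simp: Y_def UNIV_bool\<close>)
    next
      case False
      have t': "t (n u, True) = (n u, True)" "t (u, False) = (v, False)" "t (n v, True) = (n v, True)" "t (v, False) = (u, False)"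
        using False y' b(1) u by (auto simp: t_def side_def transpose_def)
      have v: "f (x2, False) = (v, False)" "f (y2, False) = (u, False)" "f (x1, True) = (y1, False)"
        "f (y1, False) = (n u, True)" "f (y1, True) = (x1, False)" "f (x1, False) = (n v, True)"
        "f (x2, True) = (y2, True)" "f (y2, True) = (x2, True)"
        using False fl n' p' y' by (auto simp: f_def turning_def)
      show ?thesis unfolding t'
        by (rule exI[of _ "(x2, True)"], rule exI[of _ "(y2, True)"], intro conjI
          returns_now[of f, OF v(1)] returns_now[of f, OF v(2)] returns2[of f, OF v(3) _ v(4)] returns2[of f, OF v(5) _ v(6)])
         (use v yn in \<open>auto simp: Y_def UNIV_bool\<close>)
    qed
  next
    assume y': "y1 = opp x1" "y2 = opp x2" "a = side (\<not> from_left x1) u (n u)"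
    show ?thesis
    proof (cases "from_left x1")
      case True
      have t': "t (n u, True) = (n u, True)" "t (u, False) = (n v, True)" "t (n v, True) = (u, False)" "t (v, False) = (v, False)"
        using True y' b(1) nuv u by (auto simp: t_def side_def transpose_def)
      have v: "f (x2, False) = (n v, True)" "f (y1, True) = (u, False)" "f (x1, True) = (y2, True)"
        "f (y2, True) = (n u, True)" "f (y2, False) = (x1, False)" "f (x1, False) = (v, False)"
        "f (x2, True) = (y1, False)" "f (y1, False) = (x2, True)"
        using True fl n' p' y' by (auto simp: f_def turning_def)
      show ?thesis unfolding t'
        by (rule exI[of _ "(x2, True)"], rule exI[of _ "(y1, False)"], intro conjI
          returns_now[of f, OF v(1)] returns_now[of f, OF v(2)] returns2[of f, OF v(3) _ v(4)] returns2[of f, OF v(5) _ v(6)])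
         (use v yn in \<open>auto simp: Y_def UNIV_bool\<close>)
    next
      case False
      have t': "t (n u, True) = (v, False)" "t (u, False) = (u, False)" "t (n v, True) = (n v, True)" "t (v, False) = (n u, True)"
        using False y' b(1) nuv u by (auto simp: t_def side_def transpose_def)
      have v: "f (x1, True) = (v, False)" "f (y2, False) = (n u, True)" "f (x2, False) = (y1, False)"
        "f (y1, False) = (u, False)" "f (y1, True) = (x2, True)" "f (x2, True) = (n v, True)"
        "f (x1, False) = (y2, True)" "f (y2, True) = (x1, False)"
        using False fl n' p' y' by (auto simp: f_def turning_def)
      show ?thesis unfolding t'
        by (rule exI[of _ "(x1, False)"], rule exI[of _ "(y2, True)"], intro conjI
          returns_now[of f, OF v(1)] returns_now[of f, OF v(2)] returns2[of f, OF v(3) _ v(4)] returns2[of f, OF v(5) _ v(6)])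
         (use v yn in \<open>auto simp: Y_def UNIV_bool\<close>)
    qed
  qed
  then obtain e e' where e: "{e, e'} \<subseteq> Y \<times> UNIV" "f e = e'" "f e' = e"
    and r: "returns f (S \<times> UNIV) (x1, True) (t (n u, True))" "returns f (S \<times> UNIV) (x2, False) (t (u, False))"
      "returns f (S \<times> UNIV) (y1, True) (t (n v, True))" "returns f (S \<times> UNIV) (y2, False) (t (v, False))"
    and cov: "\<forall>c\<in>Y \<times> UNIV - {e, e'}.
      \<exists>d\<in>{(x1, True), (x2, False), (y1, True), (y2, False)}. c = d \<or> c = f d"
    by (elim exE conjE) (rule that)
  have oE: "orbit f e = {e, e'}" "orbit f e' = {e, e'}"
    using orbit_two_cycle[of f, OF e(2,3)] orbit_two_cycle[of f, OF e(3,2)] by auto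
  have ab: "a \<in> S \<times> UNIV" "b \<in> S \<times> UNIV" "a \<noteq> b"
    using y b(1) u c nuv by (auto simp: side_def)
  have a: "a \<in> {(n u, True), (u, False)}" "b \<in> {(n v, True), (v, False)}"
    using y b(1) unfolding side_def by (cases "from_left x1"; force)+
  have "card (orbit (turning n' p') ` (S' \<times> UNIV)) =
      card (orbit (\<lambda>d. t (turning n p d)) ` (S \<times> UNIV)) + card (orbit (turning n' p') ` {e, e'})"
  proof (rule card_orbits_cut_edges(1)[OF S S', where K = "{u, v}" and C = "Y \<times> UNIV - {e, e'}"])
    show "S' \<times> UNIV = S \<times> UNIV \<union> (Y \<times> UNIV - {e, e'}) \<union> {e, e'}"
      using Z(1) e(1) unfolding Y_def[symmetric] by blast
    show "\<exists>w\<in>{u, v}. d \<in> orbit (turning n' p') (n' w, True) \<or> d \<in> orbit (turning n' p') (p' (n w), False)"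
      if "d \<in> Y \<times> UNIV - {e, e'}" for d
      using bspec[OF cov that] n' p' orbit_refl[of _ f] orbit_step[OF orbit_refl[of _ f]]
      unfolding f_def[symmetric] by auto
    show "orbit (turning n' p') d \<inter> S \<times> UNIV = {}" if "d \<in> {e, e'}" for d
    proof -
      have "orbit f d \<subseteq> Y \<times> UNIV" using that oE e(1) by auto
      then show ?thesis using YS unfolding f_def[symmetric] by blast
    qed
    show "t ` (S \<times> UNIV) \<subseteq> S \<times> UNIV" using ab by (simp add: t_def)
    show "t (n w, True) = (n w, True)" "t (w, False) = (w, False)" if "w \<in> S - {u, v}" for w
    proof -
      have "n w \<noteq> n u" "n w \<noteq> n v" using c(1)[of w] c(1)[OF u(1)] c(1)[OF u(2)] that by auto
      then show "t (n w, True) = (n w, True)" "t (w, False) = (w, False)"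
        using that a by (auto simp: t_def transpose_def)
    qed
    show "returns (turning n' p') (S \<times> UNIV) (n' w, True) (t (n w, True))"
      "returns (turning n' p') (S \<times> UNIV) (p' (n w), False) (t (w, False))" if "w \<in> {u, v}" for w
      using that r n' p' unfolding f_def by auto
  qed (use u Z n' p' uncut in auto)
  moreover have "card (orbit f ` {e, e'}) = 1" using oE by simp
  moreover have "card (orbit (\<lambda>d. t (turning n p d)) ` (S \<times> UNIV)) = card (orbit (turning n p) ` (S \<times> UNIV)) + 1"
    unfolding t_def
    by (rule card_orbits_transpose[OF _ turning_permutes[OF S] ab(1,3) b(2)]) (use S in \<open>simp add: cyclic_def\<close>)
  ultimately show ?thesis by (simp add: f_def)
qed

section \<open>Planarity of Reidemeister insertions\<close>

lemma nxt_segment: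
  assumes "distinct (X @ B @ Y)" "z \<in> set B" "z \<noteq> last B"
  shows "nxt (X @ B @ Y) z = nxt B z"
proof -
  obtain B1 B2 where b: "B = B1 @ z # B2" using assms(2) split_list by metis
  then obtain z2 B3 where c: "B2 = z2 # B3" using assms(3) by (cases B2) auto
  have "nxt B z = z2" unfolding b c by (rule nxt_middle) (use assms(1) b in auto)
  moreover have "nxt ((X @ B1) @ z # z2 # (B3 @ Y)) z = z2"
    by (rule nxt_middle) (use assms(1) b in auto)
  ultimately show ?thesis using b c by simp
qed

lemma nxt_last:
  assumes "distinct (X @ B @ Y)" "B \<noteq> []"
  shows "Y \<noteq> [] \<Longrightarrow> nxt (X @ B @ Y) (last B) = hd Y" "nxt (X @ B) (last B) = hd (X @ B)"
proof -
  have b: "B = butlast B @ [last B]" using assms(2) by simp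
  have n: "last B \<notin> set (X @ butlast B)"
    using assms(1) b by (metis append.assoc distinct_append not_distinct_conv_prefix)
  {
    assume "Y \<noteq> []"
    then have "Y = hd Y # tl Y" by simp
    then have "X @ B @ Y = (X @ butlast B) @ last B # hd Y # tl Y" using b by (metis append.assoc append_Cons append_Nil)
    then show "nxt (X @ B @ Y) (last B) = hd Y" using nxt_middle[OF n] by metis
  }
  have "X @ B = (X @ butlast B) @ [last B]" using b by (metis append.assoc)
  then show "nxt (X @ B) (last B) = hd (X @ B)" using nxt_end[OF n] by metis
qed

lemma planar_iff:
  assumes "gauss_word w" "w \<noteq> []"
  shows "planar w \<longleftrightarrow> card (orbit (turn w) ` (set w \<times> UNIV)) = length w div 2 + 2"
  using card_faces[OF assms] assms(2) by (simp add: planar_def)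

lemma gauss_word_add:
  assumes "gauss_word w" "distinct w'" "set w' = set w \<union> T" "opp ` T \<subseteq> T"
    "\<And>p q. p \<in> T \<Longrightarrow> q \<in> T \<Longrightarrow> crossing p = crossing q \<Longrightarrow> q = p \<or> q = opp p"
    "crossing ` T \<inter> crossing ` set w = {}"
  shows "gauss_word w'"
  unfolding gauss_word_iff
proof (intro conjI ballI impI)
  show "distinct w'" by fact
  show "opp p \<in> set w'" if "p \<in> set w'" for p
    using that assms(1,3,4) gauss_word_iff by blast
  show "q = p \<or> q = opp p" if "p \<in> set w'" "q \<in> set w'" "crossing p = crossing q" for p q
  proof -
    have "p \<in> set w \<and> q \<in> set w \<or> p \<in> T \<and> q \<in> T" using that assms(3,6) by fastforce
    then show ?thesis using that(3) assms(1,5) gauss_word_iff by blast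
  qed
qed

text \<open>
  The new kink sits at the end of \<open>A\<close>; an empty \<open>A\<close> means that it sits
  after the last passage of \<open>B\<close>.
\<close>

lemma virtual_diagram_insert_R1:
  assumes w: "virtual_diagram (A @ B)" "A @ B \<noteq> []" and fresh: "crossing x \<notin> crossing ` set (A @ B)"
  shows "virtual_diagram (A @ [x, opp x] @ B)"
proof -
  define R where "R = B @ A"
  define w' where "w' = A @ [x, opp x] @ B"
  have g: "gauss_word (A @ B)" "planar (A @ B)" using w virtual_diagram_def by auto
  have xn: "x \<notin> set (A @ B)" "opp x \<notin> set (A @ B)" using fresh image_eqI[of "crossing x" crossing x] image_eqI[of "crossing x" crossing "opp x"] by auto
  have d: "distinct (A @ B)" using g gauss_word_iff by blast
  have g': "gauss_word w'" unfolding w'_def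
    by (rule gauss_word_add[OF g(1), where T = "{x, opp x}"]) (use d xn fresh in auto)
  have d': "distinct w'" using g' gauss_word_iff by blast
  have R: "R \<noteq> []" "set R = set (A @ B)" "distinct R" using w d R_def by auto
  have d2: "distinct ([x, opp x] @ R)" using R xn by auto
  have n: "nxt (A @ B) z = nxt R z" if "z \<in> set R" for z
  proof -
    have "z \<in> set (A @ B)" using that by (auto simp: R_def)
    from nxt_rotate[OF d this] show ?thesis by (simp add: R_def)
  qed
  have n': "nxt w' z = nxt ([x, opp x] @ R) z" if "z \<in> set ([x, opp x] @ R)" for z
    using nxt_rotate[of A "[x, opp x] @ B" z] d' that unfolding w'_def R_def by auto
  have lR: "last R \<in> set R" using R(1) by simp
  have "card (orbit (turn w') ` (set w' \<times> UNIV)) = card (orbit (turn (A @ B)) ` (set (A @ B) \<times> UNIV)) + 1"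
  proof (rule card_orbits_monogon[OF cyclic_gauss_word[OF g(1)] cyclic_gauss_word[OF g'], where u = "last R" and x = x])
    show "last R \<in> set (A @ B)" using lR unfolding R(2) .
    show "set w' = set (A @ B) \<union> {x, opp x}" by (auto simp: w'_def)
    show "x \<notin> set (A @ B)" "opp x \<notin> set (A @ B)" by fact+
    show "nxt w' (last R) = x" using n'[of "last R"] nxt_last(2)[of "[x, opp x]" R "[]"] d2 R(1) lR by simp
    show "nxt w' x = opp x" using n'[of x] nxt_middle[of x "[]" "opp x" R] by simp
    show "nxt w' (opp x) = nxt (A @ B) (last R)"
      using n'[of "opp x"] nxt_last(1)[of "[x]" "[opp x]" R] d2 R n[OF lR] nxt_last(2)[of "[]" R "[]"] by simp
    show "nxt w' z = nxt (A @ B) z" if "z \<in> set (A @ B) - {last R}" for z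
      using that n[of z] n'[of z] nxt_segment[of "[x, opp x]" R "[]" z] d2 R by simp
  qed
  then have "planar w'" using planar_iff[OF g(1) w(2)] planar_iff[OF g'] g(2) by (simp add: w'_def)
  then show ?thesis using g' by (simp add: virtual_diagram_def w'_def)
qed

text \<open>
  This has the shape of a second Reidemeister move with both strands on the base edge, a case that
  the bigon lemma excludes. The second claim says that darts on a common face stay on a common
  face.
\<close>

lemma virtual_diagram_insert_finger:
  assumes w: "virtual_diagram R" "R \<noteq> []"
    and fresh: "crossing x1 \<notin> crossing ` set R" "crossing x2 \<notin> crossing ` set R" "crossing x1 \<noteq> crossing x2"
    and fl: "from_left x1 \<noteq> from_left x2"
  shows "virtual_diagram ([x1, x2, opp x2, opp x1] @ R)"
    and "\<And>d. d \<in> set R \<times> UNIV \<Longrightarrow> orbit (turn R) d \<subseteq> orbit (turn ([x1, x2, opp x2, opp x1] @ R)) d"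
proof -
  define Z where "Z = [x1, x2, opp x2, opp x1]"
  have g: "gauss_word R" "planar R" using w virtual_diagram_def by auto
  have c: "crossing p \<in> crossing ` set R" if "p \<in> set R" for p using that by simp
  have xn: "x1 \<notin> set R" "opp x1 \<notin> set R" "x2 \<notin> set R" "opp x2 \<notin> set R"
    using fresh c[of x1] c[of x2] c[of "opp x1"] c[of "opp x2"] by auto
  have ne: "x1 \<noteq> x2" "x1 \<noteq> opp x2" "x2 \<noteq> opp x1" using fresh(3) by (metis opp_simps(2))+
  have d: "distinct R" using g gauss_word_iff by blast
  have d': "distinct (Z @ R)" using d xn ne by (auto simp: Z_def)
  have g': "gauss_word (Z @ R)"
    by (rule gauss_word_add[OF g(1) d', where T = "set Z"]) (use fresh in \<open>auto simp: Z_def\<close>)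
  have lR: "last R \<in> set R" using w by simp
  have facts: "last R \<in> set R" "set (Z @ R) = set R \<union> {x1, x2, opp x1, opp x2}"
    "{x1, x2, opp x1, opp x2} \<inter> set R = {}" "distinct [x1, x2, opp x1, opp x2]"
    "nxt (Z @ R) (last R) = x1" "nxt (Z @ R) x1 = x2" "nxt (Z @ R) x2 = opp x2"
    "nxt (Z @ R) (opp x2) = opp x1" "nxt (Z @ R) (opp x1) = nxt R (last R)"
  proof -
    show "nxt (Z @ R) (last R) = x1" using nxt_last(2)[of Z R "[]"] d' w by (simp add: Z_def)
    show "nxt (Z @ R) x1 = x2" using nxt_middle[of x1 "[]" x2] by (simp add: Z_def)
    show "nxt (Z @ R) x2 = opp x2" using nxt_middle[of x2 "[x1]" "opp x2"] ne by (simp add: Z_def)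
    show "nxt (Z @ R) (opp x2) = opp x1" using nxt_middle[of "opp x2" "[x1, x2]" "opp x1"] ne by (simp add: Z_def)
    show "nxt (Z @ R) (opp x1) = nxt R (last R)"
      using nxt_last(1)[of "[x1, x2, opp x2]" "[opp x1]" R] nxt_last(2)[of "[]" R "[]"] d d' w by (simp add: Z_def)
  qed (use lR xn ne in \<open>auto simp: Z_def\<close>)
  have uncut: "nxt (Z @ R) z = nxt R z" if "z \<in> set R - {last R}" for z
    using that nxt_segment[of Z R "[]" z] d' by simp
  note fin = card_orbits_finger[OF cyclic_gauss_word[OF g(1)] cyclic_gauss_word[OF g'] facts uncut fl]
  have "planar (Z @ R)" using fin(1) planar_iff[OF g(1) w(2)] planar_iff[OF g'] g(2) w(2) by (simp add: Z_def)
  then show "virtual_diagram ([x1, x2, opp x2, opp x1] @ R)" using g' by (simp add: virtual_diagram_def Z_def)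
  show "orbit (turn R) d \<subseteq> orbit (turn ([x1, x2, opp x2, opp x1] @ R)) d" if "d \<in> set R \<times> UNIV" for d
    using fin(2)[OF _ that] unfolding Z_def by blast
qed

text \<open>
  The cyclic order of the word matters only up to rotation, so the word is rotated to start with
  \<open>B\<close>; then the two edges are the ones after \<open>B\<close> and after the rest.
\<close>

lemma virtual_diagram_insert_R2:
  assumes w: "virtual_diagram (A @ B @ C)" and ne: "B \<noteq> []" "C @ A \<noteq> []"
    and fresh: "crossing x1 \<notin> crossing ` set (A @ B @ C)" "crossing x2 \<notin> crossing ` set (A @ B @ C)"
      "crossing x1 \<noteq> crossing x2"
    and fl: "from_left x1 \<noteq> from_left x2"
    and y: "y1 = opp x2 \<and> y2 = opp x1 \<and> a = side (from_left x1) (last (C @ A)) (hd B) \<or>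
            y1 = opp x1 \<and> y2 = opp x2 \<and> a = side (\<not> from_left x1) (last (C @ A)) (hd B)"
    and b: "side (from_left x1) (last B) (hd (C @ A)) \<in> orbit (turn (A @ B @ C)) a"
  shows "virtual_diagram (A @ [x1, x2] @ B @ [y1, y2] @ C)"
proof -
  define R where "R = C @ A"
  define w where "w = A @ B @ C"
  define w' where "w' = A @ [x1, x2] @ B @ [y1, y2] @ C"
  have g: "gauss_word w" "planar w" using w virtual_diagram_def w_def by auto
  have c: "crossing p \<in> crossing ` set w" if "p \<in> set w" for p using that by simp
  have xn: "x1 \<notin> set w" "opp x1 \<notin> set w" "x2 \<notin> set w" "opp x2 \<notin> set w"
    using fresh c[of x1] c[of x2] c[of "opp x1"] c[of "opp x2"] by (auto simp: w_def)
  have nx: "x1 \<noteq> x2" "x1 \<noteq> opp x2" "x2 \<noteq> opp x1" using fresh(3) by (metis opp_simps(2))+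
  have Y: "{y1, y2} = {opp x1, opp x2}" "distinct [x1, x2, y1, y2]" using y nx by auto
  have d: "distinct w" using g gauss_word_iff by blast
  have sw': "set w' = set w \<union> {x1, x2, opp x1, opp x2}" using Y(1) by (auto simp: w'_def w_def)
  have yn: "y1 \<notin> set w" "y2 \<notin> set w" using Y(1) xn by (metis insert_iff singletonD)+
  have d': "distinct w'" using d xn Y(2) yn by (auto simp: w'_def w_def)
  have g': "gauss_word w'"
    by (rule gauss_word_add[OF g(1) d' sw']) (use fresh in \<open>auto simp: w_def\<close>)
  have R: "R \<noteq> []" "set w = set (B @ R)" "distinct (B @ R)" using ne d R_def w_def by auto
  define W' where "W' = [x1, x2] @ B @ [y1, y2] @ R"
  have d2: "distinct W'" using R d xn yn Y(2) by (auto simp: W'_def w_def)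
  have n: "nxt w z = nxt (B @ R) z" if "z \<in> set (B @ R)" for z
  proof -
    have "z \<in> set (A @ B @ C)" using that by (auto simp: R_def)
    from nxt_rotate[OF d[unfolded w_def] this] show ?thesis by (simp add: R_def w_def)
  qed
  have n': "nxt w' z = nxt W' z" if "z \<in> set W'" for z
    using nxt_rotate[of A "[x1, x2] @ B @ [y1, y2] @ C" z] d' that unfolding w'_def R_def W'_def by auto
  have mem: "last R \<in> set R" "last B \<in> set B" "hd B \<in> set B" "hd R \<in> set R" using R ne by auto
  have uv: "last R \<noteq> last B" using R(3) mem(1,2) by (metis disjoint_iff distinct_append)
  have dB: "distinct ([] @ B @ R)" "distinct (B @ R @ [])" using R(3) by auto
  have nu: "nxt w (last R) = hd B" using n[of "last R"] nxt_last(2)[OF dB(2) R(1)] ne mem by simp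
  have nv: "nxt w (last B) = hd R" using n[of "last B"] nxt_last(1)[OF dB(1) ne(1) R(1)] mem by simp
  have "card (orbit (turn w') ` (set w' \<times> UNIV)) = card (orbit (turn w) ` (set w \<times> UNIV)) + 2"
  proof (rule card_orbits_bigon[OF cyclic_gauss_word[OF g(1)] cyclic_gauss_word[OF g'],
        where u = "last R" and v = "last B" and ?x1.0 = x1 and ?x2.0 = x2 and ?y1.0 = y1 and ?y2.0 = y2 and a = a])
    show "last R \<in> set w" "last B \<in> set w" "last R \<noteq> last B" using mem uv unfolding R(2) by simp_all
    show "set w' = set w \<union> {x1, x2, y1, y2}" using sw' Y(1) by auto
    show "{x1, x2, y1, y2} \<inter> set w = {}" using xn yn by simp
    show "distinct [x1, x2, y1, y2]" "from_left x1 \<noteq> from_left x2" by fact+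
    show "nxt w' (last R) = x1"
      using n'[of "last R"] nxt_last(2)[of "[x1, x2] @ B @ [y1, y2]" R "[]"] d2 R(1) mem by (simp add: W'_def)
    show "nxt w' x1 = x2" using n'[of x1] nxt_middle[of x1 "[]" x2] by (simp add: W'_def)
    show "nxt w' x2 = nxt w (last R)"
      using n'[of x2] nxt_last(1)[of "[x1]" "[x2]" "B @ [y1, y2] @ R"] d2 ne(1) nu by (simp add: W'_def)
    show "nxt w' (last B) = y1"
      using n'[of "last B"] nxt_last(1)[of "[x1, x2]" B "[y1, y2] @ R"] d2 ne(1) mem by (simp add: W'_def)
    show "nxt w' y1 = y2" using n'[of y1] nxt_middle[of y1 "[x1, x2] @ B" y2 R] d2 by (auto simp: W'_def)
    show "nxt w' y2 = nxt w (last B)"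
      using n'[of y2] nxt_last(1)[of "[x1, x2] @ B @ [y1]" "[y2]" R] d2 R(1) nv by (simp add: W'_def)
    show "nxt w' z = nxt w z" if z: "z \<in> set w - {last R, last B}" for z
    proof -
      have z': "z \<in> set (B @ R)" "z \<in> set W'" using z R(2) by (auto simp: W'_def)
      show ?thesis
      proof (cases "z \<in> set B")
        case True
        then show ?thesis using n[OF z'(1)] n'[OF z'(2)] z nxt_segment[of "[x1, x2]" B "[y1, y2] @ R" z]
            nxt_segment[of "[]" B R z] d2 R(3) by (simp add: W'_def)
      next
        case False
        then have "z \<in> set R" using z' by simp
        then show ?thesis using n[OF z'(1)] n'[OF z'(2)] z nxt_segment[of "[x1, x2] @ B @ [y1, y2]" R "[]" z]
            nxt_segment[of B R "[]" z] d2 R(3) by (simp add: W'_def)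
      qed
    qed
    show "y1 = opp x2 \<and> y2 = opp x1 \<and> a = side (from_left x1) (last R) (nxt w (last R)) \<or>
            y1 = opp x1 \<and> y2 = opp x2 \<and> a = side (\<not> from_left x1) (last R) (nxt w (last R))"
      using y nu by (simp add: R_def)
    show "side (from_left x1) (last B) (hd (C @ A)) = side (from_left x1) (last B) (nxt w (last B))"
      using nv by (simp add: R_def)
    show "side (from_left x1) (last B) (hd (C @ A)) \<in> orbit (turn w) a" using b by (simp add: w_def)
  qed
  moreover have "w \<noteq> []" "w' \<noteq> []" "length w' = length w + 4" using ne by (auto simp: w_def w'_def)
  ultimately have "planar w'" using planar_iff[OF g(1)] planar_iff[OF g'] g(2) by simp
  then show ?thesis using g' by (simp add: virtual_diagram_def w'_def)
qed

section \<open>Stitches\<close>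

lemma orbit_turn_sym:
  assumes "gauss_word w" "d \<in> set w \<times> UNIV" "d' \<in> orbit (turn w) d"
  shows "d \<in> orbit (turn w) d'"
  by (rule orbit_sym[OF _ turning_permutes[OF cyclic_gauss_word[OF assms(1)]] assms(2,3)]) simp

lemma nxt_middle_distinct: "distinct (A @ p # q # B) \<Longrightarrow> nxt (A @ p # q # B) p = q"
  by (rule nxt_middle) auto

lemma prv_middle: "distinct (A @ p # q # B) \<Longrightarrow> prv (A @ p # q # B) q = p"
  unfolding prv_def using nxt_middle[of q "rev B" p "rev A"] by simp

lemma prv_hd: "distinct w \<Longrightarrow> w \<noteq> [] \<Longrightarrow> prv w (hd w) = last w"
  unfolding prv_def using nxt_end[of "hd w" "rev (tl w)"]
  by (cases w) (auto simp: hd_append hd_rev)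

text \<open>
  The cut point between \<open>P\<close> and \<open>Q\<close> is an edge that lies, like the base
  edge, on one region: on its right if \<open>s\<close> holds and on its left otherwise. Across
  this region the two edges can be joined by a tie.
\<close>

definition joinable :: "bool \<Rightarrow> passage list \<Rightarrow> passage list \<Rightarrow> bool" where
  "joinable s P Q \<longleftrightarrow> virtual_diagram (P @ Q) \<and> Q \<noteq> [] \<and>
     side s (last (Q @ P)) (hd (Q @ P)) \<in> orbit (turn (P @ Q)) (side s (last (P @ Q)) (hd (P @ Q)))"

text \<open>
  The strand over which the two loops are pulled: it passes under the first loop at the crossings
  \<open>N\<close>, \<open>N + 1\<close> and under the second loop at \<open>N + 2\<close>,
  \<open>N + 3\<close>. It is traversed before the rest of the diagram.
\<close>

definition eyelets :: "nat \<Rightarrow> bool \<Rightarrow> passage list" where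
  "eyelets N s = [Passage (N + 3) Under s, Passage (N + 2) Under (\<not> s),
                  Passage (N + 1) Under s, Passage N Under (\<not> s)]"

text \<open>
  The two loops, one at the base edge before \<open>P\<close> and one at the cut edge between
  \<open>P\<close> and \<open>Q\<close>. Their tips \<open>t1\<close> and \<open>t2\<close> lie
  beyond the eyelet strand, where they can cross each other.
\<close>

definition fingers :: "nat \<Rightarrow> bool \<Rightarrow> passage list \<Rightarrow> passage list \<Rightarrow> passage list \<Rightarrow> passage list \<Rightarrow> passage list" where
  "fingers N s t1 t2 P Q =
     [Passage N Over s] @ t1 @ [Passage (N + 1) Over (\<not> s)] @ P @
     [Passage (N + 2) Over s] @ t2 @ [Passage (N + 3) Over (\<not> s)] @ Q"

definition stitch :: "nat \<Rightarrow> bool \<Rightarrow> passage list \<Rightarrow> passage list \<Rightarrow> passage list \<Rightarrow> passage list \<Rightarrow> passage list" where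
  "stitch N s t1 t2 P Q = eyelets N s @ fingers N s t1 t2 P Q"

definition below :: "nat \<Rightarrow> passage list \<Rightarrow> bool" where
  "below N w \<longleftrightarrow> (\<forall>p\<in>set w. crossing p < N)"

lemma below_simps [simp]:
  "below N []" "below N (p # w) \<longleftrightarrow> crossing p < N \<and> below N w" "below N (v @ w) \<longleftrightarrow> below N v \<and> below N w"
  by (auto simp: below_def)

lemma below_notin: "below N w \<Longrightarrow> N \<le> k \<Longrightarrow> Passage k l b \<notin> set w"
  by (force simp: below_def)

lemma below_crossing: "below N w \<Longrightarrow> N \<le> k \<Longrightarrow> k \<notin> crossing ` set w"
  by (auto simp: below_def)

lemma dropWhile_neq: "p \<notin> set A \<Longrightarrow> dropWhile (\<lambda>z. z \<noteq> p) (A @ B) = dropWhile (\<lambda>z. z \<noteq> p) B"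
  by (rule dropWhile_append2) auto

text \<open>
  The first loop is a finger at the base edge. The second one is an R2 insertion between the new
  base edge and the cut edge; they border a common region since \<open>joinable s P Q\<close>
  holds and the first loop does not obstruct this region.
\<close>

lemma virtual_diagram_stitch_empty:
  assumes g: "joinable s P Q" and N: "below N (P @ Q)"
  shows "virtual_diagram (stitch N s [] [] P Q)"
proof -
  define R where "R = P @ Q"
  define x1 where "x1 = Passage (N + 1) Under s"
  define x2 where "x2 = Passage N Under (\<not> s)"
  define x3 where "x3 = Passage (N + 3) Under s"
  define x4 where "x4 = Passage (N + 2) Under (\<not> s)"
  have R: "virtual_diagram R" "R \<noteq> []" "Q \<noteq> []" using g by (auto simp: joinable_def R_def)
  have fr: "N \<notin> crossing ` set R" "N + 1 \<notin> crossing ` set R" "N + 2 \<notin> crossing ` set R" "N + 3 \<notin> crossing ` set R"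
    using below_crossing[OF N] by (auto simp: R_def)
  define w where "w = [x1, x2, opp x2, opp x1] @ R"
  have w: "virtual_diagram w" "\<And>d. d \<in> set R \<times> UNIV \<Longrightarrow> orbit (turn R) d \<subseteq> orbit (turn w) d"
    using virtual_diagram_insert_finger[OF R(1,2), of x1 x2] fr unfolding w_def x1_def x2_def by auto
  have gw: "gauss_word w" "distinct w" using w(1) gauss_word_iff virtual_diagram_def by blast+
  have nx: "nxt w (opp x1) = hd R"
    using nxt_middle[of "opp x1" "[x1, x2, opp x2]" "hd R" "tl R"] R(2) gw(2)
    by (simp add: w_def x1_def x2_def)
  have px: "prv w x1 = last R" using prv_hd[OF gw(2)] R(2) by (simp add: w_def)
  have o: "side s (last (Q @ P)) (hd (Q @ P)) \<in> orbit (turn R) (side s (last R) (hd R))"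
    using g unfolding joinable_def R_def by blast
  have "side s (last R) (hd R) \<in> set R \<times> UNIV" using R(2) by (simp add: side_def)
  note o' = subsetD[OF w(2)[OF this] o]
  have cond: "side s (last ([x1, x2, opp x2, opp x1] @ P)) (hd Q) \<in> orbit (turn w) (side s (last Q) x1)"
  proof (cases s)
    case True
    have "turn w (x1, True) = (hd R, True)" using nx True by (simp add: turning_def x1_def)
    then have 1: "(hd R, True) \<in> orbit (turn w) (x1, True)" using orbit_step[OF orbit_refl] by metis
    have "(hd Q, True) \<in> orbit (turn w) (hd R, True)" using o' True R(3) by (simp add: side_def)
    from orbit_trans[OF 1 this] show ?thesis using True by (simp add: side_def)
  next
    case False
    show ?thesis
    proof (cases "P = []")
      case True
      have "turn w (opp x1, False) = (last R, False)" using px False by (simp add: turning_def x1_def)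
      then have 1: "(last R, False) \<in> orbit (turn w) (opp x1, False)" using orbit_step[OF orbit_refl] by metis
      have "(opp x1, False) \<in> set w \<times> UNIV" by (simp add: w_def)
      from orbit_turn_sym[OF gw(1) this 1] have "(opp x1, False) \<in> orbit (turn w) (last R, False)" .
      then show ?thesis using True False by (simp add: side_def R_def)
    next
      case False
      then show ?thesis using o' \<open>\<not> s\<close> R(3) by (simp add: side_def R_def)
    qed
  qed
  have "virtual_diagram ([] @ [x3, x4] @ ([x1, x2, opp x2, opp x1] @ P) @ [opp x4, opp x3] @ Q)"
  proof (rule virtual_diagram_insert_R2[where a = "side s (last Q) x1"])
    show "virtual_diagram ([] @ ([x1, x2, opp x2, opp x1] @ P) @ Q)" using w(1) by (simp add: w_def R_def)
    show "side (from_left x3) (last ([x1, x2, opp x2, opp x1] @ P)) (hd (Q @ []))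
      \<in> orbit (turn ([] @ ([x1, x2, opp x2, opp x1] @ P) @ Q)) (side s (last Q) x1)"
      using cond by (simp add: w_def R_def x3_def)
  qed (use R fr in \<open>auto simp: x1_def x2_def x3_def x4_def R_def\<close>)
  then show ?thesis
    by (simp add: stitch_def eyelets_def fingers_def x1_def x2_def x3_def x4_def)
qed

text \<open>
  A new pair of crossings between the two tips. The common face is certified by walking
  \<open>k\<close> steps along it, which the simplifier can do on concrete tips.
\<close>

lemma virtual_diagram_stitch_insert:
  assumes w: "virtual_diagram (stitch N s (t1 @ t1') (t2 @ t2') P Q)"
    and fresh: "crossing x1 \<notin> crossing ` set (stitch N s (t1 @ t1') (t2 @ t2') P Q)"
      "crossing x2 \<notin> crossing ` set (stitch N s (t1 @ t1') (t2 @ t2') P Q)" "crossing x1 \<noteq> crossing x2"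
    and fl: "from_left x1 \<noteq> from_left x2"
    and y: "y1 = opp x2 \<and> y2 = opp x1 \<and> r = from_left x1 \<or> y1 = opp x1 \<and> y2 = opp x2 \<and> r = (\<not> from_left x1)"
    and a: "a = side r (last (Passage N Over s # t1)) (hd (t1' @ [Passage (N + 1) Over (\<not> s)]))"
    and b: "b = side (from_left x1) (last (Passage (N + 2) Over s # t2)) (hd (t2' @ [Passage (N + 3) Over (\<not> s)]))"
    and near: "(turn (stitch N s (t1 @ t1') (t2 @ t2') P Q) ^^ k) a = b \<or>
      (turn (stitch N s (t1 @ t1') (t2 @ t2') P Q) ^^ k) b = a"
  shows "virtual_diagram (stitch N s (t1 @ [x1, x2] @ t1') (t2 @ [y1, y2] @ t2') P Q)"
proof -
  let ?w = "stitch N s (t1 @ t1') (t2 @ t2') P Q"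
  let ?A = "eyelets N s @ Passage N Over s # t1"
  let ?B = "t1' @ [Passage (N + 1) Over (\<not> s)] @ P @ [Passage (N + 2) Over s] @ t2"
  let ?C = "t2' @ [Passage (N + 3) Over (\<not> s)] @ Q"
  have e: "?w = ?A @ ?B @ ?C" by (simp add: stitch_def fingers_def)
  have gw: "gauss_word ?w" using w virtual_diagram_def by blast
  have h: "hd (?C @ ?A) = hd (t2' @ [Passage (N + 3) Over (\<not> s)])" "hd ?B = hd (t1' @ [Passage (N + 1) Over (\<not> s)])"
    by (cases t2'; simp) (cases t1'; simp)
  have l: "last (?C @ ?A) = last (Passage N Over s # t1)" "last ?B = last (Passage (N + 2) Over s # t2)"
    by simp_all
  have bm: "b \<in> set ?w \<times> UNIV"
    unfolding b h(1)[symmetric] l(2)[symmetric] e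
    by (cases t2'; cases "t2 = []") (auto simp: side_def)
  have "b \<in> orbit (turn ?w) a"
    using near
  proof
    assume "(turn ?w ^^ k) b = a"
    then show ?thesis by (intro orbit_turn_sym[OF gw bm] orbitI)
  qed (rule orbitI)
  then have o: "side (from_left x1) (last ?B) (hd (?C @ ?A)) \<in> orbit (turn (?A @ ?B @ ?C)) a"
    unfolding b h l e .
  have "virtual_diagram (?A @ [x1, x2] @ ?B @ [y1, y2] @ ?C)"
  proof (rule virtual_diagram_insert_R2[OF _ _ _ _ _ _ fl _ o])
    show "virtual_diagram (?A @ ?B @ ?C)" "crossing x1 \<notin> crossing ` set (?A @ ?B @ ?C)"
      "crossing x2 \<notin> crossing ` set (?A @ ?B @ ?C)" "crossing x1 \<noteq> crossing x2"
      using w fresh unfolding e by blast+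
    show "y1 = opp x2 \<and> y2 = opp x1 \<and> a = side (from_left x1) (last (?C @ ?A)) (hd ?B) \<or>
      y1 = opp x1 \<and> y2 = opp x2 \<and> a = side (\<not> from_left x1) (last (?C @ ?A)) (hd ?B)"
      using y unfolding a h l by blast
  qed simp_all
  then show ?thesis by (simp add: stitch_def fingers_def)
qed

text \<open>
  After a stitch the cut point between the eyelets and the loops takes over the role of the second
  edge. It shares a region with the base edge on the other side, so the next tie is made on the
  opposite side.
\<close>

lemma joinable_stitch:
  assumes w: "virtual_diagram (stitch N s t1 t2 P Q)" and Q: "Q \<noteq> []"
    and near: "(turn (stitch N s t1 t2 P Q) ^^ k) (side (\<not> s) (Passage N Under (\<not> s)) (Passage N Over s)) =
        side (\<not> s) (last Q) (Passage (N + 3) Under s) \<or>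
      (turn (stitch N s t1 t2 P Q) ^^ k) (side (\<not> s) (last Q) (Passage (N + 3) Under s)) =
        side (\<not> s) (Passage N Under (\<not> s)) (Passage N Over s)"
  shows "joinable (\<not> s) (eyelets N s) (fingers N s t1 t2 P Q)"
proof -
  let ?w = "stitch N s t1 t2 P Q"
  let ?a = "side (\<not> s) (Passage N Under (\<not> s)) (Passage N Over s)"
  let ?b = "side (\<not> s) (last Q) (Passage (N + 3) Under s)"
  have gw: "gauss_word ?w" using w virtual_diagram_def by blast
  have m: "?a \<in> set ?w \<times> UNIV" by (auto simp: side_def stitch_def eyelets_def fingers_def)
  from near have "?a \<in> orbit (turn ?w) ?b"
  proof
    assume "(turn ?w ^^ k) ?a = ?b"
    then show ?thesis by (intro orbit_turn_sym[OF gw m] orbitI)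
  qed (rule orbitI)
  moreover have "last (fingers N s t1 t2 P Q) = last Q" using Q by (simp add: fingers_def)
  ultimately show ?thesis using w
    by (simp add: joinable_def stitch_def) (simp add: eyelets_def fingers_def Q)
qed

lemma joinable_stitch_empty:
  assumes "joinable s P Q" "below N (P @ Q)"
  shows "joinable (\<not> s) (eyelets N s) (fingers N s [] [] P Q)"
proof (rule joinable_stitch[where k = "Suc (Suc (Suc (Suc 0)))"])
  show Q: "Q \<noteq> []" using assms joinable_def by simp
  show "virtual_diagram (stitch N s [] [] P Q)" by (rule virtual_diagram_stitch_empty[OF assms])
  have b: "below N P" "below N Q" using assms by simp_all
  show "(turn (stitch N s [] [] P Q) ^^ Suc (Suc (Suc (Suc 0)))) (side (\<not> s) (Passage N Under (\<not> s)) (Passage N Over s)) =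
        side (\<not> s) (last Q) (Passage (N + 3) Under s) \<or>
      (turn (stitch N s [] [] P Q) ^^ Suc (Suc (Suc (Suc 0)))) (side (\<not> s) (last Q) (Passage (N + 3) Under s)) =
        side (\<not> s) (Passage N Under (\<not> s)) (Passage N Over s)"
    by (cases s) (use Q in \<open>simp_all add: side_def stitch_def eyelets_def fingers_def turning_def nxt_def prv_def
      dropWhile_neq below_notin[OF b(1)] below_notin[OF b(2)] hd_append hd_rev\<close>)
qed

text \<open>
  If the outermost crossing \<open>x\<close> of the clasp has this orientation, the base edge and
  the new cut edge are three turns apart on a region that passes the eyelet strand and
  \<open>x\<close>.
\<close>

lemma joinable_stitch_clasp:
  assumes w: "virtual_diagram (stitch N s (x # t1) (t2 @ [opp x]) P Q)" and Q: "Q \<noteq> []" and x: "from_left x = s"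
  shows "joinable (\<not> s) (eyelets N s) (fingers N s (x # t1) (t2 @ [opp x]) P Q)"
proof (rule joinable_stitch[where k = "Suc (Suc (Suc 0))", OF w Q])
  let ?w = "stitch N s (x # t1) (t2 @ [opp x]) P Q"
  have d: "distinct ?w" using w gauss_word_iff virtual_diagram_def by blast
  have e1: "?w = (eyelets N s) @ Passage N Over s # x # (t1 @ [Passage (N + 1) Over (\<not> s)] @ P @
     [Passage (N + 2) Over s] @ t2 @ [opp x, Passage (N + 3) Over (\<not> s)] @ Q)"
    by (simp add: stitch_def fingers_def)
  have e2: "?w = (eyelets N s @ Passage N Over s # x # (t1 @ [Passage (N + 1) Over (\<not> s)] @ P @
     [Passage (N + 2) Over s] @ t2)) @ opp x # Passage (N + 3) Over (\<not> s) # Q"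
    by (simp add: stitch_def fingers_def)
  have e3: "?w = [Passage (N + 3) Under s, Passage (N + 2) Under (\<not> s), Passage (N + 1) Under s]
     @ Passage N Under (\<not> s) # Passage N Over s # (x # t1 @ [Passage (N + 1) Over (\<not> s)] @ P @
     [Passage (N + 2) Over s] @ t2 @ [opp x, Passage (N + 3) Over (\<not> s)] @ Q)"
    by (simp add: stitch_def fingers_def eyelets_def)
  have n: "nxt ?w (Passage N Over s) = x" "prv ?w x = Passage N Over s"
    "nxt ?w (opp x) = Passage (N + 3) Over (\<not> s)" "prv ?w (Passage (N + 3) Over (\<not> s)) = opp x"
    "nxt ?w (Passage N Under (\<not> s)) = Passage N Over s"
    by (fact nxt_middle_distinct[OF d[unfolded e1], folded e1] prv_middle[OF d[unfolded e1], folded e1]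
        nxt_middle_distinct[OF d[unfolded e2], folded e2] prv_middle[OF d[unfolded e2], folded e2]
        nxt_middle_distinct[OF d[unfolded e3], folded e3])+
  have p: "prv ?w (Passage (N + 3) Under s) = last Q"
    using prv_hd[OF d] Q by (simp add: stitch_def eyelets_def fingers_def)
  show "(turn ?w ^^ Suc (Suc (Suc 0))) (side (\<not> s) (Passage N Under (\<not> s)) (Passage N Over s)) =
        side (\<not> s) (last Q) (Passage (N + 3) Under s) \<or>
      (turn ?w ^^ Suc (Suc (Suc 0))) (side (\<not> s) (last Q) (Passage (N + 3) Under s)) =
        side (\<not> s) (Passage N Under (\<not> s)) (Passage N Over s)"
    by (cases s) (use n p x in \<open>simp_all add: side_def turning_def\<close>)
qed

section \<open>Planarity of the clasps\<close>

text \<open>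
  From the empty stitch to the clasp that one arc shift makes of a tied clasp
  (\<open>zigzag1\<close>, \<open>zigzag2\<close>), adding one bigon at a time. So every one of
  the diagrams is planar, and consecutive ones differ by an R2 move.
\<close>

lemma virtual_diagrams_untied:
  assumes g: "joinable s P Q" and N: "below N (P @ Q)"
  defines "v1 \<equiv> Passage (N + 4) Virtual s" and "c \<equiv> Passage (N + 5) Over s" and "v2 \<equiv> Passage (N + 6) Virtual (\<not> s)"
    and "e \<equiv> Passage (N + 7) Over (\<not> s)" and "a1 \<equiv> Passage (N + 8) Virtual (\<not> s)" and "a2 \<equiv> Passage (N + 9) Virtual s"
    and "b1 \<equiv> Passage (N + 10) Virtual (\<not> s)" and "b2 \<equiv> Passage (N + 11) Virtual s"
  shows "virtual_diagram (stitch N s [c, e] [opp e, opp c] P Q)"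
    and "virtual_diagram (stitch N s [v1, a1, c, e] [opp e, opp c, opp a1, opp v1] P Q)"
    and "virtual_diagram (stitch N s [v1, a1, a2, v2, c, e] [opp e, opp a2, opp v2, opp c, opp a1, opp v1] P Q)"
    and "virtual_diagram (stitch N s [v1, a1, a2, v2, c, b1, b2, e]
      [opp e, opp a2, opp v2, opp b2, opp b1, opp c, opp a1, opp v1] P Q)"
proof -
  have b: "below N P" "below N Q" using N by simp_all
  have Q: "Q \<noteq> []" using g by (simp add: joinable_def)
  note walk = side_def stitch_def eyelets_def fingers_def turning_def nxt_def prv_def image_Un
      dropWhile_neq below_notin[OF b(1)] below_notin[OF b(2)] below_crossing[OF b(1)] below_crossing[OF b(2)]
      hd_append hd_rev Q
  note names = v1_def c_def v2_def e_def a1_def a2_def b1_def b2_def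
  have 0: "virtual_diagram (stitch N s ([] @ []) ([] @ []) P Q)"
    using virtual_diagram_stitch_empty[OF g N] by simp
  have "virtual_diagram (stitch N s ([] @ [c, e] @ []) ([] @ [opp e, opp c] @ []) P Q)"
    by (rule virtual_diagram_stitch_insert[OF 0 _ _ _ _ _ refl refl, where r = s and k = "Suc (Suc 0)"], unfold names)
      (cases s; simp add: walk)+
  then show 1: "virtual_diagram (stitch N s [c, e] [opp e, opp c] P Q)" by simp
  have "virtual_diagram (stitch N s ([] @ [v1, a1] @ [c, e]) ([opp e, opp c] @ [opp a1, opp v1] @ []) P Q)"
    by (rule virtual_diagram_stitch_insert[OF _ _ _ _ _ _ refl refl, where r = s and k = "Suc 0"], use 1 in simp, unfold names)
      (cases s; simp add: walk)+
  then show 2: "virtual_diagram (stitch N s [v1, a1, c, e] [opp e, opp c, opp a1, opp v1] P Q)" by simp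
  have "virtual_diagram (stitch N s ([v1, a1] @ [a2, v2] @ [c, e]) ([opp e] @ [opp a2, opp v2] @ [opp c, opp a1, opp v1]) P Q)"
    by (rule virtual_diagram_stitch_insert[OF _ _ _ _ _ _ refl refl, where r = "\<not> s" and k = "Suc 0"], use 2 in simp, unfold names)
      (cases s; simp add: walk)+
  then show 3: "virtual_diagram (stitch N s [v1, a1, a2, v2, c, e] [opp e, opp a2, opp v2, opp c, opp a1, opp v1] P Q)"
    by simp
  have "virtual_diagram (stitch N s ([v1, a1, a2, v2, c] @ [b1, b2] @ [e])
      ([opp e, opp a2, opp v2] @ [opp b2, opp b1] @ [opp c, opp a1, opp v1]) P Q)"
    by (rule virtual_diagram_stitch_insert[OF _ _ _ _ _ _ refl refl, where r = "\<not> s" and k = "Suc 0"], use 3 in simp, unfold names)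
      (cases s; simp add: walk)+
  then show "virtual_diagram (stitch N s [v1, a1, a2, v2, c, b1, b2, e]
      [opp e, opp a2, opp v2, opp b2, opp b1, opp c, opp a1, opp v1] P Q)" by simp
qed

text \<open>
  From the tied clasp to the clasp after two arc shifts (\<open>double_zigzag1\<close>,
  \<open>double_zigzag2\<close>), again one bigon at a time. In all of them \<open>v1\<close> is
  the outermost crossing, as \<open>joinable_stitch_clasp\<close> wants it.
\<close>

lemma virtual_diagrams_tied:
  assumes g: "joinable s P Q" and N: "below N (P @ Q)"
  defines "v1 \<equiv> Passage (N + 4) Virtual s" and "c \<equiv> Passage (N + 5) Over (\<not> s)" and "v2 \<equiv> Passage (N + 6) Virtual s"
    and "e \<equiv> Passage (N + 7) Over (\<not> s)" and "a1 \<equiv> Passage (N + 8) Virtual (\<not> s)" and "a2 \<equiv> Passage (N + 9) Virtual s"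
    and "b1 \<equiv> Passage (N + 10) Virtual (\<not> s)" and "b2 \<equiv> Passage (N + 11) Virtual s"
    and "g1 \<equiv> Passage (N + 12) Virtual (\<not> s)" and "g2 \<equiv> Passage (N + 13) Virtual s"
    and "d1 \<equiv> Passage (N + 14) Virtual (\<not> s)" and "d2 \<equiv> Passage (N + 15) Virtual s"
  shows "virtual_diagram (stitch N s [v1, c, v2, e] [opp e, opp v2, opp c, opp v1] P Q)"
    and "virtual_diagram (stitch N s [v1, c, v2, d1, b2, e] [opp e, opp v2, opp d1, opp b2, opp c, opp v1] P Q)"
    and "virtual_diagram (stitch N s [v1, c, v2, d1, d2, b1, b2, e]
      [opp e, opp v2, opp d1, opp b2, opp b1, opp d2, opp c, opp v1] P Q)"
    and "virtual_diagram (stitch N s [v1, a1, g2, c, v2, d1, d2, b1, b2, e]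
      [opp e, opp v2, opp d1, opp b2, opp b1, opp d2, opp c, opp g2, opp a1, opp v1] P Q)"
    and "virtual_diagram (stitch N s [v1, a1, a2, g1, g2, c, v2, d1, d2, b1, b2, e]
      [opp e, opp a2, opp g1, opp v2, opp d1, opp b2, opp b1, opp d2, opp c, opp g2, opp a1, opp v1] P Q)"
proof -
  have b: "below N P" "below N Q" using N by simp_all
  have Q: "Q \<noteq> []" using g by (simp add: joinable_def)
  note walk = side_def stitch_def eyelets_def fingers_def turning_def nxt_def prv_def image_Un
      dropWhile_neq below_notin[OF b(1)] below_notin[OF b(2)] below_crossing[OF b(1)] below_crossing[OF b(2)]
      hd_append hd_rev Q
  note names = v1_def c_def v2_def e_def a1_def a2_def b1_def b2_def g1_def g2_def d1_def d2_def
  have 0: "virtual_diagram (stitch N s ([] @ []) ([] @ []) P Q)"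
    using virtual_diagram_stitch_empty[OF g N] by simp
  have "virtual_diagram (stitch N s ([] @ [v1, c] @ []) ([] @ [opp c, opp v1] @ []) P Q)"
    by (rule virtual_diagram_stitch_insert[OF 0 _ _ _ _ _ refl refl, where r = s and k = "Suc (Suc 0)"], unfold names)
      (cases s; simp add: walk)+
  then have 1: "virtual_diagram (stitch N s [v1, c] [opp c, opp v1] P Q)" by simp
  have "virtual_diagram (stitch N s ([v1, c] @ [v2, e] @ []) ([] @ [opp e, opp v2] @ [opp c, opp v1]) P Q)"
    by (rule virtual_diagram_stitch_insert[OF _ _ _ _ _ _ refl refl, where r = s and k = "Suc 0"], use 1 in simp, unfold names)
      (cases s; simp add: walk)+
  then show 2: "virtual_diagram (stitch N s [v1, c, v2, e] [opp e, opp v2, opp c, opp v1] P Q)" by simp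
  have "virtual_diagram (stitch N s ([v1, c, v2] @ [d1, b2] @ [e]) ([opp e, opp v2] @ [opp d1, opp b2] @ [opp c, opp v1]) P Q)"
    by (rule virtual_diagram_stitch_insert[OF _ _ _ _ _ _ refl refl, where r = s and k = "Suc 0"], use 2 in simp, unfold names)
      (cases s; simp add: walk)+
  then show 3: "virtual_diagram (stitch N s [v1, c, v2, d1, b2, e] [opp e, opp v2, opp d1, opp b2, opp c, opp v1] P Q)"
    by simp
  have "virtual_diagram (stitch N s ([v1, c, v2, d1] @ [d2, b1] @ [b2, e])
      ([opp e, opp v2, opp d1, opp b2] @ [opp b1, opp d2] @ [opp c, opp v1]) P Q)"
    by (rule virtual_diagram_stitch_insert[OF _ _ _ _ _ _ refl refl, where r = s and k = "Suc 0"], use 3 in simp, unfold names)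
      (cases s; simp add: walk)+
  then show 4: "virtual_diagram (stitch N s [v1, c, v2, d1, d2, b1, b2, e]
      [opp e, opp v2, opp d1, opp b2, opp b1, opp d2, opp c, opp v1] P Q)" by simp
  have "virtual_diagram (stitch N s ([v1] @ [a1, g2] @ [c, v2, d1, d2, b1, b2, e])
      ([opp e, opp v2, opp d1, opp b2, opp b1, opp d2, opp c] @ [opp g2, opp a1] @ [opp v1]) P Q)"
    by (rule virtual_diagram_stitch_insert[OF _ _ _ _ _ _ refl refl, where r = "\<not> s" and k = "Suc 0"], use 4 in simp, unfold names)
      (cases s; simp add: walk)+
  then show 5: "virtual_diagram (stitch N s [v1, a1, g2, c, v2, d1, d2, b1, b2, e]
      [opp e, opp v2, opp d1, opp b2, opp b1, opp d2, opp c, opp g2, opp a1, opp v1] P Q)" by simp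
  have "virtual_diagram (stitch N s ([v1, a1] @ [a2, g1] @ [g2, c, v2, d1, d2, b1, b2, e])
      ([opp e] @ [opp a2, opp g1] @ [opp v2, opp d1, opp b2, opp b1, opp d2, opp c, opp g2, opp a1, opp v1]) P Q)"
    by (rule virtual_diagram_stitch_insert[OF _ _ _ _ _ _ refl refl, where r = "\<not> s" and k = "Suc (Suc (Suc 0))"], use 5 in simp, unfold names)
      (cases s; simp add: walk)+
  then show "virtual_diagram (stitch N s [v1, a1, a2, g1, g2, c, v2, d1, d2, b1, b2, e]
      [opp e, opp a2, opp g1, opp v2, opp d1, opp b2, opp b1, opp d2, opp c, opp g2, opp a1, opp v1] P Q)" by simp
qed

section \<open>Moves inside a tower of ties\<close>

text \<open>
  A move within a pair of subwords that is a move in every surrounding word. R1 and R2 moves are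
  of this kind; the other rules refer to a face, to the base edge or to all crossings.
\<close>

definition context_move :: "passage list \<times> passage list \<Rightarrow> passage list \<times> passage list \<Rightarrow> bool" where
  "context_move X Y \<longleftrightarrow> (\<forall>L M. move (L @ fst X @ M @ snd X) (L @ fst Y @ M @ snd Y))"

text \<open>
  A tie around the pair uses crossing numbers from \<open>N\<close> on, which must be new.
\<close>

definition fits :: "bool \<Rightarrow> nat \<Rightarrow> passage list \<times> passage list \<Rightarrow> bool" where
  "fits s N X \<longleftrightarrow> joinable s (fst X) (snd X) \<and> below N (fst X @ snd X)"

definition step :: "bool \<Rightarrow> nat \<Rightarrow> passage list \<times> passage list \<Rightarrow> passage list \<times> passage list \<Rightarrow> bool" where
  "step s N X Y \<longleftrightarrow> fits s N X \<and> fits s N Y \<and> context_move X Y"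

abbreviation pair_equiv :: "bool \<Rightarrow> nat \<Rightarrow> passage list \<times> passage list \<Rightarrow> passage list \<times> passage list \<Rightarrow> bool" where
  "pair_equiv s N \<equiv> equivclp (step s N)"

text \<open>
  The clasp of a tie, as seen from the first loop. The second loop meets the four crossings in
  reverse order and lies below at both classical ones. Consecutive crossings of two strands
  alternate in direction, so the virtual crossing between the two classical ones makes these agree
  in direction. That is why they do not cancel, and why reversing one of them by an arc shift lets
  them cancel.
\<close>

definition tied :: "nat \<Rightarrow> bool \<Rightarrow> passage list" where
  "tied N s = [Passage (N + 4) Virtual s, Passage (N + 5) Over (\<not> s),
               Passage (N + 6) Virtual s, Passage (N + 7) Over (\<not> s)]"

definition with_tips :: "nat \<Rightarrow> bool \<Rightarrow> passage list \<Rightarrow> passage list \<Rightarrow> passage list \<times> passage list \<Rightarrow> passage list \<times> passage list" where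
  "with_tips N s t1 t2 X = (eyelets N s, fingers N s t1 t2 (fst X) (snd X))"

definition tie :: "nat \<Rightarrow> bool \<Rightarrow> passage list \<times> passage list \<Rightarrow> passage list \<times> passage list" where
  "tie N s = with_tips N s (tied N s) (map opp (rev (tied N s)))"

lemma context_move_R1:
  "crossing p = crossing q \<Longrightarrow> context_move (P, A @ B) (P, A @ [p, q] @ B)"
  unfolding context_move_def using move.R1[of p q "_ @ P @ _ @ A" B] by simp

lemma context_move_R2_both:
  assumes "crossing p1 \<noteq> crossing p2" "{crossing q1, crossing q2} = {crossing p1, crossing p2}"
    "level p1 = level p2" "from_left p1 \<noteq> from_left p2"
  shows "context_move (P1 @ P2, Q1 @ Q2) (P1 @ [p1, p2] @ P2, Q1 @ [q1, q2] @ Q2)"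
  unfolding context_move_def
proof (intro allI)
  fix L M
  show "move (L @ fst (P1 @ P2, Q1 @ Q2) @ M @ snd (P1 @ P2, Q1 @ Q2))
      (L @ fst (P1 @ [p1, p2] @ P2, Q1 @ [q1, q2] @ Q2) @ M @ snd (P1 @ [p1, p2] @ P2, Q1 @ [q1, q2] @ Q2))"
    using move.R2[OF assms, of "L @ P1" "P2 @ M @ Q1" Q2] by simp
qed

lemma context_move_R2_right:
  assumes "crossing p1 \<noteq> crossing p2" "{crossing q1, crossing q2} = {crossing p1, crossing p2}"
    "level p1 = level p2" "from_left p1 \<noteq> from_left p2"
  shows "context_move (P, A @ B @ C) (P, A @ [p1, p2] @ B @ [q1, q2] @ C)"
  unfolding context_move_def
proof (intro allI)
  fix L M
  show "move (L @ fst (P, A @ B @ C) @ M @ snd (P, A @ B @ C))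
      (L @ fst (P, A @ [p1, p2] @ B @ [q1, q2] @ C) @ M @ snd (P, A @ [p1, p2] @ B @ [q1, q2] @ C))"
    using move.R2[OF assms, of "L @ P @ M @ A" B C] by simp
qed

lemma fits_with_tips:
  assumes "virtual_diagram (stitch N s (x # t1) (t2 @ [opp x]) P Q)" "from_left x = s"
    and "fits s N (P, Q)" "below (N + 16) (x # t1)" "below (N + 16) t2"
  shows "fits (\<not> s) (N + 16) (with_tips N s (x # t1) (t2 @ [opp x]) (P, Q))"
proof -
  have "Q \<noteq> []" "below N P" "below N Q" using assms(3) by (auto simp: fits_def joinable_def)
  moreover have "below (N + 16) P" "below (N + 16) Q" using calculation by (fastforce simp: below_def)+
  ultimately show ?thesis using joinable_stitch_clasp[OF assms(1) _ assms(2)] assms(4,5)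
    by (simp add: fits_def with_tips_def) (simp add: eyelets_def fingers_def)
qed

lemma fits_tie:
  assumes "fits s N X"
  shows "fits (\<not> s) (N + 16) (tie N s X)"
proof -
  obtain P Q where X: "X = (P, Q)" by (cases X)
  have g: "joinable s P Q" "below N (P @ Q)" using assms by (auto simp: fits_def X)
  have "fits (\<not> s) (N + 16) (with_tips N s [Passage (N + 4) Virtual s, Passage (N + 5) Over (\<not> s),
               Passage (N + 6) Virtual s, Passage (N + 7) Over (\<not> s)]
      (map opp [Passage (N + 7) Over (\<not> s), Passage (N + 6) Virtual s, Passage (N + 5) Over (\<not> s)] @
         [opp (Passage (N + 4) Virtual s)]) (P, Q))"
    by (rule fits_with_tips) (use virtual_diagrams_tied(1)[OF g] assms X in simp_all)
  then show ?thesis by (simp add: tie_def tied_def X)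
qed

text \<open>
  A move inside the inner pair remains a move after tying, because the tie leaves both subwords
  intact and only adds a context.
\<close>

lemma step_tie:
  assumes "step s N X Y"
  shows "step (\<not> s) (N + 16) (tie N s X) (tie N s Y)"
proof -
  have "context_move (tie N s X) (tie N s Y)"
    unfolding context_move_def
  proof (intro allI)
    fix L M
    have "move ((L @ eyelets N s @ M @ [Passage N Over s] @ tied N s @ [Passage (N + 1) Over (\<not> s)]) @ fst X @
         ([Passage (N + 2) Over s] @ map opp (rev (tied N s)) @ [Passage (N + 3) Over (\<not> s)]) @ snd X)
       ((L @ eyelets N s @ M @ [Passage N Over s] @ tied N s @ [Passage (N + 1) Over (\<not> s)]) @ fst Y @
         ([Passage (N + 2) Over s] @ map opp (rev (tied N s)) @ [Passage (N + 3) Over (\<not> s)]) @ snd Y)"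
      using assms unfolding step_def context_move_def by blast
    then show "move (L @ fst (tie N s X) @ M @ snd (tie N s X)) (L @ fst (tie N s Y) @ M @ snd (tie N s Y))"
      by (simp add: tie_def with_tips_def fingers_def)
  qed
  then show ?thesis using assms fits_tie by (simp add: step_def)
qed

lemma equivclp_map:
  assumes "equivclp r x y" "\<And>x y. r x y \<Longrightarrow> q (f x) (f y)"
  shows "equivclp q (f x) (f y)"
  using assms(1)
proof (induction rule: equivclp_induct)
  case base
  show ?case by (simp add: equivclp_def)
next
  case (step y z)
  then have "symclp q (f y) (f z)" using assms(2) by (auto simp: symclp_def)
  then show ?case using step(3) unfolding equivclp_def by (rule rtranclp.rtrancl_into_rtrancl[rotated])
qed

text \<open>
  Counted from zero, tie \<open>k\<close> has the crossing numbers from \<open>16 * (k +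
  1)\<close> up to the next multiple of 16, which leaves room for the crossings made by two arc
  shifts. Successive ties are on alternating sides (\<open>even\<close>).
\<close>

fun tower :: "nat \<Rightarrow> nat \<Rightarrow> passage list \<times> passage list \<Rightarrow> passage list \<times> passage list" where
  "tower k 0 X = X"
| "tower k (Suc d) X = tie (16 * (k + d + 1)) (even (k + d)) (tower k d X)"

lemma fits_tower: "fits (even k) (16 * (k + 1)) X \<Longrightarrow> fits (even (k + d)) (16 * (k + d + 1)) (tower k d X)"
proof (induction d)
  case (Suc d)
  then show ?case using fits_tie[of "even (k + d)" "16 * (k + d + 1)" "tower k d X"] by (simp add: algebra_simps)
qed simp

lemma step_tower:
  "step (even k) (16 * (k + 1)) X Y \<Longrightarrow> step (even (k + d)) (16 * (k + d + 1)) (tower k d X) (tower k d Y)"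
proof (induction d)
  case (Suc d)
  then show ?case using step_tie[of "even (k + d)" "16 * (k + d + 1)" "tower k d X" "tower k d Y"]
    by (simp add: algebra_simps)
qed simp

definition word :: "passage list \<times> passage list \<Rightarrow> passage list" where
  "word X = fst X @ snd X"

lemma step_word: "step s N X Y \<Longrightarrow> diagram_step (word X) (word Y)"
  unfolding step_def context_move_def diagram_step_def word_def fits_def joinable_def
  by (metis append_Nil)

lemma pair_equiv_tower:
  assumes "pair_equiv (even k) (16 * (k + 1)) X Y" "fits (even k) (16 * (k + 1)) X" "fits (even k) (16 * (k + 1)) Y"
  shows "(word (tower k d X), word (tower k d Y)) \<in> virtual_equiv"
proof -
  have "equivclp diagram_step (word (tower k d X)) (word (tower k d Y))"
    using equivclp_map[OF assms(1), of diagram_step "\<lambda>X. word (tower k d X)"] step_word step_tower by blast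
  then show ?thesis using fits_tower[OF assms(2), of d] fits_tower[OF assms(3), of d]
    by (simp add: virtual_equiv_def fits_def joinable_def word_def)
qed

lemma step_pair_equiv: "step s N X Y \<Longrightarrow> pair_equiv s N X Y"
  by (metis r_into_equivclp)

lemma pair_equiv_trans: "pair_equiv s N X Y \<Longrightarrow> pair_equiv s N Y Z \<Longrightarrow> pair_equiv s N X Z"
  by (rule equivclp_trans)

lemma fits_trivial:
  assumes "virtual_diagram w" "w \<noteq> []" "below N w"
  shows "fits s N ([], w)"
  using assms by (simp add: fits_def joinable_def orbit_refl)

text \<open>
  Certifies the common region by a walk of \<open>k\<close> turns, in either direction.
\<close>

lemma joinable_walk:
  assumes w: "virtual_diagram (P @ Q)" and Q: "Q \<noteq> []"
    and near: "(turn (P @ Q) ^^ k) (side s (last (Q @ P)) (hd (Q @ P))) = side s (last (P @ Q)) (hd (P @ Q)) \<or>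
      (turn (P @ Q) ^^ k) (side s (last (P @ Q)) (hd (P @ Q))) = side s (last (Q @ P)) (hd (Q @ P))"
  shows "joinable s P Q"
proof -
  have gw: "gauss_word (P @ Q)" using w virtual_diagram_def by blast
  have l: "last (Q @ P) \<in> set (P @ Q)" using Q last_in_set[of "Q @ P"] by auto
  have m: "side s (last (Q @ P)) (hd (Q @ P)) \<in> set (P @ Q) \<times> UNIV"
    using l Q by (auto simp: side_def)
  have "side s (last (Q @ P)) (hd (Q @ P)) \<in> orbit (turn (P @ Q)) (side s (last (P @ Q)) (hd (P @ Q)))"
    using near
  proof
    assume "(turn (P @ Q) ^^ k) (side s (last (Q @ P)) (hd (Q @ P))) = side s (last (P @ Q)) (hd (P @ Q))"
    then show ?thesis by (intro orbit_turn_sym[OF gw m] orbitI)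
  qed (rule orbitI)
  then show ?thesis using w Q by (simp add: joinable_def)
qed

text \<open>
  The loops are pulled out by three R2 moves. The result is the pair with empty first component:
  the base edge and the cut edge have become the same edge.
\<close>

lemma untie:
  assumes X: "fits s N (P, Q)"
  shows "pair_equiv (\<not> s) (N + 16) ([], P @ Q)
      (with_tips N s [Passage (N + 5) Over s, Passage (N + 7) Over (\<not> s)]
         [Passage (N + 7) Under s, Passage (N + 5) Under (\<not> s)] (P, Q))"
proof -
  have g: "joinable s P Q" and b: "below N P" "below N Q" and b': "below N (P @ Q)" using X by (auto simp: fits_def)
  have vd: "virtual_diagram (P @ Q)" and Q: "Q \<noteq> []" using g by (auto simp: joinable_def)
  have b16: "below (N + 16) P" "below (N + 16) Q" using b by (fastforce simp: below_def)+
  let ?Y1 = "([Passage (N + 1) Under s, Passage N Under (\<not> s)], [Passage N Over s, Passage (N + 1) Over (\<not> s)] @ P @ Q)"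
  let ?Y2 = "with_tips N s [] [] (P, Q)"
  let ?Y3 = "with_tips N s [Passage (N + 5) Over s, Passage (N + 7) Over (\<not> s)]
         [Passage (N + 7) Under s, Passage (N + 5) Under (\<not> s)] (P, Q)"
  have f0: "fits (\<not> s) (N + 16) ([], P @ Q)" using fits_trivial[of "P @ Q"] vd Q b16 by simp
  have v1: "virtual_diagram (fst ?Y1 @ snd ?Y1)"
    using virtual_diagram_insert_finger(1)[OF vd, of "Passage (N + 1) Under s" "Passage N Under (\<not> s)"] Q
      below_crossing[OF b'] by (simp add: image_Un)
  have "joinable (\<not> s) (fst ?Y1) (snd ?Y1)"
  proof (cases s)
    case True
    then show ?thesis
      by (intro joinable_walk[OF v1 _ disjI1, where k = "Suc (Suc 0)"])
        (simp_all add: Q side_def turning_def nxt_def prv_def hd_append hd_rev dropWhile_neq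
          below_notin[OF b(1)] below_notin[OF b(2)])
  next
    case False
    then show ?thesis
      by (intro joinable_walk[OF v1 _ disjI2, where k = "Suc (Suc 0)"])
        (simp_all add: Q side_def turning_def nxt_def prv_def hd_append hd_rev dropWhile_neq
          below_notin[OF b(1)] below_notin[OF b(2)])
  qed
  then have f1: "fits (\<not> s) (N + 16) ?Y1" using b16 by (simp add: fits_def)
  have f2: "fits (\<not> s) (N + 16) ?Y2" using joinable_stitch_empty[OF g b'] b16
    by (simp add: fits_def with_tips_def) (simp add: eyelets_def fingers_def)
  have f3: "fits (\<not> s) (N + 16) ?Y3"
    using fits_with_tips[of N s "Passage (N + 5) Over s" "[Passage (N + 7) Over (\<not> s)]" "[Passage (N + 7) Under s]" P Q]
      virtual_diagrams_untied(1)[OF g b'] X by simp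
  have "step (\<not> s) (N + 16) ([], P @ Q) ?Y1"
    using f0 f1 context_move_R2_both[of "Passage (N + 1) Under s" "Passage N Under (\<not> s)"
        "Passage N Over s" "Passage (N + 1) Over (\<not> s)" "[]" "[]" "[]" "P @ Q"]
    by (auto simp: step_def)
  moreover have "step (\<not> s) (N + 16) ?Y1 ?Y2"
    using f1 f2 context_move_R2_both[of "Passage (N + 3) Under s" "Passage (N + 2) Under (\<not> s)"
        "Passage (N + 2) Over s" "Passage (N + 3) Over (\<not> s)" "[]" "[Passage (N + 1) Under s, Passage N Under (\<not> s)]"
        "[Passage N Over s, Passage (N + 1) Over (\<not> s)] @ P" Q]
    by (auto simp: step_def with_tips_def eyelets_def fingers_def)
  moreover have "step (\<not> s) (N + 16) ?Y2 ?Y3"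
    using f2 f3 context_move_R2_right[of "Passage (N + 5) Over s" "Passage (N + 7) Over (\<not> s)"
        "Passage (N + 7) Under s" "Passage (N + 5) Under (\<not> s)" "eyelets N s" "[Passage N Over s]"
        "[Passage (N + 1) Over (\<not> s)] @ P @ [Passage (N + 2) Over s]" "[Passage (N + 3) Over (\<not> s)] @ Q"]
    by (auto simp: step_def with_tips_def fingers_def)
  ultimately show ?thesis by (meson step_pair_equiv pair_equiv_trans)
qed

section \<open>Untying\<close>

text \<open>
  A tie around a pair \<open>([], w)\<close> comes undone: its two loops are neighbours on one
  strand, so the eyelets \<open>N + 1\<close> and \<open>N + 2\<close> cancel by an R2 move, the
  four crossings of the clasp are then nested kinks and disappear by R1 moves from the inside out,
  and a final R2 move removes the remaining loop. The proof runs through this in the opposite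
  direction.
\<close>

lemma tie_trivial:
  assumes vd: "virtual_diagram w" and ne: "w \<noteq> []" and b: "below N w"
  shows "pair_equiv (\<not> s) (N + 16) ([], w) (tie N s ([], w))"
proof -
  let ?Z = "\<lambda>t. ([Passage (N + 3) Under s, Passage N Under (\<not> s)],
    [Passage N Over s] @ t @ [Passage (N + 3) Over (\<not> s)] @ w)"
  define v1 where "v1 = Passage (N + 4) Virtual s"
  define c where "c = Passage (N + 5) Over (\<not> s)"
  define v2 where "v2 = Passage (N + 6) Virtual s"
  define e where "e = Passage (N + 7) Over (\<not> s)"
  note names = v1_def c_def v2_def e_def
  note walk = ne side_def turning_def nxt_def prv_def hd_append hd_rev dropWhile_neq below_notin[OF b]
  have b16: "below (N + 16) w" using b by (fastforce simp: below_def)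
  have fr: "k \<notin> crossing ` set w" if "N \<le> k" for k using below_crossing[OF b that] .
  have f0: "fits (\<not> s) (N + 16) ([], w)" using fits_trivial[OF vd ne b16] .
  have 0: "virtual_diagram (fst (?Z []) @ snd (?Z []))"
    using virtual_diagram_insert_finger(1)[OF vd ne, of "Passage (N + 3) Under s" "Passage N Under (\<not> s)"] fr by simp
  have insert: "virtual_diagram (fst (?Z (t @ [x, opp x] @ t')) @ snd (?Z (t @ [x, opp x] @ t')))"
    if "virtual_diagram (fst (?Z (t @ t')) @ snd (?Z (t @ t')))" "N \<le> crossing x"
      "crossing x \<notin> {N, N + 3} \<union> crossing ` set (t @ t')" for t t' x
    using virtual_diagram_insert_R1[of "[Passage (N + 3) Under s, Passage N Under (\<not> s), Passage N Over s] @ t"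
        "t' @ [Passage (N + 3) Over (\<not> s)] @ w" x] that fr[of "crossing x"] by (simp add: image_Un)
  have 1: "virtual_diagram (fst (?Z [v1, opp v1]) @ snd (?Z [v1, opp v1]))"
    using insert[of "[]" "[]" v1] 0 by (simp add: names)
  have 2: "virtual_diagram (fst (?Z [v1, c, opp c, opp v1]) @ snd (?Z [v1, c, opp c, opp v1]))"
    using insert[of "[v1]" "[opp v1]" c] 1 by (simp add: names)
  have 3: "virtual_diagram (fst (?Z [v1, c, v2, opp v2, opp c, opp v1]) @ snd (?Z [v1, c, v2, opp v2, opp c, opp v1]))"
    using insert[of "[v1, c]" "[opp c, opp v1]" v2] 2 by (simp add: names)
  have 4: "virtual_diagram (fst (?Z [v1, c, v2, e, opp e, opp v2, opp c, opp v1]) @ snd (?Z [v1, c, v2, e, opp e, opp v2, opp c, opp v1]))"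
    using insert[of "[v1, c, v2]" "[opp v2, opp c, opp v1]" e] 3 by (simp add: names)
  have "joinable (\<not> s) (fst (?Z [])) (snd (?Z []))"
  proof (cases s)
    case True
    then show ?thesis
      by (intro joinable_walk[OF 0 _ disjI1, where k = "Suc (Suc 0)"]) (simp_all add: walk)
  next
    case False
    then show ?thesis
      by (intro joinable_walk[OF 0 _ disjI2, where k = "Suc (Suc 0)"]) (simp_all add: walk)
  qed
  then have f1: "fits (\<not> s) (N + 16) (?Z [])" using b16 by (simp add: fits_def)
  have joinable: "joinable (\<not> s) (fst (?Z (v1 # t @ [opp v1]))) (snd (?Z (v1 # t @ [opp v1])))"
    if vd: "virtual_diagram (fst (?Z (v1 # t @ [opp v1])) @ snd (?Z (v1 # t @ [opp v1])))"
      and t: "crossing ` set t \<inter> {N, N + 3, N + 4} = {}" for t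
  proof -
    have nt: "Passage N l b \<notin> set t" "Passage (N + 3) l b \<notin> set t" "Passage (N + 4) l b \<notin> set t" for l b
      using t by force+
    show ?thesis
    proof (cases s)
      case True
      then show ?thesis
        by (intro joinable_walk[OF vd _ disjI1, where k = "Suc (Suc (Suc 0))"]) (simp_all add: walk names nt)
    next
      case False
      then show ?thesis
        by (intro joinable_walk[OF vd _ disjI2, where k = "Suc (Suc (Suc 0))"]) (simp_all add: walk names nt)
    qed
  qed
  have f2: "fits (\<not> s) (N + 16) (?Z [v1, opp v1])"
    using joinable[of "[]"] 1 b16 by (simp add: fits_def names)
  have f3: "fits (\<not> s) (N + 16) (?Z [v1, c, opp c, opp v1])"
    using joinable[of "[c, opp c]"] 2 b16 by (simp add: fits_def names)
  have f4: "fits (\<not> s) (N + 16) (?Z [v1, c, v2, opp v2, opp c, opp v1])"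
    using joinable[of "[c, v2, opp v2, opp c]"] 3 b16 by (simp add: fits_def names)
  have f5: "fits (\<not> s) (N + 16) (?Z [v1, c, v2, e, opp e, opp v2, opp c, opp v1])"
    using joinable[of "[c, v2, e, opp e, opp v2, opp c]"] 4 b16 by (simp add: fits_def names)
  have f6: "fits (\<not> s) (N + 16) (tie N s ([], w))"
    by (rule fits_tie[OF fits_trivial[OF vd ne b]])
  have R1: "context_move (?Z (t @ t')) (?Z (t @ [x, opp x] @ t'))" for t t' x
    using context_move_R1[of x "opp x" "[Passage (N + 3) Under s, Passage N Under (\<not> s)]"
      "[Passage N Over s] @ t" "t' @ [Passage (N + 3) Over (\<not> s)] @ w"] by simp
  have "step (\<not> s) (N + 16) ([], w) (?Z [])"
    using f0 f1 context_move_R2_both[of "Passage (N + 3) Under s" "Passage N Under (\<not> s)"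
        "Passage N Over s" "Passage (N + 3) Over (\<not> s)" "[]" "[]" "[]" w]
    by (auto simp: step_def)
  moreover have "step (\<not> s) (N + 16) (?Z []) (?Z [v1, opp v1])"
    using f1 f2 R1[of "[]" "[]" v1] by (simp add: step_def)
  moreover have "step (\<not> s) (N + 16) (?Z [v1, opp v1]) (?Z [v1, c, opp c, opp v1])"
    using f2 f3 R1[of "[v1]" "[opp v1]" c] by (simp add: step_def)
  moreover have "step (\<not> s) (N + 16) (?Z [v1, c, opp c, opp v1]) (?Z [v1, c, v2, opp v2, opp c, opp v1])"
    using f3 f4 R1[of "[v1, c]" "[opp c, opp v1]" v2] by (simp add: step_def)
  moreover have "step (\<not> s) (N + 16) (?Z [v1, c, v2, opp v2, opp c, opp v1])
      (?Z [v1, c, v2, e, opp e, opp v2, opp c, opp v1])"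
    using f4 f5 R1[of "[v1, c, v2]" "[opp v2, opp c, opp v1]" e] by (simp add: step_def)
  moreover have "step (\<not> s) (N + 16) (?Z [v1, c, v2, e, opp e, opp v2, opp c, opp v1]) (tie N s ([], w))"
    using f5 f6 context_move_R2_both[of "Passage (N + 2) Under (\<not> s)" "Passage (N + 1) Under s"
        "Passage (N + 1) Over (\<not> s)" "Passage (N + 2) Over s" "[Passage (N + 3) Under s]" "[Passage N Under (\<not> s)]"
        "[Passage N Over s, v1, c, v2, e]" "[opp e, opp v2, opp c, opp v1, Passage (N + 3) Over (\<not> s)] @ w"]
    by (auto simp: step_def tie_def with_tips_def eyelets_def fingers_def tied_def names)
  ultimately show ?thesis by (meson step_pair_equiv pair_equiv_trans)
qed

lemma context_move_tips:
  assumes "crossing p1 \<noteq> crossing p2" "{crossing q1, crossing q2} = {crossing p1, crossing p2}"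
    "level p1 = level p2" "from_left p1 \<noteq> from_left p2"
  shows "context_move (with_tips N s (t1 @ t1') (t2 @ t2') X) (with_tips N s (t1 @ [p1, p2] @ t1') (t2 @ [q1, q2] @ t2') X)"
  using context_move_R2_right[OF assms, of "eyelets N s" "[Passage N Over s] @ t1"
    "t1' @ [Passage (N + 1) Over (\<not> s)] @ fst X @ [Passage (N + 2) Over s] @ t2" "t2' @ [Passage (N + 3) Over (\<not> s)] @ snd X"]
  by (simp add: with_tips_def fingers_def)

text \<open>
  The two sides of the clasp after an arc shift on the two middle crossings \<open>N + 5\<close>
  and \<open>N + 6\<close> of \<open>tied\<close>. The arc is traversed backwards, and the
  crossings \<open>N + 8\<close> to \<open>N + 11\<close> belong to the connecting strands.
\<close>

definition zigzag1 :: "nat \<Rightarrow> bool \<Rightarrow> passage list" where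
  "zigzag1 N s = [Passage (N + 4) Virtual s, Passage (N + 8) Virtual (\<not> s), Passage (N + 9) Virtual s,
     Passage (N + 6) Virtual (\<not> s), Passage (N + 5) Over s, Passage (N + 10) Virtual (\<not> s),
     Passage (N + 11) Virtual s, Passage (N + 7) Over (\<not> s)]"

definition zigzag2 :: "nat \<Rightarrow> bool \<Rightarrow> passage list" where
  "zigzag2 N s = [Passage (N + 7) Under s, Passage (N + 9) Virtual (\<not> s), Passage (N + 6) Virtual s,
     Passage (N + 11) Virtual (\<not> s), Passage (N + 10) Virtual s, Passage (N + 5) Under (\<not> s),
     Passage (N + 8) Virtual s, Passage (N + 4) Virtual (\<not> s)]"

text \<open>
  A second arc shift on the same two crossings restores their order; it adds the crossings
  \<open>N + 12\<close> to \<open>N + 15\<close>.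
\<close>

definition double_zigzag1 :: "nat \<Rightarrow> bool \<Rightarrow> passage list" where
  "double_zigzag1 N s = [Passage (N + 4) Virtual s, Passage (N + 8) Virtual (\<not> s), Passage (N + 9) Virtual s,
     Passage (N + 12) Virtual (\<not> s), Passage (N + 13) Virtual s, Passage (N + 5) Over (\<not> s),
     Passage (N + 6) Virtual s, Passage (N + 14) Virtual (\<not> s), Passage (N + 15) Virtual s,
     Passage (N + 10) Virtual (\<not> s), Passage (N + 11) Virtual s, Passage (N + 7) Over (\<not> s)]"

definition double_zigzag2 :: "nat \<Rightarrow> bool \<Rightarrow> passage list" where
  "double_zigzag2 N s = [Passage (N + 7) Under s, Passage (N + 9) Virtual (\<not> s), Passage (N + 12) Virtual s,
     Passage (N + 6) Virtual (\<not> s), Passage (N + 14) Virtual s, Passage (N + 11) Virtual (\<not> s),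
     Passage (N + 10) Virtual s, Passage (N + 15) Virtual (\<not> s), Passage (N + 5) Under s,
     Passage (N + 13) Virtual (\<not> s), Passage (N + 8) Virtual s, Passage (N + 4) Virtual (\<not> s)]"

text \<open>
  The arc shift has reversed the classical crossing \<open>N + 5\<close>, which now cancels with
  \<open>N + 7\<close>. Around these two, the virtual crossings form three bigons.
\<close>

lemma fits_zigzag:
  assumes X: "fits s N (P, Q)"
  shows "fits (\<not> s) (N + 16) (with_tips N s (zigzag1 N s) (zigzag2 N s) (P, Q))"
    and "pair_equiv (\<not> s) (N + 16) (with_tips N s [Passage (N + 5) Over s, Passage (N + 7) Over (\<not> s)]
         [Passage (N + 7) Under s, Passage (N + 5) Under (\<not> s)] (P, Q))
       (with_tips N s (zigzag1 N s) (zigzag2 N s) (P, Q))"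
proof -
  have g: "joinable s P Q" "below N (P @ Q)" using X by (auto simp: fits_def)
  define v1 where "v1 = Passage (N + 4) Virtual s"
  define c where "c = Passage (N + 5) Over s"
  define v2 where "v2 = Passage (N + 6) Virtual (\<not> s)"
  define e where "e = Passage (N + 7) Over (\<not> s)"
  define a1 where "a1 = Passage (N + 8) Virtual (\<not> s)"
  define a2 where "a2 = Passage (N + 9) Virtual s"
  define b1 where "b1 = Passage (N + 10) Virtual (\<not> s)"
  define b2 where "b2 = Passage (N + 11) Virtual s"
  note names = v1_def c_def v2_def e_def a1_def a2_def b1_def b2_def
  note vd = virtual_diagrams_untied[OF g, folded names]
  have f1: "fits (\<not> s) (N + 16) (with_tips N s (c # [e]) ([opp e] @ [opp c]) (P, Q))"
    by (rule fits_with_tips) (use vd(1) X in \<open>simp_all add: names\<close>)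
  have f2: "fits (\<not> s) (N + 16) (with_tips N s (v1 # [a1, c, e]) ([opp e, opp c, opp a1] @ [opp v1]) (P, Q))"
    by (rule fits_with_tips) (use vd(2) X in \<open>simp_all add: names\<close>)
  have f3: "fits (\<not> s) (N + 16) (with_tips N s (v1 # [a1, a2, v2, c, e]) ([opp e, opp a2, opp v2, opp c, opp a1] @ [opp v1]) (P, Q))"
    by (rule fits_with_tips) (use vd(3) X in \<open>simp_all add: names\<close>)
  have f4: "fits (\<not> s) (N + 16) (with_tips N s (v1 # [a1, a2, v2, c, b1, b2, e])
      ([opp e, opp a2, opp v2, opp b2, opp b1, opp c, opp a1] @ [opp v1]) (P, Q))"
    by (rule fits_with_tips) (use vd(4) X in \<open>simp_all add: names\<close>)
  have z: "zigzag1 N s = v1 # [a1, a2, v2, c, b1, b2, e]"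
    "zigzag2 N s = [opp e, opp a2, opp v2, opp b2, opp b1, opp c, opp a1] @ [opp v1]"
    by (simp_all add: zigzag1_def zigzag2_def names)
  show "fits (\<not> s) (N + 16) (with_tips N s (zigzag1 N s) (zigzag2 N s) (P, Q))" unfolding z by (rule f4)
  have "step (\<not> s) (N + 16) (with_tips N s (c # [e]) ([opp e] @ [opp c]) (P, Q))
      (with_tips N s (v1 # [a1, c, e]) ([opp e, opp c, opp a1] @ [opp v1]) (P, Q))"
    using f1 f2 context_move_tips[of v1 a1 "opp a1" "opp v1" N s "[]" "[c, e]" "[opp e, opp c]" "[]" "(P, Q)"]
    by (auto simp: step_def names)
  moreover have "step (\<not> s) (N + 16) (with_tips N s (v1 # [a1, c, e]) ([opp e, opp c, opp a1] @ [opp v1]) (P, Q))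
      (with_tips N s (v1 # [a1, a2, v2, c, e]) ([opp e, opp a2, opp v2, opp c, opp a1] @ [opp v1]) (P, Q))"
    using f2 f3 context_move_tips[of a2 v2 "opp a2" "opp v2" N s "[v1, a1]" "[c, e]" "[opp e]" "[opp c, opp a1, opp v1]" "(P, Q)"]
    by (auto simp: step_def names)
  moreover have "step (\<not> s) (N + 16)
      (with_tips N s (v1 # [a1, a2, v2, c, e]) ([opp e, opp a2, opp v2, opp c, opp a1] @ [opp v1]) (P, Q))
      (with_tips N s (v1 # [a1, a2, v2, c, b1, b2, e]) ([opp e, opp a2, opp v2, opp b2, opp b1, opp c, opp a1] @ [opp v1]) (P, Q))"
    using f3 f4 context_move_tips[of b1 b2 "opp b2" "opp b1" N s "[v1, a1, a2, v2, c]" "[e]" "[opp e, opp a2, opp v2]"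
        "[opp c, opp a1, opp v1]" "(P, Q)"]
    by (auto simp: step_def names)
  ultimately have "pair_equiv (\<not> s) (N + 16) (with_tips N s (c # [e]) ([opp e] @ [opp c]) (P, Q))
      (with_tips N s (zigzag1 N s) (zigzag2 N s) (P, Q))"
    unfolding z by (meson step_pair_equiv pair_equiv_trans)
  then show "pair_equiv (\<not> s) (N + 16) (with_tips N s [Passage (N + 5) Over s, Passage (N + 7) Over (\<not> s)]
         [Passage (N + 7) Under s, Passage (N + 5) Under (\<not> s)] (P, Q))
       (with_tips N s (zigzag1 N s) (zigzag2 N s) (P, Q))"
    by (simp add: c_def e_def)
qed

text \<open>
  The connecting strands of the two arc shifts cancel each other in four bigons of virtual
  crossings.
\<close>

lemma fits_double_zigzag:
  assumes X: "fits s N (P, Q)"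
  shows "fits (\<not> s) (N + 16) (with_tips N s (double_zigzag1 N s) (double_zigzag2 N s) (P, Q))"
    and "pair_equiv (\<not> s) (N + 16) (tie N s (P, Q))
       (with_tips N s (double_zigzag1 N s) (double_zigzag2 N s) (P, Q))"
proof -
  have g: "joinable s P Q" "below N (P @ Q)" using X by (auto simp: fits_def)
  define v1 where "v1 = Passage (N + 4) Virtual s"
  define c where "c = Passage (N + 5) Over (\<not> s)"
  define v2 where "v2 = Passage (N + 6) Virtual s"
  define e where "e = Passage (N + 7) Over (\<not> s)"
  define a1 where "a1 = Passage (N + 8) Virtual (\<not> s)"
  define a2 where "a2 = Passage (N + 9) Virtual s"
  define b1 where "b1 = Passage (N + 10) Virtual (\<not> s)"
  define b2 where "b2 = Passage (N + 11) Virtual s"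
  define g1 where "g1 = Passage (N + 12) Virtual (\<not> s)"
  define g2 where "g2 = Passage (N + 13) Virtual s"
  define d1 where "d1 = Passage (N + 14) Virtual (\<not> s)"
  define d2 where "d2 = Passage (N + 15) Virtual s"
  note names = v1_def c_def v2_def e_def a1_def a2_def b1_def b2_def g1_def g2_def d1_def d2_def
  note vd = virtual_diagrams_tied[OF g, folded names]
  have f1: "fits (\<not> s) (N + 16) (with_tips N s (v1 # [c, v2, e]) ([opp e, opp v2, opp c] @ [opp v1]) (P, Q))"
    by (rule fits_with_tips) (use vd(1) X in \<open>simp_all add: names\<close>)
  have f2: "fits (\<not> s) (N + 16) (with_tips N s (v1 # [c, v2, d1, b2, e]) ([opp e, opp v2, opp d1, opp b2, opp c] @ [opp v1]) (P, Q))"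
    by (rule fits_with_tips) (use vd(2) X in \<open>simp_all add: names\<close>)
  have f3: "fits (\<not> s) (N + 16) (with_tips N s (v1 # [c, v2, d1, d2, b1, b2, e])
      ([opp e, opp v2, opp d1, opp b2, opp b1, opp d2, opp c] @ [opp v1]) (P, Q))"
    by (rule fits_with_tips) (use vd(3) X in \<open>simp_all add: names\<close>)
  have f4: "fits (\<not> s) (N + 16) (with_tips N s (v1 # [a1, g2, c, v2, d1, d2, b1, b2, e])
      ([opp e, opp v2, opp d1, opp b2, opp b1, opp d2, opp c, opp g2, opp a1] @ [opp v1]) (P, Q))"
    by (rule fits_with_tips) (use vd(4) X in \<open>simp_all add: names\<close>)
  have f5: "fits (\<not> s) (N + 16) (with_tips N s (v1 # [a1, a2, g1, g2, c, v2, d1, d2, b1, b2, e])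
      ([opp e, opp a2, opp g1, opp v2, opp d1, opp b2, opp b1, opp d2, opp c, opp g2, opp a1] @ [opp v1]) (P, Q))"
    by (rule fits_with_tips) (use vd(5) X in \<open>simp_all add: names\<close>)
  have z: "double_zigzag1 N s = v1 # [a1, a2, g1, g2, c, v2, d1, d2, b1, b2, e]"
    "double_zigzag2 N s = [opp e, opp a2, opp g1, opp v2, opp d1, opp b2, opp b1, opp d2, opp c, opp g2, opp a1] @ [opp v1]"
    by (simp_all add: double_zigzag1_def double_zigzag2_def names)
  show "fits (\<not> s) (N + 16) (with_tips N s (double_zigzag1 N s) (double_zigzag2 N s) (P, Q))" unfolding z by (rule f5)
  have "step (\<not> s) (N + 16) (with_tips N s (v1 # [c, v2, e]) ([opp e, opp v2, opp c] @ [opp v1]) (P, Q))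
     (with_tips N s (v1 # [c, v2, d1, b2, e]) ([opp e, opp v2, opp d1, opp b2, opp c] @ [opp v1]) (P, Q))"
    using f1 f2 context_move_tips[of d1 b2 "opp d1" "opp b2" N s "[v1, c, v2]" "[e]" "[opp e, opp v2]" "[opp c, opp v1]" "(P, Q)"]
    by (auto simp: step_def names)
  moreover have "step (\<not> s) (N + 16)
     (with_tips N s (v1 # [c, v2, d1, b2, e]) ([opp e, opp v2, opp d1, opp b2, opp c] @ [opp v1]) (P, Q))
     (with_tips N s (v1 # [c, v2, d1, d2, b1, b2, e]) ([opp e, opp v2, opp d1, opp b2, opp b1, opp d2, opp c] @ [opp v1]) (P, Q))"
    using f2 f3 context_move_tips[of d2 b1 "opp b1" "opp d2" N s "[v1, c, v2, d1]" "[b2, e]" "[opp e, opp v2, opp d1, opp b2]"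
      "[opp c, opp v1]" "(P, Q)"]
    by (auto simp: step_def names)
  moreover have "step (\<not> s) (N + 16)
     (with_tips N s (v1 # [c, v2, d1, d2, b1, b2, e]) ([opp e, opp v2, opp d1, opp b2, opp b1, opp d2, opp c] @ [opp v1]) (P, Q))
     (with_tips N s (v1 # [a1, g2, c, v2, d1, d2, b1, b2, e])
      ([opp e, opp v2, opp d1, opp b2, opp b1, opp d2, opp c, opp g2, opp a1] @ [opp v1]) (P, Q))"
    using f3 f4 context_move_tips[of a1 g2 "opp g2" "opp a1" N s "[v1]" "[c, v2, d1, d2, b1, b2, e]"
      "[opp e, opp v2, opp d1, opp b2, opp b1, opp d2, opp c]" "[opp v1]" "(P, Q)"]
    by (auto simp: step_def names)
  moreover have "step (\<not> s) (N + 16)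
     (with_tips N s (v1 # [a1, g2, c, v2, d1, d2, b1, b2, e])
      ([opp e, opp v2, opp d1, opp b2, opp b1, opp d2, opp c, opp g2, opp a1] @ [opp v1]) (P, Q))
     (with_tips N s (v1 # [a1, a2, g1, g2, c, v2, d1, d2, b1, b2, e])
      ([opp e, opp a2, opp g1, opp v2, opp d1, opp b2, opp b1, opp d2, opp c, opp g2, opp a1] @ [opp v1]) (P, Q))"
    using f4 f5 context_move_tips[of a2 g1 "opp a2" "opp g1" N s "[v1, a1]" "[g2, c, v2, d1, d2, b1, b2, e]"
      "[opp e]" "[opp v2, opp d1, opp b2, opp b1, opp d2, opp c, opp g2, opp a1, opp v1]" "(P, Q)"]
    by (auto simp: step_def names)
  ultimately have "pair_equiv (\<not> s) (N + 16) (with_tips N s (v1 # [c, v2, e]) ([opp e, opp v2, opp c] @ [opp v1]) (P, Q))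
      (with_tips N s (double_zigzag1 N s) (double_zigzag2 N s) (P, Q))"
    unfolding z by (meson step_pair_equiv pair_equiv_trans)
  then show "pair_equiv (\<not> s) (N + 16) (tie N s (P, Q)) (with_tips N s (double_zigzag1 N s) (double_zigzag2 N s) (P, Q))"
    by (simp add: tie_def tied_def names)
qed

section \<open>The chain of knots and its arc shifts\<close>

lemma virtual_equiv_refl: "virtual_diagram w \<Longrightarrow> (w, w) \<in> virtual_equiv"
  by (simp add: virtual_equiv_def equivclp_def)

lemma virtual_equiv_sym: "(v, w) \<in> virtual_equiv \<Longrightarrow> (w, v) \<in> virtual_equiv"
  by (auto simp: virtual_equiv_def intro: equivclp_sym)

lemma virtual_equiv_trans: "(u, v) \<in> virtual_equiv \<Longrightarrow> (v, w) \<in> virtual_equiv \<Longrightarrow> (u, w) \<in> virtual_equiv"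
  by (auto simp: virtual_equiv_def intro: equivclp_trans)

lemma equiv_virtual_equiv: "equiv (Collect virtual_diagram) virtual_equiv"
proof (rule equivI)
  show "refl_on (Collect virtual_diagram) virtual_equiv"
    by (rule refl_onI) (auto intro: virtual_equiv_refl)
  show "sym virtual_equiv" by (rule symI) (rule virtual_equiv_sym)
  show "trans virtual_equiv" by (rule transI) (rule virtual_equiv_trans)
  show "virtual_equiv \<subseteq> Collect virtual_diagram \<times> Collect virtual_diagram" by (auto simp: virtual_equiv_def)
qed

text \<open>
  A diagram of the virtual trefoil: two classical crossings of the same sign and one virtual
  crossing.
\<close>

definition lock :: "passage list \<times> passage list" where
  "lock = ([Passage 0 Over True, Passage 1 Under False],
           [Passage 2 Virtual True, Passage 0 Under False, Passage 1 Over True, Passage 2 Virtual False])"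

text \<open>
  A circle with one kink has three faces, by inspection. The lock arises from it by inserting a
  bigon, here with one classical and one virtual crossing.
\<close>

lemma fits_lock: "fits True 16 lock"
proof -
  define y where "y = Passage 0 Over True"
  have g: "gauss_word [y, opp y]" by (auto simp: gauss_word_iff y_def)
  have t: "turn [y, opp y] (y, True) = (y, True)" "turn [y, opp y] (y, False) = (y, False)"
    "turn [y, opp y] (opp y, True) = (opp y, False)" "turn [y, opp y] (opp y, False) = (opp y, True)"
    by (simp_all add: turning_def nxt_def prv_def y_def)
  have o: "orbit (turn [y, opp y]) (y, True) = {(y, True)}" "orbit (turn [y, opp y]) (y, False) = {(y, False)}"
    "orbit (turn [y, opp y]) (opp y, True) = {(opp y, True), (opp y, False)}"
    "orbit (turn [y, opp y]) (opp y, False) = {(opp y, True), (opp y, False)}"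
    using orbit_fixpoint[of "turn [y, opp y]", OF t(1)] orbit_fixpoint[of "turn [y, opp y]", OF t(2)]
      orbit_two_cycle[of "turn [y, opp y]", OF t(3,4)] orbit_two_cycle[of "turn [y, opp y]", OF t(4,3)] by auto
  have "set [y, opp y] \<times> UNIV = {(y, True), (y, False), (opp y, True), (opp y, False)}"
    by (auto simp: UNIV_bool)
  then have "card (orbit (turn [y, opp y]) ` (set [y, opp y] \<times> UNIV)) = 3"
    using o by (simp add: card_insert_if)
  then have "virtual_diagram [y, opp y]" using planar_iff[OF g] g by (simp add: virtual_diagram_def)
  then have "virtual_diagram ([y] @ [Passage 1 Under False, Passage 2 Virtual True] @ [opp y] @
      [opp (Passage 1 Under False), opp (Passage 2 Virtual True)] @ [])"
    using t(3) orbit_step[OF orbit_refl[of "(opp y, True)" "turn [y, opp y]"]]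
    by (intro virtual_diagram_insert_R2[where a = "(opp y, True)"]) (auto simp: y_def side_def)
  then have vd: "virtual_diagram (fst lock @ snd lock)" by (simp add: lock_def y_def)
  have "joinable True (fst lock) (snd lock)"
    by (rule joinable_walk[OF vd _ disjI2, where k = "Suc (Suc 0)"])
      (simp_all add: lock_def side_def turning_def nxt_def prv_def)
  then show ?thesis by (simp add: fits_def) (simp add: lock_def)
qed

lemma tower_add: "tower k (m + d) X = tower (k + m) d (tower k m X)"
  by (induction d) (simp_all add: add.assoc)

lemma tower_Suc: "tower k (Suc d) X = tower (Suc k) d (tie (16 * (k + 1)) (even k) X)"
  using tower_add[of k 1 d X] by simp

text \<open>
  If the innermost pair has an empty first component, the ties come undone from the inside
  outwards.
\<close>

lemma tower_trivial:
  assumes "virtual_diagram w" "w \<noteq> []" "below (16 * (k + 1)) w"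
  shows "(word (tower k d ([], w)), w) \<in> virtual_equiv"
  using assms(3)
proof (induction d arbitrary: k)
  case 0
  then show ?case using assms by (simp add: word_def virtual_equiv_refl)
next
  case (Suc d)
  define N where "N = 16 * (k + 1)"
  have N: "N + 16 = 16 * (Suc k + 1)" by (simp add: N_def)
  have b: "below N w" using Suc.prems by (simp add: N_def)
  then have b': "below (N + 16) w" by (fastforce simp: below_def)
  have "pair_equiv (\<not> even k) (N + 16) ([], w) (tie N (even k) ([], w))"
    by (rule tie_trivial[OF assms(1,2) b])
  moreover have "fits (\<not> even k) (N + 16) (tie N (even k) ([], w))"
    by (rule fits_tie[OF fits_trivial[OF assms(1,2) b]])
  moreover have "fits (\<not> even k) (N + 16) ([], w)"
    by (rule fits_trivial[OF assms(1,2) b'])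
  ultimately have "(word (tower (Suc k) d ([], w)), word (tower (Suc k) d (tie N (even k) ([], w)))) \<in> virtual_equiv"
    using pair_equiv_tower[of "Suc k" "([], w)" "tie N (even k) ([], w)" d] unfolding N by simp
  moreover have "(word (tower (Suc k) d ([], w)), w) \<in> virtual_equiv"
    using Suc.IH[of "Suc k"] b' unfolding N by simp
  ultimately show ?case
    unfolding tower_Suc N_def by (blast intro: virtual_equiv_sym virtual_equiv_trans)
qed

lemma tower_pair_context:
  "d = 0 \<or> (\<exists>E F G. (\<forall>X. tower k d X = (E, F @ fst X @ G @ snd X)) \<and>
     (\<forall>p\<in>set (E @ F @ G). 16 * (k + 1) \<le> crossing p))"
proof (induction d)
  case (Suc d)
  define N where "N = 16 * (k + d + 1)"
  define s where "s = even (k + d)"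
  have N: "16 * (k + 1) \<le> N" by (simp add: N_def)
  let ?F = "[Passage N Over s] @ tied N s @ [Passage (N + 1) Over (\<not> s)]"
  let ?G = "[Passage (N + 2) Over s] @ map opp (rev (tied N s)) @ [Passage (N + 3) Over (\<not> s)]"
  have new: "16 * (k + 1) \<le> crossing p" if "p \<in> set (eyelets N s @ ?F @ ?G)" for p
    using that N by (auto simp: eyelets_def tied_def)
  have t: "tower k (Suc d) X = (eyelets N s, ?F @ fst (tower k d X) @ ?G @ snd (tower k d X))" for X
    by (simp add: N_def s_def tie_def with_tips_def fingers_def)
  from Suc show ?case
  proof
    assume "d = 0"
    then have "\<forall>X. tower k (Suc d) X = (eyelets N s, ?F @ fst X @ ?G @ snd X)" using t by simp
    then show ?thesis using new by blast
  next
    assume "\<exists>E F G. (\<forall>X. tower k d X = (E, F @ fst X @ G @ snd X)) \<and> (\<forall>p\<in>set (E @ F @ G). 16 * (k + 1) \<le> crossing p)"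
    then obtain E F G where e: "\<And>X. tower k d X = (E, F @ fst X @ G @ snd X)"
      "\<And>p. p \<in> set (E @ F @ G) \<Longrightarrow> 16 * (k + 1) \<le> crossing p" by blast
    have "\<forall>X. tower k (Suc d) X = (eyelets N s, (?F @ E @ ?G @ F) @ fst X @ G @ snd X)" using t e(1) by simp
    moreover have "\<forall>p\<in>set (eyelets N s @ (?F @ E @ ?G @ F) @ G). 16 * (k + 1) \<le> crossing p"
      using new e(2) N by auto
    ultimately show ?thesis by blast
  qed
qed simp

text \<open>
  The inner pair of a tower sits untouched inside a fixed context with larger crossing numbers.
\<close>

lemma tower_context:
  "\<exists>L M. (\<forall>X. word (tower k d X) = L @ fst X @ M @ snd X) \<and> (\<forall>p\<in>set (L @ M). 16 * (k + 1) \<le> crossing p)"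
  using tower_pair_context[of d k]
proof
  assume "d = 0"
  then show ?thesis by (intro exI[of _ "[]"]) (simp add: word_def)
next
  assume "\<exists>E F G. (\<forall>X. tower k d X = (E, F @ fst X @ G @ snd X)) \<and> (\<forall>p\<in>set (E @ F @ G). 16 * (k + 1) \<le> crossing p)"
  then obtain E F G where "\<forall>X. tower k d X = (E, F @ fst X @ G @ snd X)" "\<forall>p\<in>set (E @ F @ G). 16 * (k + 1) \<le> crossing p"
    by blast
  then show ?thesis by (intro exI[of _ "E @ F"] exI[of _ G]) (simp add: word_def)
qed

lemma concat_map_id: "(\<And>p. p \<in> set w \<Longrightarrow> g p = [p]) \<Longrightarrow> concat (map g w) = w"
  by (induction w) auto

text \<open>
  The arc consists of the middle crossings \<open>N + 5\<close> and \<open>N + 6\<close> of the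
  clasp.
\<close>

lemma arc_shift_tied:
  assumes w: "w = L @ fst X @ M @ snd X" "X = tie N s (P, Q)" "virtual_diagram w"
    and w': "w' = L @ fst Y @ M @ snd Y" "Y = with_tips N s (zigzag1 N s) (zigzag2 N s) (P, Q)"
    and out: "\<And>p. p \<in> set (L @ M) \<Longrightarrow> N + 16 \<le> crossing p" and inn: "below N (P @ Q)"
  shows "arc_shift w w'"
proof -
  let ?x = "Passage (N + 5) Over (\<not> s)" and ?y = "Passage (N + 6) Virtual s"
  let ?A = "L @ eyelets N s @ M @ [Passage N Over s, Passage (N + 4) Virtual s]"
  let ?B = "[Passage (N + 7) Over (\<not> s), Passage (N + 1) Over (\<not> s)] @ P @ [Passage (N + 2) Over s] @
     map opp (rev (tied N s)) @ [Passage (N + 3) Over (\<not> s)] @ Q"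
  define g where "g = (\<lambda>p. if crossing p = crossing ?x then transverse s ?x (N + 8) (N + 10) p
             else if crossing p = crossing ?y then transverse s ?y (N + 9) (N + 11) p else [p])"
  have id: "concat (map g L) = L" "concat (map g M) = M" "concat (map g P) = P" "concat (map g Q) = Q"
    by (rule concat_map_id; use out inn in \<open>force simp: g_def below_def\<close>)+
  have e: "w = ?A @ [?x, ?y] @ ?B"
    by (simp add: w tie_def with_tips_def fingers_def tied_def)
  have fr: "{N + 8, N + 9, N + 10, N + 11} \<inter> crossing ` set w = {}"
    using out inn unfolding w tie_def with_tips_def fingers_def tied_def eyelets_def
    by (force simp: below_def)
  have "arc_shift w (concat (map g ?A) @
      [Passage (N + 8) Virtual (from_left ?x), Passage (N + 9) Virtual (from_left ?y), flip ?y, flip ?x,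
       Passage (N + 10) Virtual (from_left ?x), Passage (N + 11) Virtual (from_left ?y)] @ concat (map g ?B))"
    by (rule arc_shift.intros[OF e w(3) _ _ fr g_def]) simp_all
  also have "concat (map g ?A) @
      [Passage (N + 8) Virtual (from_left ?x), Passage (N + 9) Virtual (from_left ?y), flip ?y, flip ?x,
       Passage (N + 10) Virtual (from_left ?x), Passage (N + 11) Virtual (from_left ?y)] @ concat (map g ?B) = w'"
    by (simp add: id) (simp add: g_def w' with_tips_def fingers_def tied_def eyelets_def zigzag1_def zigzag2_def
      transverse_def flip_def)
  finally show ?thesis .
qed

text \<open>
  The arc consists of the same two crossings, in the order that the first arc shift has given
  them. The connecting strands run on the other sides than before, so that they cancel the earlier
  ones.
\<close>

lemma arc_shift_zigzag:
  assumes w: "w = L @ fst X @ M @ snd X" "X = with_tips N s (zigzag1 N s) (zigzag2 N s) (P, Q)" "virtual_diagram w"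
    and w': "w' = L @ fst Y @ M @ snd Y" "Y = with_tips N s (double_zigzag1 N s) (double_zigzag2 N s) (P, Q)"
    and out: "\<And>p. p \<in> set (L @ M) \<Longrightarrow> N + 16 \<le> crossing p" and inn: "below N (P @ Q)"
  shows "arc_shift w w'"
proof -
  let ?x = "Passage (N + 6) Virtual (\<not> s)" and ?y = "Passage (N + 5) Over s"
  let ?A = "L @ eyelets N s @ M @ [Passage N Over s, Passage (N + 4) Virtual s, Passage (N + 8) Virtual (\<not> s), Passage (N + 9) Virtual s]"
  let ?B = "[Passage (N + 10) Virtual (\<not> s), Passage (N + 11) Virtual s, Passage (N + 7) Over (\<not> s), Passage (N + 1) Over (\<not> s)]
     @ P @ [Passage (N + 2) Over s] @ zigzag2 N s @ [Passage (N + 3) Over (\<not> s)] @ Q"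
  define g where "g = (\<lambda>p. if crossing p = crossing ?x then transverse (\<not> s) ?x (N + 12) (N + 14) p
             else if crossing p = crossing ?y then transverse (\<not> s) ?y (N + 13) (N + 15) p else [p])"
  have id: "concat (map g L) = L" "concat (map g M) = M" "concat (map g P) = P" "concat (map g Q) = Q"
    by (rule concat_map_id; use out inn in \<open>force simp: g_def below_def\<close>)+
  have e: "w = ?A @ [?x, ?y] @ ?B"
    by (simp add: w with_tips_def fingers_def zigzag1_def)
  have fr: "{N + 12, N + 13, N + 14, N + 15} \<inter> crossing ` set w = {}"
    using out inn unfolding w with_tips_def fingers_def zigzag1_def zigzag2_def eyelets_def
    by (force simp: below_def)
  have "arc_shift w (concat (map g ?A) @
      [Passage (N + 12) Virtual (from_left ?x), Passage (N + 13) Virtual (from_left ?y), flip ?y, flip ?x,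
       Passage (N + 14) Virtual (from_left ?x), Passage (N + 15) Virtual (from_left ?y)] @ concat (map g ?B))"
    by (rule arc_shift.intros[OF e w(3) _ _ fr g_def]) simp_all
  also have "concat (map g ?A) @
      [Passage (N + 12) Virtual (from_left ?x), Passage (N + 13) Virtual (from_left ?y), flip ?y, flip ?x,
       Passage (N + 14) Virtual (from_left ?x), Passage (N + 15) Virtual (from_left ?y)] @ concat (map g ?B) = w'"
    by (simp add: id) (simp add: g_def w' with_tips_def fingers_def eyelets_def double_zigzag1_def double_zigzag2_def
      zigzag2_def transverse_def flip_def)
  finally show ?thesis .
qed

definition chain :: "nat \<Rightarrow> passage list" where
  "chain n = word (tower 0 n lock)"

lemma fits_chain: "fits (even n) (16 * (n + 1)) (tower 0 n lock)"
  using fits_tower[of 0 lock n] fits_lock by simp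

lemma virtual_diagram_chain: "virtual_diagram (chain n)"
  using fits_chain[of n] by (simp add: fits_def joinable_def chain_def word_def)

text \<open>
  Both arc shifts take place in the tie that makes \<open>chain (Suc m)\<close> out of
  \<open>chain m\<close>. The diagram \<open>u\<close> between them is equivalent to \<open>chain
  m\<close>.
\<close>

lemma arc_shift_chain:
  assumes "m < n"
  obtains u v where "arc_shift (chain n) u" "(u, chain m) \<in> virtual_equiv"
    "arc_shift u v" "(v, chain n) \<in> virtual_equiv"
proof -
  obtain d where n: "n = Suc m + d" using assms less_iff_Suc_add by auto
  define N where "N = 16 * (m + 1)"
  define s where "s = even m"
  obtain P Q where PQ: "tower 0 m lock = (P, Q)" by fastforce
  have f: "fits s N (P, Q)" using fits_chain[of m] PQ by (simp add: N_def s_def)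
  have g: "virtual_diagram (P @ Q)" "Q \<noteq> []" "below N (P @ Q)" using f by (simp_all add: fits_def joinable_def)
  have cm: "chain m = P @ Q" by (simp add: chain_def PQ word_def)
  have N: "N + 16 = 16 * (Suc m + 1)" and s: "(\<not> s) = even (Suc m)" by (simp_all add: N_def s_def)
  define T where "T = tie N s (P, Q)"
  define Z where "Z = with_tips N s (zigzag1 N s) (zigzag2 N s) (P, Q)"
  define D where "D = with_tips N s (double_zigzag1 N s) (double_zigzag2 N s) (P, Q)"
  have cn: "chain n = word (tower (Suc m) d T)"
    using tower_add[of 0 "Suc m" d lock] by (simp add: chain_def n PQ T_def N_def s_def)
  have fT: "fits (even (Suc m)) (16 * (Suc m + 1)) T" using fits_tie[OF f] unfolding T_def s N .
  have fZ: "fits (even (Suc m)) (16 * (Suc m + 1)) Z" using fits_zigzag(1)[OF f] unfolding Z_def s N .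
  have fD: "fits (even (Suc m)) (16 * (Suc m + 1)) D" using fits_double_zigzag(1)[OF f] unfolding D_def s N .
  have b16: "below (N + 16) (P @ Q)" using g(3) unfolding below_def by fastforce
  have f0: "fits (even (Suc m)) (16 * (Suc m + 1)) ([], P @ Q)"
    by (rule fits_trivial) (use g b16 in \<open>simp_all add: N_def\<close>)
  \<comment> \<open>After the first arc shift the tie comes undone, and with it all the outer ties.\<close>
  have "pair_equiv (\<not> s) (N + 16) ([], P @ Q) Z"
    unfolding Z_def by (rule pair_equiv_trans[OF untie[OF f] fits_zigzag(2)[OF f]])
  then have "pair_equiv (even (Suc m)) (16 * (Suc m + 1)) ([], P @ Q) Z" unfolding s N .
  from pair_equiv_tower[OF this f0 fZ]
  have "(word (tower (Suc m) d ([], P @ Q)), word (tower (Suc m) d Z)) \<in> virtual_equiv" .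
  moreover have "(word (tower (Suc m) d ([], P @ Q)), P @ Q) \<in> virtual_equiv"
    by (rule tower_trivial) (use g b16 in \<open>simp_all add: N_def\<close>)
  ultimately have 2: "(word (tower (Suc m) d Z), chain m) \<in> virtual_equiv"
    unfolding cm by (blast intro: virtual_equiv_sym virtual_equiv_trans)
  \<comment> \<open>After the second arc shift the tie is as before.\<close>
  have "pair_equiv (even (Suc m)) (16 * (Suc m + 1)) T D"
    using fits_double_zigzag(2)[OF f] unfolding T_def D_def s N .
  from pair_equiv_tower[OF this fT fD]
  have 4: "(word (tower (Suc m) d D), chain n) \<in> virtual_equiv" unfolding cn by (rule virtual_equiv_sym)
  obtain L M where LM: "\<And>X. word (tower (Suc m) d X) = L @ fst X @ M @ snd X"
    "\<And>p. p \<in> set (L @ M) \<Longrightarrow> N + 16 \<le> crossing p"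
    using tower_context[of "Suc m" d] unfolding N by blast
  have "virtual_diagram (chain n)" "virtual_diagram (word (tower (Suc m) d Z))"
    using virtual_diagram_chain 2 by (auto simp: virtual_equiv_def)
  then have "arc_shift (chain n) (word (tower (Suc m) d Z))"
    "arc_shift (word (tower (Suc m) d Z)) (word (tower (Suc m) d D))"
    using arc_shift_tied[OF LM(1) T_def _ LM(1) Z_def LM(2) g(3)]
      arc_shift_zigzag[OF LM(1) Z_def _ LM(1) D_def LM(2) g(3)] unfolding cn by blast+
  then show thesis using that 2 4 by blast
qed

lemma virtual_class_eq: "(v, w) \<in> virtual_equiv \<Longrightarrow> virtual_equiv `` {v} = virtual_equiv `` {w}"
  by (rule equiv_class_eq[OF equiv_virtual_equiv])

text \<open>
  For \<open>m < n\<close> and for \<open>m > n\<close> different arc shifts of the same sequence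
  are used: the first leads down the chain, the second one up.
\<close>

lemma arc_shift_distance_chain:
  assumes "m \<noteq> n" "virtual_equiv `` {chain m} \<noteq> virtual_equiv `` {chain n}"
  shows "arc_shift_distance (virtual_equiv `` {chain m}) (virtual_equiv `` {chain n}) = 1"
proof -
  let ?D = "{enat k | k. \<exists>w\<in>virtual_equiv `` {chain m}. \<exists>w'\<in>virtual_equiv `` {chain n}.
      (w, w') \<in> (virtual_equiv O arc_shift_rel) ^^ k O virtual_equiv}"
  have self: "(chain k, chain k) \<in> virtual_equiv" for k by (rule virtual_equiv_refl[OF virtual_diagram_chain])
  have "\<exists>u u'. (chain m, u) \<in> virtual_equiv \<and> arc_shift u u' \<and> (u', chain n) \<in> virtual_equiv"
  proof (cases "m < n")
    case True
    from arc_shift_chain[OF this] obtain u v where "(u, chain m) \<in> virtual_equiv" "arc_shift u v" "(v, chain n) \<in> virtual_equiv"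
      by metis
    then show ?thesis using virtual_equiv_sym by blast
  next
    case False
    then have "n < m" using assms by simp
    from arc_shift_chain[OF this] obtain u where "arc_shift (chain m) u" "(u, chain n) \<in> virtual_equiv" by metis
    then show ?thesis using self by blast
  qed
  then have "(chain m, chain n) \<in> (virtual_equiv O arc_shift_rel) ^^ 1 O virtual_equiv"
    by (auto simp: arc_shift_rel_def)
  then have 1: "enat 1 \<in> ?D" using self by blast
  \<comment> \<open>Distance zero would mean equality of the two classes.\<close>
  have 0: "enat 0 \<notin> ?D"
  proof
    assume "enat 0 \<in> ?D"
    then obtain w w' where "(chain m, w) \<in> virtual_equiv" "(chain n, w') \<in> virtual_equiv" "(w, w') \<in> virtual_equiv"
      by (auto simp: zero_enat_def)
    then have "(chain m, chain n) \<in> virtual_equiv" by (blast intro: virtual_equiv_trans virtual_equiv_sym)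
    then show False using assms(2) virtual_class_eq by blast
  qed
  have "1 \<le> x" if x: "x \<in> ?D" for x
  proof -
    obtain k where k: "x = enat k" using x by blast
    then have "k \<noteq> 0" using x 0 by metis
    then show ?thesis using k by (simp add: one_enat_def)
  qed
  moreover have "(1 :: enat) \<in> ?D" using 1 by (simp add: one_enat_def)
  ultimately show ?thesis unfolding arc_shift_distance_def
    by (intro antisym Inf_lower Inf_greatest)
qed

section \<open>Quandle colorings\<close>

text \<open>
  The operation \<open>r\<close> and its right inverse \<open>l\<close> on the carrier
  \<open>X\<close>.
\<close>

definition quandle :: "'q set \<Rightarrow> ('q \<Rightarrow> 'q \<Rightarrow> 'q) \<Rightarrow> ('q \<Rightarrow> 'q \<Rightarrow> 'q) \<Rightarrow> bool" where
  "quandle X r l \<longleftrightarrow>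
     (\<forall>a\<in>X. \<forall>b\<in>X. r a b \<in> X \<and> l a b \<in> X \<and> l (r a b) b = a \<and> r (l a b) b = a) \<and>
     (\<forall>a\<in>X. r a a = a) \<and>
     (\<forall>a\<in>X. \<forall>b\<in>X. \<forall>c\<in>X. r (r a b) c = r (r a c) (r b c))"

definition subquandle :: "('q \<Rightarrow> 'q \<Rightarrow> 'q) \<Rightarrow> ('q \<Rightarrow> 'q \<Rightarrow> 'q) \<Rightarrow> 'q set \<Rightarrow> bool" where
  "subquandle r l Y \<longleftrightarrow> (\<forall>a\<in>Y. \<forall>b\<in>Y. r a b \<in> Y \<and> l a b \<in> Y)"

text \<open>
  An under strand is acted on by \<open>r\<close> or by \<open>l\<close>, depending on the
  direction in which the over strand crosses it.
\<close>

definition act :: "('q \<Rightarrow> 'q \<Rightarrow> 'q) \<Rightarrow> ('q \<Rightarrow> 'q \<Rightarrow> 'q) \<Rightarrow> bool \<Rightarrow> 'q \<Rightarrow> 'q \<Rightarrow> 'q" where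
  "act r l b x y = (if b then r x y else l x y)"

text \<open>
  The color of the strand after the passage \<open>p\<close>, if it is \<open>a\<close> before.
  Virtual crossings do not act.
\<close>

definition out :: "('q \<Rightarrow> 'q \<Rightarrow> 'q) \<Rightarrow> ('q \<Rightarrow> 'q \<Rightarrow> 'q) \<Rightarrow> (passage \<Rightarrow> 'q) \<Rightarrow> passage \<Rightarrow> 'q \<Rightarrow> 'q" where
  "out r l \<chi> p a = (if level p = Under then act r l (from_left p) a (\<chi> (opp p)) else a)"

text \<open>
  \<open>\<chi> p\<close> is the color of the edge arriving at \<open>p\<close>. Segments of a
  word are colored from a given first color \<open>a\<close> to a given last color
  \<open>b\<close>; a coloring of a diagram has \<open>a = b\<close>.
\<close>

fun colored :: "'q set \<Rightarrow> ('q \<Rightarrow> 'q \<Rightarrow> 'q) \<Rightarrow> ('q \<Rightarrow> 'q \<Rightarrow> 'q) \<Rightarrow> (passage \<Rightarrow> 'q) \<Rightarrow> passage list \<Rightarrow> 'q \<Rightarrow> 'q \<Rightarrow> bool" where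
  "colored X r l \<chi> [] a b \<longleftrightarrow> a = b \<and> a \<in> X"
| "colored X r l \<chi> (p # w) a b \<longleftrightarrow> \<chi> p = a \<and> a \<in> X \<and> colored X r l \<chi> w (out r l \<chi> p a) b"

text \<open>
  Equivalently, the knot quandle maps onto \<open>X\<close>. The color \<open>a\<close> of the
  base edge is included for the sake of the empty word.
\<close>

definition surjective_coloring :: "'q set \<Rightarrow> ('q \<Rightarrow> 'q \<Rightarrow> 'q) \<Rightarrow> ('q \<Rightarrow> 'q \<Rightarrow> 'q) \<Rightarrow> passage list \<Rightarrow> bool" where
  "surjective_coloring X r l w \<longleftrightarrow> (\<exists>\<chi> a. colored X r l \<chi> w a a \<and>
     (\<forall>Y. Y \<subseteq> X \<longrightarrow> subquandle r l Y \<longrightarrow> insert a (\<chi> ` set w) \<subseteq> Y \<longrightarrow> Y = X))"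

lemma act_quandle:
  assumes "quandle X r l" "a \<in> X" "b \<in> X"
  shows "act r l e a b \<in> X" "act r l (\<not> e) (act r l e a b) b = a" "act r l e (act r l (\<not> e) a b) b = a"
    "act r l e a a = a"
proof -
  have q: "r a b \<in> X" "l a b \<in> X" "l (r a b) b = a" "r (l a b) b = a" "r a a = a" "l (r a a) a = a"
    using assms unfolding quandle_def by metis+
  then show "act r l e a b \<in> X" "act r l (\<not> e) (act r l e a b) b = a" "act r l e (act r l (\<not> e) a b) b = a"
    by (auto simp: act_def)
  show "act r l e a a = a" using q(5,6) by (cases e; simp only: act_def if_True if_False)
qed

text \<open>
  Acting by \<open>c\<close> is an automorphism of \<open>r\<close>. Hence it is one of the
  inverse operation \<open>l\<close>, and the inverse of the action is an automorphism of both.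
\<close>

lemma act_distrib:
  assumes q: "quandle X r l" and X: "a \<in> X" "b \<in> X" "c \<in> X"
  shows "act r l e (act r l f a b) c = act r l f (act r l e a c) (act r l e b c)"
proof -
  note cl = act_quandle(1)[OF q] and inv = act_quandle(2,3)[OF q]
  have d: "r (r x y) z = r (r x z) (r y z)" if "x \<in> X" "y \<in> X" "z \<in> X" for x y z
    using q that unfolding quandle_def by blast
  have c: "r x y \<in> X" "l x y \<in> X" "l (r x y) y = x" "r (l x y) y = x" if "x \<in> X" "y \<in> X" for x y
    using q that unfolding quandle_def by blast+
  have rl: "r (l x y) z = l (r x z) (r y z)" if "x \<in> X" "y \<in> X" "z \<in> X" for x y z
    using d[of "l x y" y z] c that by metis
  have lr: "l (r x y) z = r (l x z) (l y z)" if "x \<in> X" "y \<in> X" "z \<in> X" for x y z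
    using d[of "l x z" "l y z" z] c that by metis
  have ll: "l (l x y) z = l (l x z) (l y z)" if "x \<in> X" "y \<in> X" "z \<in> X" for x y z
    using rl[of "l x z" "l y z" z] c that by metis
  show ?thesis using d[OF X] rl[OF X] lr[OF X] ll[OF X] by (cases e; cases f; simp only: act_def if_True if_False)
qed

lemma quandle_dual: "quandle X r l \<Longrightarrow> quandle X l r"
proof -
  assume q: "quandle X r l"
  have "l (l a b) c = l (l a c) (l b c)" if "a \<in> X" "b \<in> X" "c \<in> X" for a b c
    using act_distrib[OF q that, where e = False and f = False] by (simp add: act_def)
  moreover have "l a a = a" if "a \<in> X" for a using act_quandle(4)[OF q that that, where e = False] by (simp add: act_def)
  ultimately show ?thesis using q unfolding quandle_def by blast
qed

lemma colored_append:
  "colored X r l \<chi> (u @ v) a c \<longleftrightarrow> (\<exists>b. colored X r l \<chi> u a b \<and> colored X r l \<chi> v b c)"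
proof (induction u arbitrary: a)
  case Nil
  show ?case by (cases v) auto
qed auto

lemma colored_X: "colored X r l \<chi> w a b \<Longrightarrow> a \<in> X \<and> b \<in> X \<and> \<chi> ` set w \<subseteq> X"
  by (induction w arbitrary: a) auto

lemma colored_start: "colored X r l \<chi> w a b \<Longrightarrow> w \<noteq> [] \<Longrightarrow> a \<in> \<chi> ` set w"
  by (cases w) auto

lemma colored_cong:
  assumes "colored X r l \<chi> w a b" "\<And>p. p \<in> set w \<Longrightarrow> \<chi>' p = \<chi> p \<and> \<chi>' (opp p) = \<chi> (opp p)"
  shows "colored X r l \<chi>' w a b"
  using assms by (induction w arbitrary: a) (auto simp: out_def)

text \<open>
  Where a segment ends, the next one begins, unless it is empty and the traversal is back at its
  start.
\<close>

lemma colored_exit: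
  assumes "colored X r l \<chi> u a b" "colored X r l \<chi> v b a"
  shows "b \<in> insert a (\<chi> ` set v)"
  using assms by (cases v) auto

lemma surjective_coloringI:
  assumes "colored X r l \<chi> w a a"
    "\<And>Y. Y \<subseteq> X \<Longrightarrow> subquandle r l Y \<Longrightarrow> a \<in> Y \<Longrightarrow> \<chi> ` set w \<subseteq> Y \<Longrightarrow> Y = X"
  shows "surjective_coloring X r l w"
  unfolding surjective_coloring_def using assms by (metis insert_subset)

lemma surjective_coloringE:
  assumes "surjective_coloring X r l w"
  obtains \<chi> a where "colored X r l \<chi> w a a"
    "\<And>Y. Y \<subseteq> X \<Longrightarrow> subquandle r l Y \<Longrightarrow> a \<in> Y \<Longrightarrow> \<chi> ` set w \<subseteq> Y \<Longrightarrow> Y = X"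
  using assms unfolding surjective_coloring_def by (metis insert_subset)

lemma surjective_coloring_rotate:
  assumes "surjective_coloring X r l (u @ v)"
  shows "surjective_coloring X r l (v @ u)"
proof -
  obtain \<chi> a b where c: "colored X r l \<chi> u a b" "colored X r l \<chi> v b a"
    and s: "\<And>Y. Y \<subseteq> X \<Longrightarrow> subquandle r l Y \<Longrightarrow> insert a (\<chi> ` set (u @ v)) \<subseteq> Y \<Longrightarrow> Y = X"
    using assms unfolding surjective_coloring_def colored_append by blast
  have a: "a \<in> insert b (\<chi> ` set u)" by (rule colored_exit[OF c(2,1)])
  have "Y = X" if "Y \<subseteq> X" "subquandle r l Y" "insert b (\<chi> ` set (v @ u)) \<subseteq> Y" for Y
    by (rule s[OF that(1,2)]) (use that(3) a in auto)
  moreover have "colored X r l \<chi> (v @ u) b b" unfolding colored_append using c by blast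
  ultimately show ?thesis unfolding surjective_coloring_def by blast
qed

lemma surjective_coloring_rename:
  assumes g: "gauss_word w" and f: "inj_on f (crossing ` set w)"
  defines "h \<equiv> \<lambda>p. Passage (f (crossing p)) (level p) (from_left p)"
  shows "surjective_coloring X r l w \<longleftrightarrow> surjective_coloring X r l (map h w)"
proof -
  have opp: "opp p \<in> set w" if "p \<in> set w" for p using g that gauss_word_iff by blast
  have inj: "inj_on h (set w)"
    using f by (auto simp: inj_on_def h_def intro!: passage.expand)
  have hopp: "h (opp p) = opp (h p)" for p by (simp add: h_def opp_def)
  have hl: "level (h p) = level p" "from_left (h p) = from_left p" for p by (simp_all add: h_def)
  have eq: "colored X r l \<chi>' (map h v) a b \<longleftrightarrow> colored X r l \<chi> v a b"
    if "set v \<subseteq> set w" "\<And>p. p \<in> set w \<Longrightarrow> \<chi>' (h p) = \<chi> p" for v a b \<chi> \<chi>'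
    using that(1)
  proof (induction v arbitrary: a)
    case (Cons p v)
    have "out r l \<chi>' (h p) a = out r l \<chi> p a"
      using that(2)[of "opp p"] opp[of p] Cons.prems by (simp add: out_def hl hopp)
    then show ?case using Cons that(2)[of p] by simp
  qed simp
  show ?thesis
  proof
    assume "surjective_coloring X r l w"
    then obtain \<chi> a where c: "colored X r l \<chi> w a a"
      and s: "\<And>Y. Y \<subseteq> X \<Longrightarrow> subquandle r l Y \<Longrightarrow> insert a (\<chi> ` set w) \<subseteq> Y \<Longrightarrow> Y = X"
      unfolding surjective_coloring_def by blast
    define \<chi>' where "\<chi>' = (\<lambda>q. \<chi> (inv_into (set w) h q))"
    have e: "\<chi>' (h p) = \<chi> p" if "p \<in> set w" for p using that inj by (simp add: \<chi>'_def)
    then have "\<chi>' ` set (map h w) = \<chi> ` set w" by (auto simp: image_iff)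
    moreover have "colored X r l \<chi>' (map h w) a a" using eq[of w \<chi>' \<chi>] e c by simp
    ultimately show "surjective_coloring X r l (map h w)"
      unfolding surjective_coloring_def using s by (intro exI[of _ \<chi>'] exI[of _ a]) simp
  next
    assume "surjective_coloring X r l (map h w)"
    then obtain \<chi> a where c: "colored X r l \<chi> (map h w) a a"
      and s: "\<And>Y. Y \<subseteq> X \<Longrightarrow> subquandle r l Y \<Longrightarrow> insert a (\<chi> ` set (map h w)) \<subseteq> Y \<Longrightarrow> Y = X"
      unfolding surjective_coloring_def by blast
    have "(\<lambda>p. \<chi> (h p)) ` set w = \<chi> ` set (map h w)" by auto
    moreover have "colored X r l (\<lambda>p. \<chi> (h p)) w a a" using eq[of w \<chi> "\<lambda>p. \<chi> (h p)"] c by simp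
    ultimately show "surjective_coloring X r l w"
      unfolding surjective_coloring_def using s by (intro exI[of _ "\<lambda>p. \<chi> (h p)"] exI[of _ a]) simp
  qed
qed

text \<open>
  The reversed word keeps its \<open>from_left\<close> flags, so each undercrossing now undoes the
  action that it performed before. Edges arrive at their former starting points, whence the new
  coloring \<open>out r l \<chi> p (\<chi> p)\<close>.
\<close>

lemma surjective_coloring_rev:
  assumes q: "quandle X r l" and g: "gauss_word w" and w: "surjective_coloring X r l w"
  shows "surjective_coloring X l r (rev w)"
proof -
  obtain \<chi> a where c: "colored X r l \<chi> w a a"
    and s: "\<And>Y. Y \<subseteq> X \<Longrightarrow> subquandle r l Y \<Longrightarrow> insert a (\<chi> ` set w) \<subseteq> Y \<Longrightarrow> Y = X"
    using w unfolding surjective_coloring_def by blast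
  define \<chi>' where "\<chi>' = (\<lambda>p. out r l \<chi> p (\<chi> p))"
  have opp: "opp p \<in> set w" if "p \<in> set w" for p using g that gauss_word_iff by blast
  have X: "\<chi> p \<in> X" if "p \<in> set w" for p using colored_X[OF c] that by blast
  have outX: "out r l \<chi> p a \<in> X" if "p \<in> set w" "a \<in> X" for p a
    using act_quandle(1)[OF q that(2) X[OF opp[OF that(1)]]] that(2) by (simp add: out_def)
  \<comment> \<open>The color acting at \<open>p\<close> belongs to an over passage, which \<open>out\<close> leaves unchanged.\<close>
  have undo: "out l r \<chi>' p (out r l \<chi> p a) = a" if "p \<in> set w" "a \<in> X" for p a
  proof (cases "level p = Under")
    case True
    have "\<chi>' (opp p) = \<chi> (opp p)" using True by (simp add: \<chi>'_def out_def)
    moreover have "act l r b x y = act r l (\<not> b) x y" for b x y by (simp add: act_def)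
    ultimately show ?thesis
      using True act_quandle(2)[OF q that(2) X[OF opp[OF that(1)]]] by (simp add: out_def)
  qed (simp add: out_def)
  have "colored X l r \<chi>' (rev v) b a" if "colored X r l \<chi> v a b" "set v \<subseteq> set w" for v a b
    using that
  proof (induction v arbitrary: a)
    case (Cons p v)
    then have "colored X l r \<chi>' (rev v) b (out r l \<chi> p a)" and p: "p \<in> set w" "a \<in> X" "\<chi> p = a" by auto
    moreover have "colored X l r \<chi>' [p] (out r l \<chi> p a) a"
      using undo[OF p(1,2)] outX[OF p(1,2)] p by (simp add: \<chi>'_def)
    ultimately show ?case by (auto simp: colored_append)
  qed simp
  then have c': "colored X l r \<chi>' (rev w) a a" using c by blast
  have in_out: "\<chi> ` set v \<subseteq> insert a (\<chi>' ` set v)" if "colored X r l \<chi> v a b" for v a b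
    using that
  proof (induction v arbitrary: a)
    case (Cons p v)
    then have "\<chi> p = a" "\<chi> ` set v \<subseteq> insert (out r l \<chi> p a) (\<chi>' ` set v)" by auto
    then show ?case by (auto simp: \<chi>'_def)
  qed simp
  have "insert a (\<chi>' ` set (rev w)) \<subseteq> Y \<Longrightarrow> insert a (\<chi> ` set w) \<subseteq> Y" for Y
    using in_out[OF c] by auto
  moreover have "subquandle l r Y \<longleftrightarrow> subquandle r l Y" for Y by (auto simp: subquandle_def)
  ultimately show ?thesis
    unfolding surjective_coloring_def using c' s by (intro exI[of _ \<chi>'] exI[of _ a]) metis
qed

text \<open>
  Both edges of a kink must have the color of the strand, by idempotency.
\<close>

lemma surjective_coloring_R1:
  assumes q: "quandle X r l" and g: "gauss_word (A @ B)" and g': "gauss_word (A @ [p, p'] @ B)"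
    and pp: "crossing p = crossing p'"
  shows "surjective_coloring X r l (A @ B) \<longleftrightarrow> surjective_coloring X r l (A @ [p, p'] @ B)"
proof -
  have p': "p' = opp p" using g' pp by (auto simp: gauss_word_iff)
  have new: "p \<notin> set (A @ B)" "opp p \<notin> set (A @ B)" using g' p' by (auto simp: gauss_word_iff)
  have opp: "opp z \<in> set (A @ B)" if "z \<in> set (A @ B)" for z using g that gauss_word_iff by blast
  have kink: "colored X r l \<chi> [p, opp p] b c \<longleftrightarrow> b \<in> X \<and> c = b \<and> \<chi> p = b \<and> \<chi> (opp p) = b" for \<chi> b c
  proof (cases "level p")
    case Over
    have "act r l e b b = b" if "b \<in> X" for e using act_quandle(4)[OF q that that] .
    then show ?thesis using Over by (auto simp: out_def)
  next
    case Under
    have self: "act r l e x x = x" if "x \<in> X" for x e using act_quandle(4)[OF q that that] .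
    have "x = b" if "b \<in> X" "x \<in> X" "x = act r l e b x" for x e
      using act_quandle(2)[OF q that(1,2), of e] self[OF that(2), of "\<not> e"] that(3) by metis
    then have "x = act r l e b x \<longleftrightarrow> x = b" if "b \<in> X" "x \<in> X" for x e
      using that self by metis
    then show ?thesis using Under by (auto simp: out_def self)
  next
    case Virtual
    then show ?thesis by (auto simp: out_def)
  qed
  show ?thesis
  proof
    assume "surjective_coloring X r l (A @ B)"
    then obtain \<chi> a b where c: "colored X r l \<chi> A a b" "colored X r l \<chi> B b a"
      and s: "\<And>Y. Y \<subseteq> X \<Longrightarrow> subquandle r l Y \<Longrightarrow> insert a (\<chi> ` set (A @ B)) \<subseteq> Y \<Longrightarrow> Y = X"
      unfolding surjective_coloring_def colored_append by blast
    define \<chi>' where "\<chi>' = \<chi>(p := b, opp p := b)"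
    have e: "\<chi>' z = \<chi> z" if "z \<in> set (A @ B)" for z using that new by (auto simp: \<chi>'_def)
    have "colored X r l \<chi>' A a b" "colored X r l \<chi>' B b a"
      using colored_cong[OF c(1), of \<chi>'] colored_cong[OF c(2), of \<chi>'] e opp by auto
    moreover have "colored X r l \<chi>' [p, opp p] b b"
      unfolding kink using colored_X[OF c(1)] by (simp add: \<chi>'_def)
    ultimately have "colored X r l \<chi>' (A @ [p, p'] @ B) a a" unfolding colored_append p' by blast
    have "\<chi> ` set (A @ B) \<subseteq> \<chi>' ` set (A @ [p, p'] @ B)"
    proof
      fix y assume "y \<in> \<chi> ` set (A @ B)"
      then obtain z where "z \<in> set (A @ B)" "y = \<chi>' z" using e by auto
      then show "y \<in> \<chi>' ` set (A @ [p, p'] @ B)" by auto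
    qed
    note sub = this
    show "surjective_coloring X r l (A @ [p, p'] @ B)"
    proof (rule surjective_coloringI)
      show "colored X r l \<chi>' (A @ [p, p'] @ B) a a" by fact
      show "Y = X" if "Y \<subseteq> X" "subquandle r l Y" "a \<in> Y" "\<chi>' ` set (A @ [p, p'] @ B) \<subseteq> Y" for Y
        by (rule s[OF that(1,2)]) (use that(3) order_trans[OF sub that(4)] in simp)
    qed
  next
    assume "surjective_coloring X r l (A @ [p, p'] @ B)"
    then obtain \<chi> a b c where c: "colored X r l \<chi> A a b" "colored X r l \<chi> [p, opp p] b c" "colored X r l \<chi> B c a"
      and s: "\<And>Y. Y \<subseteq> X \<Longrightarrow> subquandle r l Y \<Longrightarrow> insert a (\<chi> ` set (A @ [p, p'] @ B)) \<subseteq> Y \<Longrightarrow> Y = X"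
      unfolding surjective_coloring_def colored_append p' by blast
    have k: "c = b" "\<chi> p = b" "\<chi> (opp p) = b" using c(2) unfolding kink by auto
    have b: "b \<in> insert a (\<chi> ` set B)" using colored_exit[OF c(1) c(3)[unfolded k(1)]] .
    show "surjective_coloring X r l (A @ B)"
    proof (rule surjective_coloringI)
      show "colored X r l \<chi> (A @ B) a a" unfolding colored_append using c k by blast
      show "Y = X" if "Y \<subseteq> X" "subquandle r l Y" "a \<in> Y" "\<chi> ` set (A @ B) \<subseteq> Y" for Y
        by (rule s[OF that(1,2)]) (use that(3,4) b k p' in auto)
    qed
  qed
qed

text \<open>
  The under strand, if any, is acted on by an operation and then by its inverse, with the same
  color. The color in between is generated by the others, so surjectivity is preserved.
\<close>

lemma surjective_coloring_R2:
  assumes q: "quandle X r l" and g: "gauss_word (A @ B @ C)" and g': "gauss_word (A @ [p1, p2] @ B @ [q1, q2] @ C)"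
    and pq: "crossing p1 \<noteq> crossing p2" "{crossing q1, crossing q2} = {crossing p1, crossing p2}"
      "level p1 = level p2" "from_left p1 \<noteq> from_left p2"
  shows "surjective_coloring X r l (A @ B @ C) \<longleftrightarrow> surjective_coloring X r l (A @ [p1, p2] @ B @ [q1, q2] @ C)"
proof -
  let ?w = "A @ B @ C" and ?w' = "A @ [p1, p2] @ B @ [q1, q2] @ C"
  have Q: "q1 = opp p1 \<and> q2 = opp p2 \<or> q1 = opp p2 \<and> q2 = opp p1"
  proof -
    have m: "{p1, p2, q1, q2} \<subseteq> set ?w'" "distinct [p1, p2, q1, q2]" using g' by (auto simp: gauss_word_iff)
    have same: "y = x \<or> y = opp x" if "x \<in> set ?w'" "y \<in> set ?w'" "crossing x = crossing y" for x y
      using g' that gauss_word_iff by blast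
    have "crossing q1 = crossing p1 \<and> crossing q2 = crossing p2 \<or> crossing q1 = crossing p2 \<and> crossing q2 = crossing p1"
      using pq(2) by (auto simp: doubleton_eq_iff)
    then show ?thesis
      using same[of p1 q1] same[of p2 q2] same[of p2 q1] same[of p1 q2] m by auto
  qed
  have nw: "p1 \<notin> set ?w" "p2 \<notin> set ?w" "q1 \<notin> set ?w" "q2 \<notin> set ?w" "p1 \<noteq> p2"
    using g' by (auto simp: gauss_word_iff)
  have new: "p1 \<notin> set ?w" "p2 \<notin> set ?w" "opp p1 \<notin> set ?w" "opp p2 \<notin> set ?w"
    using nw Q by auto
  have ne: "p1 \<noteq> p2" "opp p1 \<noteq> p2" "p1 \<noteq> opp p2" using pq(1) by auto
  have f2: "from_left p2 = (\<not> from_left p1)" using pq(4) by blast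
  have opp: "opp z \<in> set ?w" if "z \<in> set ?w" for z using g that gauss_word_iff by blast
  have cl: "act r l e x y \<in> X" if "x \<in> X" "y \<in> X" for e x y using act_quandle(1)[OF q that] .
  have inv: "act r l (\<not> e) (act r l e x y) y = x" "act r l e (act r l (\<not> e) x y) y = x" if "x \<in> X" "y \<in> X" for e x y
    using act_quandle(2,3)[OF q that] by blast+
  show ?thesis
  proof
    assume "surjective_coloring X r l ?w"
    then obtain \<chi> a where c0: "colored X r l \<chi> ?w a a"
      and s: "\<And>Y. Y \<subseteq> X \<Longrightarrow> subquandle r l Y \<Longrightarrow> a \<in> Y \<Longrightarrow> \<chi> ` set ?w \<subseteq> Y \<Longrightarrow> Y = X"
      by (rule surjective_coloringE) (rule that)
    then obtain b c where c: "colored X r l \<chi> A a b" "colored X r l \<chi> B b c" "colored X r l \<chi> C c a"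
      unfolding colored_append by blast
    have bX: "b \<in> X" "c \<in> X" using colored_X[OF c(2)] by auto
    \<comment> \<open>Colors for the four new passages, depending on which strand is above and on the order of the crossings on the second strand.\<close>
    have "\<exists>u1 u2 v1 v2. \<forall>\<chi>'. \<chi>' p1 = u1 \<longrightarrow> \<chi>' p2 = u2 \<longrightarrow> \<chi>' (opp p1) = v1 \<longrightarrow> \<chi>' (opp p2) = v2 \<longrightarrow>
      colored X r l \<chi>' [p1, p2] b b \<and> colored X r l \<chi>' [q1, q2] c c"
    proof (cases "level p1")
      case Over
      show ?thesis
      proof (cases "q1 = opp p1")
        case True
        then have "q2 = opp p2" using Q by auto
        then show ?thesis using True Over pq(3) f2 bX cl inv
          by (intro exI[of _ b] exI[of _ c] exI[of _ "act r l (\<not> from_left p1) c b"]) (auto simp: out_def)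
      next
        case False
        then have "q1 = opp p2" "q2 = opp p1" using Q by auto
        then show ?thesis using Over pq(3) f2 bX cl inv
          by (rule_tac x = b in exI, rule_tac x = b in exI, rule_tac x = "act r l (from_left p1) c b" in exI, rule_tac x = c in exI)
            (auto simp: out_def)
      qed
    next
      case Under
      then show ?thesis using pq(3) Q f2 bX cl inv
        by (rule_tac x = b in exI, rule_tac x = "act r l (from_left p1) b c" in exI, rule_tac x = c in exI, rule_tac x = c in exI)
          (auto simp: out_def)
    next
      case Virtual
      then show ?thesis using pq(3) Q bX
        by (rule_tac x = b in exI, rule_tac x = b in exI, rule_tac x = c in exI, rule_tac x = c in exI)
          (auto simp: out_def)
    qed
    then obtain u1 u2 v1 v2 where u: "\<And>\<chi>'. \<chi>' p1 = u1 \<Longrightarrow> \<chi>' p2 = u2 \<Longrightarrow> \<chi>' (opp p1) = v1 \<Longrightarrow> \<chi>' (opp p2) = v2 \<Longrightarrow>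
      colored X r l \<chi>' [p1, p2] b b \<and> colored X r l \<chi>' [q1, q2] c c" by blast
    define \<chi>' where "\<chi>' = \<chi>(p1 := u1, p2 := u2, opp p1 := v1, opp p2 := v2)"
    have e: "\<chi>' z = \<chi> z" if "z \<in> set ?w" for z using that new by (auto simp: \<chi>'_def)
    have "colored X r l \<chi>' A a b" "colored X r l \<chi>' B b c" "colored X r l \<chi>' C c a"
      using colored_cong[OF c(1), of \<chi>'] colored_cong[OF c(2), of \<chi>'] colored_cong[OF c(3), of \<chi>'] e opp by auto
    moreover have "colored X r l \<chi>' [p1, p2] b b \<and> colored X r l \<chi>' [q1, q2] c c"
      by (rule u) (use ne in \<open>auto simp: \<chi>'_def\<close>)
    ultimately have c': "colored X r l \<chi>' ?w' a a" unfolding colored_append by blast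
    have sub: "\<chi> ` set ?w \<subseteq> \<chi>' ` set ?w'"
    proof
      fix y assume "y \<in> \<chi> ` set ?w"
      then obtain z where "z \<in> set ?w" "y = \<chi>' z" using e by auto
      then show "y \<in> \<chi>' ` set ?w'" by auto
    qed
    show "surjective_coloring X r l ?w'"
    proof (rule surjective_coloringI[OF c'])
      show "Y = X" if "Y \<subseteq> X" "subquandle r l Y" "a \<in> Y" "\<chi>' ` set ?w' \<subseteq> Y" for Y
        by (rule s[OF that(1,2,3) order_trans[OF sub that(4)]])
    qed
  next
    assume "surjective_coloring X r l ?w'"
    then obtain \<chi> a where c0: "colored X r l \<chi> ?w' a a"
      and s: "\<And>Y. Y \<subseteq> X \<Longrightarrow> subquandle r l Y \<Longrightarrow> a \<in> Y \<Longrightarrow> \<chi> ` set ?w' \<subseteq> Y \<Longrightarrow> Y = X"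
      by (rule surjective_coloringE) (rule that)
    then obtain b b' c c' where c: "colored X r l \<chi> A a b" "colored X r l \<chi> [p1, p2] b b'" "colored X r l \<chi> B b' c"
      "colored X r l \<chi> [q1, q2] c c'" "colored X r l \<chi> C c' a"
      unfolding colored_append by blast
    have bX: "b \<in> X" "c \<in> X" using colored_X[OF c(1)] colored_X[OF c(3)] by auto
    have k: "b' = b \<and> c' = c \<and> (\<forall>Y. subquandle r l Y \<longrightarrow> b \<in> Y \<longrightarrow> c \<in> Y \<longrightarrow> {\<chi> p1, \<chi> p2, \<chi> q1, \<chi> q2} \<subseteq> Y)"
    proof (cases "level p1")
      case Over
      then have "\<chi> p1 = b" "\<chi> p2 = b" "b' = b" using c(2) pq(3) by (auto simp: out_def)
      moreover have "\<chi> q1 = c" "\<chi> q2 = act r l (from_left q1) c b" "c' = act r l (\<not> from_left q1) (\<chi> q2) b"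
        using c(4) Q Over pq(3) f2 calculation by (auto simp: out_def)
      ultimately show ?thesis using inv[OF bX(2,1)] by (auto simp: act_def subquandle_def)
    next
      case Under
      then have "\<chi> q1 = c" "\<chi> q2 = c" "c' = c" using c(4) pq(3) Q by (auto simp: out_def)
      moreover have "\<chi> p1 = b" "\<chi> p2 = act r l (from_left p1) b c" "b' = act r l (\<not> from_left p1) (\<chi> p2) c"
        using c(2) Q Under pq(3) f2 calculation by (auto simp: out_def)
      ultimately show ?thesis using inv[OF bX] by (auto simp: act_def subquandle_def)
    next
      case Virtual
      then show ?thesis using c(2,4) pq(3) Q by (auto simp: out_def)
    qed
    then have cc: "colored X r l \<chi> B b c" "colored X r l \<chi> C c a" using c by auto
    have "colored X r l \<chi> (A @ B) a c" "colored X r l \<chi> (B @ C) b a"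
      unfolding colored_append using c(1) cc by blast+
    then have cin: "c \<in> insert a (\<chi> ` set C)" and bin: "b \<in> insert a (\<chi> ` set (B @ C))"
      using colored_exit[of X r l \<chi> "A @ B" a c C] colored_exit[of X r l \<chi> A a b "B @ C"] c(1) cc by blast+
    show "surjective_coloring X r l ?w"
    proof (rule surjective_coloringI)
      show "colored X r l \<chi> ?w a a" unfolding colored_append using c(1) cc by blast
      show "Y = X" if Y: "Y \<subseteq> X" "subquandle r l Y" "a \<in> Y" "\<chi> ` set ?w \<subseteq> Y" for Y
      proof (rule s[OF Y(1,2,3)])
        have "b \<in> Y" "c \<in> Y" using bin cin Y(3,4) by auto
        then have "{\<chi> p1, \<chi> p2, \<chi> q1, \<chi> q2} \<subseteq> Y" using k Y(2) by blast
        then show "\<chi> ` set ?w' \<subseteq> Y" using Y(4) by auto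
      qed
    qed
  qed
qed

section \<open>Colorings of a triangle\<close>

text \<open>
  An edge with end points \<open>t\<close> and \<open>h\<close>, where the direction of travel
  around the face is that of the word if \<open>b\<close> holds.
\<close>

definition traversed :: "bool \<Rightarrow> passage \<Rightarrow> passage \<Rightarrow> passage list" where
  "traversed b t h = (if b then [t, h] else [h, t])"

text \<open>
  Around the triangle the edges arrive at \<open>h1\<close>, \<open>h2\<close>, \<open>h3\<close>
  and leave from \<open>opp h3\<close>, \<open>opp h1\<close>, \<open>opp h2\<close>. The first
  edge belongs to the strand that is virtual at both ends or lies on top. The color of this strand
  acts on both other strands, and self-distributivity says that the order of this action and of
  the crossing of the other two strands does not matter. The eight choices of directions are
  checked separately.
\<close>

lemma triangle_recolor_one:
  assumes q: "quandle X r l"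
    and cr: "crossing h1 \<noteq> crossing h2" "crossing h2 \<noteq> crossing h3" "crossing h1 \<noteq> crossing h3"
    and fl: "from_left h1 = (b1 = b2)" "from_left h2 = (b2 = b3)" "from_left h3 = (b3 = b1)"
    and lev: "level h1 = Virtual \<and> level h3 = Virtual \<or> level h1 = Over \<and> level h3 = Under \<and> level h2 \<noteq> Virtual"
    and c: "colored X r l \<chi> (traversed b1 (opp h3) h1) i1 o1" "colored X r l \<chi> (traversed b2 (opp h1) h2) i2 o2"
      "colored X r l \<chi> (traversed b3 (opp h2) h3) i3 o3"
  shows "\<exists>\<psi>. \<forall>\<chi>'. (\<forall>p. crossing p \<in> crossing ` {h1, h2, h3} \<longrightarrow> \<chi>' p = \<psi> p) \<longrightarrow>
      colored X r l \<chi>' (traversed (\<not> b1) (opp h3) h1) i1 o1 \<and>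
      colored X r l \<chi>' (traversed (\<not> b2) (opp h1) h2) i2 o2 \<and>
      colored X r l \<chi>' (traversed (\<not> b3) (opp h2) h3) i3 o3"
    and "\<And>Y. subquandle r l Y \<Longrightarrow> {i1, i2, i3} \<subseteq> Y \<Longrightarrow>
      \<chi> ` {h1, h2, h3, opp h1, opp h2, opp h3} \<subseteq> Y"
proof -
  have iX: "i1 \<in> X" "i2 \<in> X" "i3 \<in> X" using c[THEN colored_X] by auto
  have cl: "r x y \<in> X" "l x y \<in> X" if "x \<in> X" "y \<in> X" for x y
    using q that unfolding quandle_def by blast+
  have inv: "l (r x y) y = x" "r (l x y) y = x" if "x \<in> X" "y \<in> X" for x y
    using q that unfolding quandle_def by blast+
  have D: "act r l e (act r l f a b) c = act r l f (act r l e a c) (act r l e b c)"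
    if "a \<in> X" "b \<in> X" "c \<in> X" for a b c e f
    using act_distrib[OF q that] .
  \<comment> \<open>Forms of distributivity in which the simplifier meets it: a color that has already been acted on by the top strand, or not yet.\<close>
  have X1: "r (r a (l b c)) c = r (r a c) b" "r (l a (l b c)) c = l (r a c) b"
    "l (r a (r b c)) c = r (l a c) b" "l (l a (r b c)) c = l (l a c) b"
    if "a \<in> X" "b \<in> X" "c \<in> X" for a b c
    using D[of a "l b c" c True True] D[of a "l b c" c True False] D[of a "r b c" c False True]
      D[of a "r b c" c False False] that cl inv by (simp_all add: act_def)
  have X2: "r (r a c) (r b c) = r (r a b) c" "l (r a c) (r b c) = r (l a b) c"
    "r (l a c) (l b c) = l (r a b) c" "l (l a c) (l b c) = l (l a b) c"
    if "a \<in> X" "b \<in> X" "c \<in> X" for a b c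
    using D[OF that, of True True] D[OF that, of True False] D[OF that, of False True]
      D[OF that, of False False] by (simp_all only: act_def if_True if_False)
  have ne: "h1 \<noteq> h2" "h2 \<noteq> h3" "h1 \<noteq> h3" "opp h1 \<noteq> h2" "opp h2 \<noteq> h3" "opp h1 \<noteq> h3"
    "h1 \<noteq> opp h2" "h2 \<noteq> opp h3" "h1 \<noteq> opp h3" using cr by auto
  have lev2: "level h2 = Over \<or> level h2 = Under \<or> level h2 = Virtual" by (cases "level h2") auto
  have lh: "level h1 = Virtual \<and> level h3 = Virtual \<or> level h1 = Over \<and> level h3 = Under \<and> level h2 = Over \<or>
      level h1 = Over \<and> level h3 = Under \<and> level h2 = Under" using lev lev2 by auto
  \<comment> \<open>\<open>A\<close> and \<open>B\<close> are the colors of the second and the third strand after passing under the first one.\<close>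
  define A where "A = (if level h1 = Over then act r l (b1 \<noteq> b2) i2 i1 else i2)"
  define B where "B = (if level h1 = Over then act r l (b3 = b1) i3 i1 else i3)"
  define X2' where "X2' = (if b2 then A else i2)"
  define Y2' where "Y2' = (if b3 then i3 else B)"
  define p2 where "p2 = (\<lambda>a. if level h2 = Under then act r l (b2 = b3) a Y2' else a)"
  define p3 where "p3 = (\<lambda>a. if level h2 = Over then act r l (b2 \<noteq> b3) a X2' else a)"
  have oc: "o1 = i1" "o2 = (if b2 then p2 A else if level h1 = Over then act r l (b1 \<noteq> b2) (p2 i2) i1 else p2 i2)"
    "o3 = (if b3 then if level h1 = Over then act r l (b3 = b1) (p3 i3) i1 else p3 i3 else p3 B)"
    using lh lev2
    by (elim disjE conjE; cases b1; cases b2; cases b3;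
        use c fl in \<open>simp add: traversed_def out_def A_def B_def X2'_def Y2'_def p2_def p3_def act_def\<close>)+
  \<comment> \<open>The colors after the move, where each strand meets its two crossings in the other order.\<close>
  define x2 where "x2 = (if b2 then i2 else A)"
  define y2 where "y2 = (if b3 then B else i3)"
  define z1 where "z1 = (if b2 then if level h2 = Under then act r l (b2 = b3) i2 y2 else i2 else i2)"
  define x3 where "x3 = (if b3 then i3 else if level h2 = Over then act r l (b2 \<noteq> b3) i3 x2 else i3)"
  define \<psi> where "\<psi> = (\<lambda>p. if p = h1 \<or> p = opp h3 then i1 else if p = h2 then x2 else if p = opp h1 then z1
      else if p = opp h2 then y2 else x3)"
  have "colored X r l \<chi>' (traversed (\<not> b1) (opp h3) h1) i1 o1 \<and>
      colored X r l \<chi>' (traversed (\<not> b2) (opp h1) h2) i2 o2 \<and>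
      colored X r l \<chi>' (traversed (\<not> b3) (opp h2) h3) i3 o3"
    if x: "\<forall>p. crossing p \<in> crossing ` {h1, h2, h3} \<longrightarrow> \<chi>' p = \<psi> p" for \<chi>'
  proof -
    have v: "\<chi>' h1 = i1" "\<chi>' (opp h3) = i1" "\<chi>' h2 = x2" "\<chi>' (opp h1) = z1" "\<chi>' (opp h2) = y2" "\<chi>' h3 = x3"
      using x ne by (auto simp: \<psi>_def)
    show ?thesis
      unfolding oc using lh lev2
      by (elim disjE conjE; cases b1; cases b2; cases b3;
        use fl v iX in \<open>simp add: traversed_def out_def A_def B_def X2'_def Y2'_def p2_def p3_def x2_def y2_def z1_def
          x3_def act_def cl inv X1 X2\<close>)
  qed
  then show "\<exists>\<psi>. \<forall>\<chi>'. (\<forall>p. crossing p \<in> crossing ` {h1, h2, h3} \<longrightarrow> \<chi>' p = \<psi> p) \<longrightarrow>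
      colored X r l \<chi>' (traversed (\<not> b1) (opp h3) h1) i1 o1 \<and>
      colored X r l \<chi>' (traversed (\<not> b2) (opp h1) h2) i2 o2 \<and>
      colored X r l \<chi>' (traversed (\<not> b3) (opp h2) h3) i3 o3" by blast
  show "\<chi> ` {h1, h2, h3, opp h1, opp h2, opp h3} \<subseteq> Y" if "subquandle r l Y" "{i1, i2, i3} \<subseteq> Y" for Y
    using lh
    by (elim disjE conjE; cases b1; cases b2; cases b3)
      (use c fl that in \<open>auto simp: traversed_def out_def act_def subquandle_def\<close>)
qed

text \<open>
  The triangle is cyclically symmetric, so the special strand may be taken as the first one.
\<close>

lemma triangle_recolor:
  assumes q: "quandle X r l"
    and cr: "crossing h1 \<noteq> crossing h2" "crossing h2 \<noteq> crossing h3" "crossing h1 \<noteq> crossing h3"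
    and fl: "from_left h1 = (b1 = b2)" "from_left h2 = (b2 = b3)" "from_left h3 = (b3 = b1)"
    and lev: "triangle_levels {(opp h3, h1), (opp h1, h2), (opp h2, h3)}"
    and c: "colored X r l \<chi> (traversed b1 (opp h3) h1) i1 o1" "colored X r l \<chi> (traversed b2 (opp h1) h2) i2 o2"
      "colored X r l \<chi> (traversed b3 (opp h2) h3) i3 o3"
  shows "\<exists>\<psi>. \<forall>\<chi>'. (\<forall>p. crossing p \<in> crossing ` {h1, h2, h3} \<longrightarrow> \<chi>' p = \<psi> p) \<longrightarrow>
      colored X r l \<chi>' (traversed (\<not> b1) (opp h3) h1) i1 o1 \<and>
      colored X r l \<chi>' (traversed (\<not> b2) (opp h1) h2) i2 o2 \<and>
      colored X r l \<chi>' (traversed (\<not> b3) (opp h2) h3) i3 o3" (is ?A)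
    and "\<And>Y. subquandle r l Y \<Longrightarrow> {i1, i2, i3} \<subseteq> Y \<Longrightarrow>
      \<chi> ` {h1, h2, h3, opp h1, opp h2, opp h3} \<subseteq> Y" (is "\<And>Y. _ \<Longrightarrow> _ \<Longrightarrow> ?B Y")
proof -
  let ?L = "\<lambda>h1 h2 h3. level h1 = Virtual \<and> level h3 = Virtual \<or> level h1 = Over \<and> level h3 = Under \<and> level h2 \<noteq> Virtual"
  have o: "opposite x = Over \<longleftrightarrow> x = Under" "opposite x = Under \<longleftrightarrow> x = Over" "opposite x = Virtual \<longleftrightarrow> x = Virtual" for x
    by (cases x; simp)+
  consider "?L h1 h2 h3" | "?L h2 h3 h1" | "?L h3 h1 h2"
    using lev by (auto simp: triangle_levels_def o)
  then have "?A \<and> (\<forall>Y. subquandle r l Y \<longrightarrow> {i1, i2, i3} \<subseteq> Y \<longrightarrow> ?B Y)"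
  proof cases
    case 1
    show ?thesis
      using triangle_recolor_one[OF q cr fl 1 c] by blast
  next
    case 2
    note t = triangle_recolor_one[OF q cr(2) cr(3)[symmetric] cr(1)[symmetric] fl(2,3,1) 2 c(2,3,1)]
    have e: "{h2, h3, h1} = {h1, h2, h3}" "{i2, i3, i1} = {i1, i2, i3}"
      "{h2, h3, h1, opp h2, opp h3, opp h1} = {h1, h2, h3, opp h1, opp h2, opp h3}" by auto
    show ?thesis using t[unfolded e] by blast
  next
    case 3
    note t = triangle_recolor_one[OF q cr(3)[symmetric] cr(1) cr(2)[symmetric] fl(3,1,2) 3 c(3,1,2)]
    have e: "{h3, h1, h2} = {h1, h2, h3}" "{i3, i1, i2} = {i1, i2, i3}"
      "{h3, h1, h2, opp h3, opp h1, opp h2} = {h1, h2, h3, opp h1, opp h2, opp h3}" by auto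
    show ?thesis using t[unfolded e] by blast
  qed
  then show ?A "\<And>Y. subquandle r l Y \<Longrightarrow> {i1, i2, i3} \<subseteq> Y \<Longrightarrow> ?B Y" by blast+
qed

lemma turn_right_edge:
  assumes g: "gauss_word w" and j: "Suc j < length w" "Suc j' < length w" and t: "turn_right w (j, b) = (j', b')"
  shows "w ! (if b' then j' else Suc j') = opp (w ! (if b then Suc j else j))"
    and "from_left (w ! (if b then Suc j else j)) = (b = b')"
proof -
  define n where "n = length w"
  define i where "i = (if b then Suc j else j)"
  define k where "k = partner w i"
  have i: "i < n" using j n_def i_def by auto
  have k: "k < n" "w ! k = opp (w ! i)" using nth_partner[OF g, of i] i n_def k_def by auto
  have ii: "(if b then Suc j mod n else j) = i" using j n_def i_def by auto
  have "turn_right w (j, b) = (if from_left (w ! i) = b then (k, True) else ((k + n - 1) mod n, False))"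
    unfolding turn_right.simps Let_def n_def[symmetric] ii k_def[symmetric] ..
  then have t': "(if from_left (w ! i) = b then (k, True) else ((k + n - 1) mod n, False)) = (j', b')"
    using t by simp
  have "from_left (w ! i) = (b = b') \<and> w ! (if b' then j' else Suc j') = opp (w ! i)"
  proof (cases "from_left (w ! i) = b")
    case True
    then show ?thesis using t' k by auto
  next
    case False
    then have e: "j' = (k + n - 1) mod n" "\<not> b'" using t' by auto
    have "Suc j' mod n = Suc (k + n - 1) mod n" unfolding e(1) by (rule mod_Suc_eq)
    moreover have "Suc (k + n - 1) = k + n" using k by simp
    ultimately have "Suc j' mod n = k" using k by simp
    then have "Suc j' = k" using j n_def by simp
    then show ?thesis using False e k by auto
  qed
  then show "w ! (if b' then j' else Suc j') = opp (w ! (if b then Suc j else j))"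
    "from_left (w ! (if b then Suc j else j)) = (b = b')" by (auto simp: i_def)
qed

text \<open>
  The boundary of a face with exactly three different edges visits each of them once. It could
  also run through an edge twice, in both directions; the Gauss word condition rules this out, as
  well as shorter cycles.
\<close>

lemma triangle_face:
  assumes g: "gauss_word w" and F: "F \<in> faces w" "fst ` F = {e1, e2, e3}"
    and e: "Suc e1 < e2" "Suc e2 < e3" "Suc e3 < length w"
  obtains j1 j2 j3 b1 b2 b3 where "{j1, j2, j3} = {e1, e2, e3}" "distinct [j1, j2, j3]"
    "\<And>j b j' b'. (j, b, j', b') \<in> {(j1, b1, j2, b2), (j2, b2, j3, b3), (j3, b3, j1, b1)} \<Longrightarrow>
      w ! (if b' then j' else Suc j') = opp (w ! (if b then Suc j else j)) \<and>
      from_left (w ! (if b then Suc j else j)) = (b = b')"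
proof -
  have d: "distinct w" using g gauss_word_iff by blast
  define E where "E = {e1, e2, e3}"
  have E: "Suc j < length w" if "j \<in> E" for j using that e by (auto simp: E_def)
  have sep: "j \<noteq> Suc j'" if "j \<in> E" "j' \<in> E" for j j' using that e by (auto simp: E_def)
  have inj: "w ! i = w ! k \<longleftrightarrow> i = k" if "i < length w" "k < length w" for i k
    using d that by (simp add: nth_eq_iff_index_eq)
  obtain x1 where x1: "F = orbit (turn_right w) x1"
    using F(1) unfolding faces_def face_def orbit_def by blast
  define T where "T = turn_right w"
  have F': "F = orbit T x1" using x1 T_def by simp
  have xF: "x1 \<in> F" "T x1 \<in> F" "T (T x1) \<in> F" "T (T (T x1)) \<in> F"
    unfolding F' by (intro orbit_step orbit_refl)+
  obtain j1 b1 where 1: "x1 = (j1, b1)" by fastforce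
  obtain j2 b2 where 2: "T x1 = (j2, b2)" by fastforce
  obtain j3 b3 where 3: "T (T x1) = (j3, b3)" by fastforce
  obtain j4 b4 where 4: "T (T (T x1)) = (j4, b4)" by fastforce
  have fE: "j \<in> E" if "(j, b) \<in> F" for j b using F(2) that unfolding E_def by force
  have jE: "j1 \<in> E" "j2 \<in> E" "j3 \<in> E" "j4 \<in> E" using xF fE 1 2 3 4 by metis+
  define h where "h = (\<lambda>j b. w ! (if b then Suc j else j))"
  define t where "t = (\<lambda>j b. w ! (if b then j else Suc j))"
  have ht: "h j b = h j' b' \<longleftrightarrow> j = j' \<and> b = b'" "t j b = t j' b' \<longleftrightarrow> j = j' \<and> b = b'"
    "h j b = t j' b' \<longleftrightarrow> j = j' \<and> b = (\<not> b')" if "j \<in> E" "j' \<in> E" for j b j' b'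
    using E[OF that(1)] E[OF that(2)] sep[OF that] sep[OF that(2,1)]
    by (auto simp: h_def t_def inj)
  have s: "t j' b' = opp (h j b) \<and> from_left (h j b) = (b = b')" if "T (j, b) = (j', b')" "j \<in> E" "j' \<in> E" for j b j' b'
    using turn_right_edge[OF g E[OF that(2)] E[OF that(3)]] that(1) unfolding T_def h_def t_def by blast
  have s1: "t j2 b2 = opp (h j1 b1)" "from_left (h j1 b1) = (b1 = b2)" using s[of j1 b1 j2 b2] 1 2 jE by auto
  have s2: "t j3 b3 = opp (h j2 b2)" "from_left (h j2 b2) = (b2 = b3)" using s[of j2 b2 j3 b3] 2 3 jE by auto
  have s3: "t j4 b4 = opp (h j3 b3)" "from_left (h j3 b3) = (b3 = b4)" using s[of j3 b3 j4 b4] 3 4 jE by auto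
  have three: "card E = 3" using e by (auto simp: E_def)
  have step: "j' \<noteq> j" if a: "t j' b' = opp (h j b)" "j \<in> E" "j' \<in> E" and ne: "(j', b') \<noteq> (j, b)" for j b j' b'
  proof
    assume "j' = j"
    then have "b' = (\<not> b)" using ne by auto
    then have "h j b = t j' b'" using ht(3)[OF a(2,3)] \<open>j' = j\<close> by auto
    then show False using a(1) by simp
  qed
  \<comment> \<open>Three successive darts are on different edges, and the fourth one is the first again.\<close>
  have n12: "(j2, b2) \<noteq> (j1, b1)"
  proof
    assume "(j2, b2) = (j1, b1)"
    then have "T x1 = x1" using 1 2 by simp
    then have "F = {x1}" unfolding F' by (rule orbit_fixpoint)
    then have "E = {fst x1}" using F(2) unfolding E_def by simp
    then show False using three by simp
  qed
  have j12: "j2 \<noteq> j1" by (rule step[OF s1(1) jE(1,2) n12])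
  have n23: "(j3, b3) \<noteq> (j2, b2)"
  proof
    assume "(j3, b3) = (j2, b2)"
    then have "opp (h j2 b2) = opp (h j1 b1)" using s1(1) s2(1) by simp
    then show False using ht(1)[OF jE(2,1), of b2 b1] j12 by simp
  qed
  have j23: "j3 \<noteq> j2" by (rule step[OF s2(1) jE(2,3) n23])
  have j13: "j3 \<noteq> j1"
  proof
    assume j: "j3 = j1"
    have "b3 = b1"
    proof (rule ccontr)
      assume "b3 \<noteq> b1"
      then have "h j1 b1 = t j3 b3" using ht(3)[OF jE(1,3)] j by auto
      then have "t j2 b2 = h j2 b2" using s1(1) s2(1) by simp
      then show False using ht(3)[OF jE(2,2)] by metis
    qed
    then have "T (T x1) = x1" using j 1 3 by simp
    from orbit_two_cycle[of T, OF refl this] have "F = {x1, T x1}" unfolding F' .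
    then have "E = {j1, j2}" using F(2) 1 2 unfolding E_def by simp
    then show False using three j12 by simp
  qed
  have Ej: "E = {j1, j2, j3}"
  proof -
    have "{j1, j2, j3} \<subseteq> E" "card {j1, j2, j3} = 3" using jE j12 j23 j13 by auto
    then show ?thesis using three card_subset_eq[of E "{j1, j2, j3}"] by (simp add: E_def)
  qed
  have n34: "(j4, b4) \<noteq> (j3, b3)"
  proof
    assume "(j4, b4) = (j3, b3)"
    then have "opp (h j3 b3) = opp (h j2 b2)" using s2(1) s3(1) by simp
    then show False using ht(1)[OF jE(3,2), of b3 b2] j23 by simp
  qed
  have j34: "j4 \<noteq> j3" by (rule step[OF s3(1) jE(3,4) n34])
  have j24: "j4 \<noteq> j2"
  proof
    assume j: "j4 = j2"
    show False
    proof (cases "b4 = b2")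
      case True
      then have "opp (h j3 b3) = opp (h j1 b1)" using s1(1) s3(1) j by simp
      then show False using ht(1)[OF jE(3,1)] j13 by simp
    next
      case False
      then have "h j2 b2 = t j4 b4" using ht(3)[OF jE(2,4)] j by auto
      then have "t j3 b3 = h j3 b3" using s2(1) s3(1) by simp
      then show False using ht(3)[OF jE(3,3)] by metis
    qed
  qed
  have j4: "j4 = j1" using Ej jE(4) j34 j24 by auto
  have b4: "b4 = b1"
  proof (rule ccontr)
    assume "b4 \<noteq> b1"
    then have "h j1 b1 = t j4 b4" using ht(3)[OF jE(1,4)] j4 by auto
    then have "t j2 b2 = h j3 b3" using s1(1) s3(1) by simp
    then show False using ht(3)[OF jE(3,2)] j23 by metis
  qed
  show thesis
  proof (rule that)
    show "{j1, j2, j3} = {e1, e2, e3}" using Ej E_def by simp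
    show "distinct [j1, j2, j3]" using j12 j23 j13 by auto
    show "w ! (if b' then j' else Suc j') = opp (w ! (if b then Suc j else j)) \<and>
      from_left (w ! (if b then Suc j else j)) = (b = b')"
      if "(j, b, j', b') \<in> {(j1, b1, j2, b2), (j2, b2, j3, b3), (j3, b3, j1, b1)}" for j b j' b'
      using that s1 s2 s3 j4 b4 unfolding h_def t_def by auto
  qed
qed

section \<open>Invariance of quandle quotients\<close>

text \<open>
  With \<open>S c e\<close> the subword at the edge \<open>e\<close> before (\<open>c\<close>) and
  after (\<open>\<not> c\<close>) the move, the statement is symmetric in the two diagrams. So it
  gives both directions of the invariance, although the face is given for only one of them.
\<close>

lemma triangle_recolor_face:
  assumes q: "quandle X r l" and g: "gauss_word w" and F: "F \<in> faces w" "fst ` F = {e1, e2, e3}"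
    and e: "Suc e1 < e2" "Suc e2 < e3" "Suc e3 < length w"
    and lev: "triangle_levels {(w ! e1, w ! Suc e1), (w ! e2, w ! Suc e2), (w ! e3, w ! Suc e3)}"
  defines "S \<equiv> \<lambda>c e. if c then [w ! e, w ! Suc e] else [w ! Suc e, w ! e]"
  defines "Z \<equiv> {w ! e1, w ! Suc e1, w ! e2, w ! Suc e2, w ! e3, w ! Suc e3}"
  shows "opp ` Z \<subseteq> Z"
    and "(\<And>e. e \<in> {e1, e2, e3} \<Longrightarrow> colored X r l \<chi> (S c e) (i e) (o' e)) \<Longrightarrow>
      \<exists>\<psi>. \<forall>\<chi>'. (\<forall>p. crossing p \<in> crossing ` Z \<longrightarrow> \<chi>' p = \<psi> p) \<longrightarrow>
        (\<forall>e\<in>{e1, e2, e3}. colored X r l \<chi>' (S (\<not> c) e) (i e) (o' e))"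
    and "(\<And>e. e \<in> {e1, e2, e3} \<Longrightarrow> colored X r l \<chi> (S c e) (i e) (o' e)) \<Longrightarrow>
      subquandle r l Y \<Longrightarrow> i ` {e1, e2, e3} \<subseteq> Y \<Longrightarrow> \<chi> ` Z \<subseteq> Y"
proof -
  obtain j1 j2 j3 b1 b2 b3 where j: "{j1, j2, j3} = {e1, e2, e3}" "distinct [j1, j2, j3]"
    and st: "\<And>j b j' b'. (j, b, j', b') \<in> {(j1, b1, j2, b2), (j2, b2, j3, b3), (j3, b3, j1, b1)} \<Longrightarrow>
      w ! (if b' then j' else Suc j') = opp (w ! (if b then Suc j else j)) \<and>
      from_left (w ! (if b then Suc j else j)) = (b = b')"
    by (rule triangle_face[OF g F e]) (rule that)
  have d: "distinct w" using g gauss_word_iff by blast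
  define h1 where "h1 = w ! (if b1 then Suc j1 else j1)"
  define h2 where "h2 = w ! (if b2 then Suc j2 else j2)"
  define h3 where "h3 = w ! (if b3 then Suc j3 else j3)"
  have t: "w ! (if b2 then j2 else Suc j2) = opp h1" "from_left h1 = (b1 = b2)"
    "w ! (if b3 then j3 else Suc j3) = opp h2" "from_left h2 = (b2 = b3)"
    "w ! (if b1 then j1 else Suc j1) = opp h3" "from_left h3 = (b3 = b1)"
    using st[of j1 b1 j2 b2] st[of j2 b2 j3 b3] st[of j3 b3 j1 b1] unfolding h1_def h2_def h3_def by blast+
  have Z: "Z = {h1, h2, h3, opp h1, opp h2, opp h3}"
  proof -
    have 1: "{w ! j1, w ! Suc j1} = {opp h3, h1}" "{w ! j2, w ! Suc j2} = {opp h1, h2}"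
      "{w ! j3, w ! Suc j3} = {opp h2, h3}"
      using t h1_def h2_def h3_def by (auto split: if_splits)
    have "Z = (\<Union>e\<in>{e1, e2, e3}. {w ! e, w ! Suc e})" by (auto simp: Z_def)
    also have "\<dots> = (\<Union>e\<in>{j1, j2, j3}. {w ! e, w ! Suc e})" using j(1) by simp
    also have "\<dots> = {opp h3, h1} \<union> {opp h1, h2} \<union> {opp h2, h3}" using 1 by auto
    finally show ?thesis by auto
  qed
  then show "opp ` Z \<subseteq> Z" by simp
  have jl: "Suc j < length w" if "j \<in> {j1, j2, j3}" for j
    using that unfolding j(1) using e by auto
  have sep: "j \<noteq> Suc j'" if "j \<in> {j1, j2, j3}" "j' \<in> {j1, j2, j3}" for j j'
    using that unfolding j(1) using e by auto
  have ix: "w ! k = w ! m \<longleftrightarrow> k = m" if "k < length w" "m < length w" for k m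
    by (rule nth_eq_iff_index_eq[OF d that])
  have hh: "j = j'" if "w ! (if b then Suc j else j) = w ! (if b' then Suc j' else j')"
    and j: "j \<in> {j1, j2, j3}" "j' \<in> {j1, j2, j3}" for j b j' b'
  proof -
    have "(if b then Suc j else j) = (if b' then Suc j' else j')"
      using that(1) ix[of "if b then Suc j else j" "if b' then Suc j' else j'"] jl[OF j(1)] jl[OF j(2)]
      by (cases b; cases b') simp_all
    then show ?thesis using sep[OF j] sep[OF j(2,1)] by (cases b; cases b') simp_all
  qed
  have hne: "h1 \<noteq> h2" "h2 \<noteq> h3" "h1 \<noteq> h3"
    unfolding h1_def h2_def h3_def using hh[of b1 j1 b2 j2] hh[of b2 j2 b3 j3] hh[of b1 j1 b3 j3] j(2)
    by (metis distinct_length_2_or_more insertCI)+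
  have tail: "w ! (if b then j else Suc j) \<noteq> w ! (if b then Suc j else j)" if "j \<in> {j1, j2, j3}" for j b
    using ix[of j "Suc j"] ix[of "Suc j" j] jl[OF that] by (cases b) simp_all
  have tne: "opp h1 \<noteq> h2" "opp h2 \<noteq> h3" "opp h3 \<noteq> h1"
    unfolding t(1,3,5)[symmetric] unfolding h1_def h2_def h3_def by (rule tail; simp)+
  have hw: "h1 \<in> set w" "h2 \<in> set w" "h3 \<in> set w"
    using jl[of j1] jl[of j2] jl[of j3] by (auto simp: h1_def h2_def h3_def)
  have same: "y = x \<or> y = opp x" if "x \<in> set w" "y \<in> set w" "crossing x = crossing y" for x y
    using g that gauss_word_iff by blast
  have cr: "crossing h1 \<noteq> crossing h2" "crossing h2 \<noteq> crossing h3" "crossing h1 \<noteq> crossing h3"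
    using same[OF hw(1,2)] same[OF hw(2,3)] same[OF hw(3,1)] hne tne by auto
  have S: "S c j1 = traversed (b1 = c) (opp h3) h1" "S c j2 = traversed (b2 = c) (opp h1) h2"
    "S c j3 = traversed (b3 = c) (opp h2) h3" for c
    unfolding S_def traversed_def t(1,3,5)[symmetric] unfolding h1_def h2_def h3_def by auto
  have fl: "from_left h1 = ((b1 = c) = (b2 = c))" "from_left h2 = ((b2 = c) = (b3 = c))"
    "from_left h3 = ((b3 = c) = (b1 = c))" for c
    using t by auto
  have L: "triangle_levels {(opp h3, h1), (opp h1, h2), (opp h2, h3)}"
  proof -
    have "triangle_levels ((\<lambda>e. (w ! e, w ! Suc e)) ` {e1, e2, e3})" using lev by simp
    then have "triangle_levels ((\<lambda>e. (w ! e, w ! Suc e)) ` {j1, j2, j3})" using j(1) by simp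
    then have 1: "triangle_levels {(w ! j1, w ! Suc j1), (w ! j2, w ! Suc j2), (w ! j3, w ! Suc j3)}" by simp
    have 2: "(w ! j1, w ! Suc j1) = (opp h3, h1) \<or> (w ! j1, w ! Suc j1) = (h1, opp h3)"
      "(w ! j2, w ! Suc j2) = (opp h1, h2) \<or> (w ! j2, w ! Suc j2) = (h2, opp h1)"
      "(w ! j3, w ! Suc j3) = (opp h2, h3) \<or> (w ! j3, w ! Suc j3) = (h3, opp h2)"
      using t by (auto simp: h1_def h2_def h3_def split: if_splits)
    show ?thesis using 2 1 unfolding triangle_levels_def by (elim disjE) auto
  qed
  {
    assume col: "\<And>e. e \<in> {e1, e2, e3} \<Longrightarrow> colored X r l \<chi> (S c e) (i e) (o' e)"
    have c: "colored X r l \<chi> (traversed (b1 = c) (opp h3) h1) (i j1) (o' j1)"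
      "colored X r l \<chi> (traversed (b2 = c) (opp h1) h2) (i j2) (o' j2)"
      "colored X r l \<chi> (traversed (b3 = c) (opp h2) h3) (i j3) (o' j3)"
      unfolding S[symmetric] by (rule col; use j(1) in blast)+
    note tri = triangle_recolor[OF q cr fl L c]
    have crZ: "crossing ` Z = crossing ` {h1, h2, h3}" using Z by auto
    have neg: "(\<not> (b = c)) = (b = (\<not> c))" for b by auto
    from tri(1)[unfolded neg S[symmetric]]
    show "\<exists>\<psi>. \<forall>\<chi>'. (\<forall>p. crossing p \<in> crossing ` Z \<longrightarrow> \<chi>' p = \<psi> p) \<longrightarrow>
        (\<forall>e\<in>{e1, e2, e3}. colored X r l \<chi>' (S (\<not> c) e) (i e) (o' e))"
      unfolding crZ j(1)[symmetric] by simp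
    show "\<chi> ` Z \<subseteq> Y" if "subquandle r l Y" "i ` {e1, e2, e3} \<subseteq> Y"
      unfolding Z by (rule tri(2)[OF that(1)]) (use that(2) in \<open>simp add: j(1)[symmetric]\<close>)
  }
qed

text \<open>
  Colors change only inside the triangle. The new inner colors determine the old ones within the
  generated subquandle, because the colors entering the triangle are the same.
\<close>

lemma surjective_coloring_R3:
  assumes q: "quandle X r l" and w: "w = A @ [p1, p2] @ B @ [q1, q2] @ C @ [r1, r2] @ D" and g: "gauss_word w"
    and F: "F \<in> faces w"
      "fst ` F = {length A, length (A @ [p1, p2] @ B), length (A @ [p1, p2] @ B @ [q1, q2] @ C)}"
    and lev: "triangle_levels {(p1, p2), (q1, q2), (r1, r2)}"
  shows "surjective_coloring X r l w \<longleftrightarrow>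
    surjective_coloring X r l (A @ [p2, p1] @ B @ [q2, q1] @ C @ [r2, r1] @ D)"
proof -
  define e1 where "e1 = length A"
  define e2 where "e2 = length (A @ [p1, p2] @ B)"
  define e3 where "e3 = length (A @ [p1, p2] @ B @ [q1, q2] @ C)"
  have n1: "w ! e1 = p1" "w ! Suc e1 = p2" by (simp_all add: w e1_def nth_append)
  have n2: "w ! e2 = q1" "w ! Suc e2 = q2"
    using nth_append_length[of "A @ [p1, p2] @ B" q1] nth_append_length[of "A @ [p1, p2] @ B @ [q1]" q2]
    by (simp_all add: w e2_def)
  have n3: "w ! e3 = r1" "w ! Suc e3 = r2"
    using nth_append_length[of "A @ [p1, p2] @ B @ [q1, q2] @ C" r1] nth_append_length[of "A @ [p1, p2] @ B @ [q1, q2] @ C @ [r1]" r2]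
    by (simp_all add: w e3_def)
  have e: "Suc e1 < e2" "Suc e2 < e3" "Suc e3 < length w" by (simp_all add: e1_def e2_def e3_def w)
  define Z where "Z = {p1, p2, q1, q2, r1, r2}"
  define S where "S = (\<lambda>c e. if c then [w ! e, w ! Suc e] else [w ! Suc e, w ! e])"
  define W where "W = (\<lambda>c. A @ S c e1 @ B @ S c e2 @ C @ S c e3 @ D)"
  note tri = triangle_recolor_face[OF q g F[folded e1_def e2_def e3_def] e, unfolded n1 n2 n3, OF lev]
  have oppZ: "opp ` Z \<subseteq> Z" using tri(1) by (simp add: Z_def)
  have d: "distinct w" using g gauss_word_iff by blast
  have rest: "crossing z \<notin> crossing ` Z" if z: "z \<in> set (A @ B @ C @ D)" for z
  proof
    assume "crossing z \<in> crossing ` Z"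
    then obtain y where y: "y \<in> Z" "crossing y = crossing z" by auto
    have "y \<in> set w" "z \<in> set w" using y z by (auto simp: Z_def w)
    then have "z = y \<or> z = opp y" using g y(2) gauss_word_iff by blast
    then have "z \<in> Z" using y(1) oppZ by auto
    then show False using z d by (auto simp: Z_def w)
  qed
  have dir: "surjective_coloring X r l (W (\<not> c))" if surj: "surjective_coloring X r l (W c)" for c
  proof -
    obtain \<chi> a where c0: "colored X r l \<chi> (W c) a a"
      and s: "\<And>Y. Y \<subseteq> X \<Longrightarrow> subquandle r l Y \<Longrightarrow> a \<in> Y \<Longrightarrow> \<chi> ` set (W c) \<subseteq> Y \<Longrightarrow> Y = X"
      using surj by (rule surjective_coloringE) (rule that)
    obtain a1 a2 a3 a4 a5 a6 where k: "colored X r l \<chi> A a a1" "colored X r l \<chi> (S c e1) a1 a2"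
      "colored X r l \<chi> B a2 a3" "colored X r l \<chi> (S c e2) a3 a4" "colored X r l \<chi> C a4 a5"
      "colored X r l \<chi> (S c e3) a5 a6" "colored X r l \<chi> D a6 a"
      using c0 unfolding W_def colored_append by blast
    define i where "i = (\<lambda>e. if e = e1 then a1 else if e = e2 then a3 else a5)"
    define o' where "o' = (\<lambda>e. if e = e1 then a2 else if e = e2 then a4 else a6)"
    have io: "i e1 = a1" "i e2 = a3" "i e3 = a5" "o' e1 = a2" "o' e2 = a4" "o' e3 = a6"
      using e by (auto simp: i_def o'_def)
    have col: "colored X r l \<chi> (S c e) (i e) (o' e)" if "e \<in> {e1, e2, e3}" for e
      using that k io by auto
    obtain \<psi> where \<psi>: "\<And>\<chi>'. (\<forall>p. crossing p \<in> crossing ` Z \<longrightarrow> \<chi>' p = \<psi> p) \<Longrightarrow>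
        (\<forall>e\<in>{e1, e2, e3}. colored X r l \<chi>' (S (\<not> c) e) (i e) (o' e))"
      using tri(2)[of \<chi> c i o'] col unfolding S_def Z_def by blast
    define \<chi>' where "\<chi>' = (\<lambda>p. if crossing p \<in> crossing ` Z then \<psi> p else \<chi> p)"
    have agree: "\<chi>' z = \<chi> z \<and> \<chi>' (opp z) = \<chi> (opp z)" if "z \<in> set (A @ B @ C @ D)" for z
      using rest[OF that] by (simp add: \<chi>'_def)
    have "colored X r l \<chi>' (S (\<not> c) e1) a1 a2" "colored X r l \<chi>' (S (\<not> c) e2) a3 a4"
      "colored X r l \<chi>' (S (\<not> c) e3) a5 a6"
      using \<psi>[of \<chi>'] io by (simp_all add: \<chi>'_def)
    note k' = this
    have "colored X r l \<chi>' A a a1" "colored X r l \<chi>' B a2 a3" "colored X r l \<chi>' C a4 a5" "colored X r l \<chi>' D a6 a"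
      by (rule colored_cong[OF k(1)] colored_cong[OF k(3)] colored_cong[OF k(5)] colored_cong[OF k(7)]; use agree in auto)+
    then have c': "colored X r l \<chi>' (W (\<not> c)) a a" unfolding W_def colored_append using k' by blast
    show ?thesis
    proof (rule surjective_coloringI[OF c'])
      fix Y assume Y: "Y \<subseteq> X" "subquandle r l Y" "a \<in> Y" "\<chi>' ` set (W (\<not> c)) \<subseteq> Y"
      have "a1 \<in> Y" "a3 \<in> Y" "a5 \<in> Y"
        using colored_start[OF k'(1)] colored_start[OF k'(2)] colored_start[OF k'(3)] Y(4)
        by (auto simp: W_def S_def split: if_splits)
      then have "i ` {e1, e2, e3} \<subseteq> Y" using io by auto
      then have "\<chi> ` Z \<subseteq> Y" using tri(3)[of \<chi> c i o' Y] col Y(2) unfolding S_def Z_def by blast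
      moreover have "\<chi> z \<in> Y" if "z \<in> set (A @ B @ C @ D)" for z
        using agree[OF that] Y(4) that by (force simp: W_def)
      moreover have "set (W c) \<subseteq> Z \<union> set (A @ B @ C @ D)"
        by (auto simp: W_def S_def Z_def n1 n2 n3 split: if_splits)
      ultimately have "\<chi> ` set (W c) \<subseteq> Y" by blast
      then show "Y = X" by (rule s[OF Y(1,2,3)])
    qed
  qed
  have W: "W True = w" "W False = A @ [p2, p1] @ B @ [q2, q1] @ C @ [r2, r1] @ D"
    unfolding W_def S_def n1 n2 n3 by (simp_all add: w)
  show ?thesis using dir[of True] dir[of False] unfolding not_True_eq_False not_False_eq_True W by blast
qed

text \<open>
  A change of the base edge can reverse the word, which exchanges the quandle with its dual.
\<close>

definition quandle_quotient :: "'q set \<Rightarrow> ('q \<Rightarrow> 'q \<Rightarrow> 'q) \<Rightarrow> ('q \<Rightarrow> 'q \<Rightarrow> 'q) \<Rightarrow> passage list \<Rightarrow> bool" where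
  "quandle_quotient X r l w \<longleftrightarrow> surjective_coloring X r l w \<or> surjective_coloring X l r w"

lemma quandle_quotient_move:
  assumes q: "quandle X r l" and "diagram_step w w'"
  shows "quandle_quotient X r l w \<longleftrightarrow> quandle_quotient X r l w'"
proof -
  have g: "gauss_word w" "gauss_word w'" and m: "move w w'"
    using assms by (auto simp: diagram_step_def virtual_diagram_def)
  note q' = quandle_dual[OF q]
  from m g show ?thesis
  proof (induction rule: move.induct)
    case (rename f w)
    then show ?case
      using surjective_coloring_rename[of w f X r l] surjective_coloring_rename[of w f X l r]
      by (simp add: quandle_quotient_def)
  next
    case (rebase_forward i w)
    obtain u v where "w = u @ v" "rotate (Suc i) w = v @ u"
      by (metis append_take_drop_id rotate_drop_take)
    then show ?case using surjective_coloring_rotate unfolding quandle_quotient_def by metis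
  next
    case (rebase_backward i w)
    obtain u v where uv: "w = u @ v" "rotate (Suc i) w = v @ u"
      by (metis append_take_drop_id rotate_drop_take)
    have "gauss_word (rev (v @ u))" using rebase_backward uv by simp
    then have g: "gauss_word (v @ u)" by (auto simp: gauss_word_iff)
    have "surjective_coloring X r l (v @ u) \<longleftrightarrow> surjective_coloring X l r (rev (v @ u))"
      using surjective_coloring_rev[OF q g] surjective_coloring_rev[OF q', of "rev (v @ u)"] g
      by (auto simp: gauss_word_iff)
    moreover have "surjective_coloring X l r (v @ u) \<longleftrightarrow> surjective_coloring X r l (rev (v @ u))"
      using surjective_coloring_rev[OF q' g] surjective_coloring_rev[OF q, of "rev (v @ u)"] g
      by (auto simp: gauss_word_iff)
    ultimately show ?case
      using surjective_coloring_rotate uv unfolding quandle_quotient_def by metis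
  next
    case (R1 p q A B)
    then show ?case
      using surjective_coloring_R1[OF assms(1), of A B p q] surjective_coloring_R1[OF q', of A B p q]
      by (simp add: quandle_quotient_def)
  next
    case (R2 p1 p2 q1 q2 A B C)
    then show ?case
      using surjective_coloring_R2[OF assms(1), of A B C p1 p2 q1 q2] surjective_coloring_R2[OF q', of A B C p1 p2 q1 q2]
      by (simp add: quandle_quotient_def)
  next
    case (R3 w A p1 p2 B q1 q2 C r1 r2 D F)
    show ?case
      using surjective_coloring_R3[OF assms(1) R3(1) R3(6) R3(3,4,5)] surjective_coloring_R3[OF q' R3(1) R3(6) R3(3,4,5)]
      by (simp add: quandle_quotient_def)
  qed
qed

lemma quandle_quotient_virtual_equiv:
  assumes "quandle X r l" "(w, w') \<in> virtual_equiv"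
  shows "quandle_quotient X r l w \<longleftrightarrow> quandle_quotient X r l w'"
proof -
  have "equivclp diagram_step w w'" using assms by (simp add: virtual_equiv_def)
  then show ?thesis
    by (induction rule: equivclp_induct) (use quandle_quotient_move[OF assms(1)] in blast)+
qed

section \<open>Colorings of a tower of ties\<close>

lemma colored_unique: "colored X r l \<chi> w a b \<Longrightarrow> colored X r l \<chi> w a b' \<Longrightarrow> b = b'"
  by (induction w arbitrary: a) auto

text \<open>
  The color on the first loop is \<open>u\<close>, that on the second one \<open>w\<close>. The
  second loop passes twice under the first, so \<open>Q\<close> starts with \<open>w\<close> acted
  on twice by \<open>u\<close>. The four eyelets act on the color \<open>y\<close> of the new
  strand; the last two cancel.
\<close>

lemma colored_tieD:
  assumes q: "quandle X r l" and y: "colored X r l \<chi> (fst (tie N s (P, Q))) y y'"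
    and u: "colored X r l \<chi> (snd (tie N s (P, Q))) u z"
  obtains w where "colored X r l \<chi> P u w" "colored X r l \<chi> Q (act r l s (act r l s w u) u) z"
    "y' = act r l (\<not> s) (act r l s y (act r l s (act r l s w u) u)) w"
    "w = u \<longrightarrow> (\<forall>p\<in>set (snd (tie N s (P, Q))). p \<in> set P \<or> p \<in> set Q \<or> \<chi> p = u)"
    "w = u \<longrightarrow> y = u \<longrightarrow> (\<forall>p\<in>set (fst (tie N s (P, Q))). \<chi> p = u)"
proof -
  obtain w where w: "colored X r l \<chi> P u w"
    "colored X r l \<chi> ([Passage (N + 2) Over s] @ map opp (rev (tied N s)) @ [Passage (N + 3) Over (\<not> s)] @ Q) w z"
    and a: "\<chi> (Passage N Over s) = u" "\<chi> (Passage (N + 1) Over (\<not> s)) = u" "u \<in> X"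
      "\<chi> (Passage (N + 4) Virtual s) = u" "\<chi> (Passage (N + 5) Over (\<not> s)) = u"
      "\<chi> (Passage (N + 6) Virtual s) = u" "\<chi> (Passage (N + 7) Over (\<not> s)) = u"
    using u by (auto simp: tie_def with_tips_def fingers_def tied_def colored_append out_def)
  define w1 where "w1 = act r l s w u"
  define w' where "w' = act r l s w1 u"
  have b: "\<chi> (Passage (N + 2) Over s) = w" "\<chi> (Passage (N + 3) Over (\<not> s)) = w'" "w \<in> X" "w' \<in> X"
    "\<chi> (Passage (N + 7) Under s) = w" "\<chi> (Passage (N + 6) Virtual (\<not> s)) = w1"
    "\<chi> (Passage (N + 5) Under s) = w1" "\<chi> (Passage (N + 4) Virtual (\<not> s)) = w'" "colored X r l \<chi> Q w' z"
    using w(2) a by (auto simp: tied_def out_def w1_def w'_def)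
  have yX: "y \<in> X" using colored_X[OF y] by blast
  define y1 where "y1 = act r l s y w'"
  define y2 where "y2 = act r l (\<not> s) y1 w"
  have X: "w1 \<in> X" "y1 \<in> X" "y2 \<in> X" using act_quandle(1)[OF q] a b yX by (auto simp: w1_def y1_def y2_def)
  have inv: "act r l (\<not> s) (act r l s y2 u) u = y2" using act_quandle(2)[OF q X(3) a(3)] .
  have e: "\<chi> (Passage (N + 3) Under s) = y" "\<chi> (Passage (N + 2) Under (\<not> s)) = y1"
    "\<chi> (Passage (N + 1) Under s) = y2" "\<chi> (Passage N Under (\<not> s)) = act r l s y2 u" "y' = y2"
    using y a b inv by (auto simp: tie_def with_tips_def eyelets_def out_def y1_def y2_def)
  have self: "act r l c u u = u" for c using act_quandle(4)[OF q a(3) a(3)] .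
  have self': "w1 = u" "w' = u" if "w = u" using that self by (simp_all add: w1_def w'_def)
  show thesis
  proof (rule that[of w])
    show "colored X r l \<chi> P u w" by fact
    show "colored X r l \<chi> Q (act r l s (act r l s w u) u) z" using b by (simp add: w1_def w'_def)
    show "y' = act r l (\<not> s) (act r l s y (act r l s (act r l s w u) u)) w"
      using e(5) by (simp add: y2_def y1_def w'_def w1_def)
    show "w = u \<longrightarrow> (\<forall>p\<in>set (snd (tie N s (P, Q))). p \<in> set P \<or> p \<in> set Q \<or> \<chi> p = u)"
    proof (intro impI ballI)
      fix p assume "w = u" "p \<in> set (snd (tie N s (P, Q)))"
      then show "p \<in> set P \<or> p \<in> set Q \<or> \<chi> p = u"
        using a b self' by (auto simp: tie_def with_tips_def fingers_def tied_def)
    qed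
    show "w = u \<longrightarrow> y = u \<longrightarrow> (\<forall>p\<in>set (fst (tie N s (P, Q))). \<chi> p = u)"
    proof (intro impI ballI)
      fix p assume wy: "w = u" "y = u" and p: "p \<in> set (fst (tie N s (P, Q)))"
      have "y1 = u" "y2 = u" using wy self self' by (simp_all add: y1_def y2_def)
      then show "\<chi> p = u" using p wy e self by (auto simp: tie_def with_tips_def eyelets_def)
    qed
  qed
qed

text \<open>
  The colors of the new crossings are forced by those at the ends of \<open>P\<close> and
  \<open>Q\<close>.
\<close>

lemma colored_tieI:
  assumes q: "quandle X r l" and b: "below N (P @ Q)" and opp: "\<And>p. p \<in> set (P @ Q) \<Longrightarrow> opp p \<in> set (P @ Q)"
    and P: "colored X r l \<chi> P u w" and Q: "colored X r l \<chi> Q (act r l s (act r l s w u) u) z" and y: "y \<in> X"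
  shows "\<exists>\<chi>' y'. colored X r l \<chi>' (fst (tie N s (P, Q))) y y' \<and> colored X r l \<chi>' (snd (tie N s (P, Q))) u z \<and>
    (\<forall>p\<in>set (P @ Q). \<chi>' p = \<chi> p)"
proof -
  define w1 where "w1 = act r l s w u"
  define w' where "w' = act r l s w1 u"
  define y1 where "y1 = act r l s y w'"
  define y2 where "y2 = act r l (\<not> s) y1 w"
  define y3 where "y3 = act r l s y2 u"
  have uX: "u \<in> X" "w \<in> X" using colored_X[OF P] by auto
  have X: "w1 \<in> X" "w' \<in> X" "y1 \<in> X" "y2 \<in> X" "y3 \<in> X"
    using act_quandle(1)[OF q] uX y by (auto simp: w1_def w'_def y1_def y2_def y3_def)
  have inv: "act r l (\<not> s) y3 u = y2" using act_quandle(2)[OF q X(4) uX(1)] by (simp add: y3_def)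
  define \<chi>' where "\<chi>' = (\<lambda>p. if crossing p < N then \<chi> p
    else if p = Passage (N + 3) Under s then y else if p = Passage (N + 2) Under (\<not> s) then y1
    else if p = Passage (N + 1) Under s then y2 else if p = Passage N Under (\<not> s) then y3
    else if p = Passage (N + 2) Over s \<or> p = Passage (N + 7) Under s then w
    else if p = Passage (N + 3) Over (\<not> s) \<or> p = Passage (N + 4) Virtual (\<not> s) then w'
    else if p = Passage (N + 6) Virtual (\<not> s) \<or> p = Passage (N + 5) Under s then w1 else u)"
  have old: "\<chi>' p = \<chi> p" if "p \<in> set (P @ Q)" for p using b that by (simp add: \<chi>'_def below_def)
  have P': "colored X r l \<chi>' P u w"
    by (rule colored_cong[OF P]) (use old opp in auto)
  have Q': "colored X r l \<chi>' Q w' z"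
    using Q unfolding w1_def[symmetric] w'_def[symmetric] by (rule colored_cong) (use old opp in auto)
  have "colored X r l \<chi>' (fst (tie N s (P, Q))) y y2"
    using X uX y inv by (simp add: tie_def with_tips_def eyelets_def out_def \<chi>'_def y1_def[symmetric] y2_def[symmetric] y3_def[symmetric])
  moreover have "colored X r l \<chi>' ([Passage N Over s] @ tied N s @ [Passage (N + 1) Over (\<not> s)]) u u"
    using uX by (simp add: tied_def out_def \<chi>'_def)
  moreover have "colored X r l \<chi>' ([Passage (N + 2) Over s] @ map opp (rev (tied N s)) @ [Passage (N + 3) Over (\<not> s)]) w w'"
    using uX X by (simp add: tied_def out_def \<chi>'_def w1_def[symmetric] w'_def[symmetric])
  ultimately have "colored X r l \<chi>' (fst (tie N s (P, Q))) y y2" "colored X r l \<chi>' (snd (tie N s (P, Q))) u z"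
    using P' Q' by (auto simp: tie_def with_tips_def fingers_def colored_append)
  then show ?thesis using old by blast
qed

text \<open>
  The colors at the two ends of the first half of the lock.
\<close>

definition lock_start :: "(passage \<Rightarrow> 'q) \<Rightarrow> 'q" where
  "lock_start \<chi> = \<chi> (Passage 0 Over True)"

definition lock_end :: "('q \<Rightarrow> 'q \<Rightarrow> 'q) \<Rightarrow> ('q \<Rightarrow> 'q \<Rightarrow> 'q) \<Rightarrow> (passage \<Rightarrow> 'q) \<Rightarrow> 'q" where
  "lock_end r l \<chi> = act r l False (lock_start \<chi>) (\<chi> (Passage 1 Over True))"

lemma colored_lockD:
  assumes "colored X r l \<chi> (fst lock) u w"
  shows "u = lock_start \<chi>" "w = lock_end r l \<chi>" "\<chi> (Passage 1 Under False) = u"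
  using assms by (auto simp: lock_def lock_start_def lock_end_def out_def)

lemma colored_lockD2:
  assumes "colored X r l \<chi> (snd lock) w' z"
  shows "\<chi> (Passage 2 Virtual True) = w'" "\<chi> (Passage 0 Under False) = w'"
    "\<chi> (Passage 1 Over True) = act r l False w' (lock_start \<chi>)" "z = act r l False w' (lock_start \<chi>)"
    "\<chi> (Passage 2 Virtual False) = z"
  using assms by (auto simp: lock_def lock_start_def out_def)

lemma tower0_Suc: "tower 0 (Suc k) X = tie (16 * (k + 1)) (even k) (tower 0 k X)"
  by simp

text \<open>
  If the color does not change along the first half of the lock, then by induction it does not
  change along either half of any tie around it.
\<close>

lemma constant_coloring:
  assumes q: "quandle X r l"
    and "colored X r l \<chi> (fst (tower 0 (Suc k) lock)) y y'" "colored X r l \<chi> (snd (tower 0 (Suc k) lock)) u z"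
    and eq: "lock_end r l \<chi> = lock_start \<chi>"
  shows "y' = y \<and> z = u \<and> (\<forall>p\<in>set (snd (tower 0 (Suc k) lock)). \<chi> p = u) \<and>
    (y = u \<longrightarrow> (\<forall>p\<in>set (fst (tower 0 (Suc k) lock)). \<chi> p = u))"
proof -
  have tie: "y' = y \<and> z = u \<and> (\<forall>p\<in>set (snd (tie N s (P, Q))). \<chi> p = u) \<and>
      (y = u \<longrightarrow> (\<forall>p\<in>set (fst (tie N s (P, Q))). \<chi> p = u))"
    if c: "colored X r l \<chi> (fst (tie N s (P, Q))) y y'" "colored X r l \<chi> (snd (tie N s (P, Q))) u z"
      and P: "\<And>w. colored X r l \<chi> P u w \<Longrightarrow> w = u"
      and Q: "colored X r l \<chi> P u u \<Longrightarrow> colored X r l \<chi> Q u z \<Longrightarrow> z = u \<and> (\<forall>p\<in>set P \<union> set Q. \<chi> p = u)"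
    for N s P Q y y' u z
  proof -
    have X: "y \<in> X" "u \<in> X" using c colored_X by metis+
    obtain w where w: "colored X r l \<chi> P u w" "colored X r l \<chi> Q (act r l s (act r l s w u) u) z"
      "y' = act r l (\<not> s) (act r l s y (act r l s (act r l s w u) u)) w"
      "w = u \<longrightarrow> (\<forall>p\<in>set (snd (tie N s (P, Q))). p \<in> set P \<or> p \<in> set Q \<or> \<chi> p = u)"
      "w = u \<longrightarrow> y = u \<longrightarrow> (\<forall>p\<in>set (fst (tie N s (P, Q))). \<chi> p = u)"
      by (rule colored_tieD[OF q c])
    have wu: "w = u" using P[OF w(1)] .
    have self: "act r l s (act r l s w u) u = u" using act_quandle(4)[OF q X(2) X(2)] wu by simp
    have "z = u" and PQ: "\<forall>p\<in>set P \<union> set Q. \<chi> p = u" using Q w(1) w(2)[unfolded self] unfolding wu by blast+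
    moreover have "y' = y" using w(3) wu self act_quandle(2)[OF q X, of s] by simp
    moreover have "\<forall>p\<in>set (snd (tie N s (P, Q))). \<chi> p = u" using w(4) wu PQ by blast
    moreover have "y = u \<longrightarrow> (\<forall>p\<in>set (fst (tie N s (P, Q))). \<chi> p = u)" using w(5) wu by blast
    ultimately show ?thesis by blast
  qed
  show ?thesis using assms(2,3)
  proof (induction k arbitrary: y y' u z)
    case 0
    have t: "tower 0 (Suc 0) lock = tie 16 True (fst lock, snd lock)" by simp
    show ?case unfolding t
    proof (rule tie)
      show "colored X r l \<chi> (fst (tie 16 True (fst lock, snd lock))) y y'"
        "colored X r l \<chi> (snd (tie 16 True (fst lock, snd lock))) u z" using 0 by simp_all
      show "w = u" if "colored X r l \<chi> (fst lock) u w" for w using colored_lockD[OF that] eq by simp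
      assume c: "colored X r l \<chi> (fst lock) u u" "colored X r l \<chi> (snd lock) u z"
      have st: "lock_start \<chi> = u" "\<chi> (Passage 1 Under False) = u" using colored_lockD[OF c(1)] by simp_all
      have self: "act r l e u u = u" for e using act_quandle(4)[OF q] colored_X[OF c(1)] by blast
      note c' = colored_lockD2[OF c(2), unfolded st self]
      show "z = u \<and> (\<forall>p\<in>set (fst lock) \<union> set (snd lock). \<chi> p = u)"
        using c' st by (auto simp: lock_def lock_start_def)
    qed
  next
    case (Suc k)
    define T where "T = tower 0 (Suc k) lock"
    have t: "tower 0 (Suc (Suc k)) lock = tie (16 * (Suc k + 1)) (even (Suc k)) (fst T, snd T)"
      unfolding T_def tower0_Suc[of "Suc k"] by simp
    note IH = Suc.IH[folded T_def]
    show ?case unfolding t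
    proof (rule tie)
      show "colored X r l \<chi> (fst (tie (16 * (Suc k + 1)) (even (Suc k)) (fst T, snd T))) y y'"
        "colored X r l \<chi> (snd (tie (16 * (Suc k + 1)) (even (Suc k)) (fst T, snd T))) u z"
        using Suc.prems[unfolded t] by simp_all
      have ex: "\<exists>z. colored X r l \<chi> (snd T) (act r l (even (Suc k)) (act r l (even (Suc k)) w u) u) z"
        if "colored X r l \<chi> (fst T) u w" for w
        by (rule colored_tieD[OF q Suc.prems[unfolded t]]) (use colored_unique[OF that] in metis)
      show "w = u" if "colored X r l \<chi> (fst T) u w" for w using ex[OF that] IH[OF that] by blast
      assume c: "colored X r l \<chi> (fst T) u u" "colored X r l \<chi> (snd T) u z"
      show "z = u \<and> (\<forall>p\<in>set (fst T) \<union> set (snd T). \<chi> p = u)" using IH[OF c] by blast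
    qed
  qed
qed

section \<open>Linear quandles and the drift along a tower\<close>

text \<open>
  The linear quandle modulo \<open>m\<close> with factor 2: the operation extends the segment from
  \<open>b\<close> to \<open>a\<close> to twice its length.
\<close>

definition double :: "int \<Rightarrow> int \<Rightarrow> int \<Rightarrow> int" where
  "double m a b = (2 * a - b) mod m"

text \<open>
  The inverse operation, with \<open>g\<close> a multiplicative inverse of 2 modulo
  \<open>m\<close>.
\<close>

definition halve :: "int \<Rightarrow> int \<Rightarrow> int \<Rightarrow> int \<Rightarrow> int" where
  "halve m g a b = (g * a + (1 - g) * b) mod m"

lemma int_mod_eqI: "x = y + m * i \<Longrightarrow> x mod m = y mod (m::int)"
  by simp

lemma mod_witness: obtains i where "x mod m = x + m * (i::int)"
proof -
  have "x mod m = x + m * (- (x div m))" using minus_mult_div_eq_mod[of x m] by simp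
  then show thesis by (rule that)
qed

lemma double_mod: "double m (x mod m) (y mod m) = double m x y"
proof -
  obtain i j where "x mod m = x + m * i" "y mod m = y + m * j" using mod_witness by metis
  then show ?thesis unfolding double_def by (intro int_mod_eqI[of _ _ _ "2 * i - j"]) (simp add: algebra_simps)
qed

lemma double_mod_left: "double m (x mod m) y = double m x y"
  by (metis double_mod mod_mod_trivial)

lemma halve_mod: "halve m g (x mod m) (y mod m) = halve m g x y"
proof -
  obtain i j where "x mod m = x + m * i" "y mod m = y + m * j" using mod_witness by metis
  then show ?thesis unfolding halve_def
    by (intro int_mod_eqI[of _ _ _ "g * i + (1 - g) * j"]) (simp add: algebra_simps)
qed

lemma quandle_double_halve:
  assumes m: "0 < m" and g: "m dvd 2 * g - 1"
  shows "quandle {0..<m} (double m) (halve m g)"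
proof -
  obtain h where h: "2 * g = 1 + m * h" using g by (metis add.commute diff_add_cancel dvd_def)
  have inv: "halve m g (double m a b) b = a \<and> double m (halve m g a b) b = a" if "a \<in> {0..<m}" for a b
  proof -
    have "(g * ((2 * a - b) mod m) + (1 - g) * b) mod m = (g * (2 * a - b) + (1 - g) * b) mod m"
      by (metis mod_add_left_eq mod_mult_right_eq)
    also have "g * (2 * a - b) + (1 - g) * b = (2 * g) * a + (1 - 2 * g) * b" by (simp add: algebra_simps)
    also have "\<dots> = a + m * (h * (a - b))" unfolding h by (simp add: algebra_simps)
    finally have 1: "halve m g (double m a b) b = a" using that by (simp add: halve_def double_def)
    have "(2 * ((g * a + (1 - g) * b) mod m) - b) mod m = (2 * (g * a + (1 - g) * b) - b) mod m"
      by (metis mod_diff_left_eq mod_mult_right_eq)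
    also have "2 * (g * a + (1 - g) * b) - b = (2 * g) * a + (1 - 2 * g) * b" by (simp add: algebra_simps)
    also have "\<dots> = a + m * (h * (a - b))" unfolding h by (simp add: algebra_simps)
    finally have "double m (halve m g a b) b = a" using that by (simp add: halve_def double_def)
    then show ?thesis using 1 by blast
  qed
  have "double m (double m a b) c = double m (double m a c) (double m b c)" for a b c
  proof -
    have "double m (double m a b) c = double m (2 * a - b) c"
      "double m (double m a c) (double m b c) = double m (2 * a - c) (2 * b - c)"
      unfolding double_def[of m a b] double_def[of m a c] double_def[of m b c] by (rule double_mod_left double_mod)+
    then show ?thesis by (simp add: double_def)
  qed
  moreover have "double m a a = a" if "a \<in> {0..<m}" for a using that by (simp add: double_def)
  moreover have "double m a b \<in> {0..<m}" "halve m g a b \<in> {0..<m}" for a b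
    using m by (simp_all add: double_def halve_def)
  ultimately show ?thesis unfolding quandle_def using inv by blast
qed

lemma mod_residue_eqI: "\<lbrakk>x \<in> {0..<m}; y \<in> {0..<m}; m dvd x - y\<rbrakk> \<Longrightarrow> x = (y::int)"
  by (metis atLeastLessThan_iff mod_eq_dvd_iff mod_pos_pos_trivial)

text \<open>
  If the color changes by \<open>d\<close> along \<open>P\<close>, then a tie on side
  \<open>s\<close> changes the color of the eyelet strand by \<open>outer_rate g s * d\<close>,
  and the color at the beginning of \<open>Q\<close> exceeds that at the beginning of
  \<open>P\<close> by \<open>inner_rate g s * d\<close>.
\<close>

definition outer_rate :: "int \<Rightarrow> bool \<Rightarrow> int" where
  "outer_rate g s = (if s then 1 - 5 * g else g ^ 2 - 1)"

definition inner_rate :: "int \<Rightarrow> bool \<Rightarrow> int" where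
  "inner_rate g s = (if s then 4 else g ^ 2)"

text \<open>
  The change of color along the first half of a tower of ties, in units of the change in the lock.
\<close>

fun outer_drift :: "int \<Rightarrow> nat \<Rightarrow> int" where
  "outer_drift g 0 = 1"
| "outer_drift g (Suc k) = outer_rate g (even k) * outer_drift g k"

text \<open>
  The same for the second half. The value at 0 is the contribution of the second half of the lock,
  inside at least one tie.
\<close>

fun inner_drift :: "int \<Rightarrow> nat \<Rightarrow> int" where
  "inner_drift g 0 = - 2"
| "inner_drift g (Suc k) = inner_drift g k + inner_rate g (even k) * outer_drift g k"

context
  fixes m g :: int
  assumes m: "0 < m" and g: "m dvd 2 * g - 1"
begin

lemma inner_drift_tie:
  assumes w: "m dvd w - (u + d)"
  shows "m dvd act (double m) (halve m g) s (act (double m) (halve m g) s w u) u - (u + inner_rate g s * d)"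
proof -
  obtain i where i: "w = u + d + m * i" using w by (metis add.commute diff_add_cancel dvd_def)
  show ?thesis
  proof (cases s)
    case True
    define p where "p = double m w u"
    obtain i1 where 1: "p = 2 * w - u + m * i1" unfolding p_def double_def by (rule mod_witness)
    obtain i2 where 2: "double m p u = 2 * p - u + m * i2" unfolding double_def by (rule mod_witness)
    have "double m p u - (u + 4 * d) = m * (4 * i + 2 * i1 + i2)"
      unfolding 2 unfolding 1 unfolding i by (simp add: algebra_simps)
    then show ?thesis using True by (simp add: act_def inner_rate_def p_def)
  next
    case False
    define p where "p = halve m g w u"
    obtain i1 where 1: "p = g * w + (1 - g) * u + m * i1" unfolding p_def halve_def by (rule mod_witness)
    obtain i2 where 2: "halve m g p u = g * p + (1 - g) * u + m * i2" unfolding halve_def by (rule mod_witness)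
    have "halve m g p u - (u + g ^ 2 * d) = m * (g ^ 2 * i + g * i1 + i2)"
      unfolding 2 unfolding 1 unfolding i by (simp add: algebra_simps power2_eq_square)
    then show ?thesis using False by (simp add: act_def inner_rate_def p_def)
  qed
qed

lemma outer_drift_tie:
  assumes w: "m dvd w - (u + d)" and v: "m dvd v - (u + inner_rate g s * d)"
  shows "m dvd act (double m) (halve m g) (\<not> s) (act (double m) (halve m g) s y v) w - (y + outer_rate g s * d)"
proof -
  obtain i where i: "w = u + d + m * i" using w by (metis add.commute diff_add_cancel dvd_def)
  obtain j where j: "v = u + inner_rate g s * d + m * j" using v by (metis add.commute diff_add_cancel dvd_def)
  obtain h where h: "2 * g = 1 + m * h" using g by (metis add.commute diff_add_cancel dvd_def)
  show ?thesis
  proof (cases s)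
    case True
    define p where "p = double m y v"
    obtain i1 where 1: "p = 2 * y - v + m * i1" unfolding p_def double_def by (rule mod_witness)
    obtain i2 where 2: "halve m g p w = g * p + (1 - g) * w + m * i2" unfolding halve_def by (rule mod_witness)
    have "halve m g p w - (y + (1 - 5 * g) * d) =
        (2 * g - 1) * (y - u) + m * (g * i1 - g * j + (1 - g) * i + i2)"
      unfolding 2 unfolding 1 unfolding i j using True by (simp add: algebra_simps inner_rate_def)
    also have "\<dots> = m * (h * (y - u) + (g * i1 - g * j + (1 - g) * i + i2))"
      unfolding h by (simp add: algebra_simps)
    finally show ?thesis using True by (simp add: act_def outer_rate_def p_def)
  next
    case False
    define p where "p = halve m g y v"
    obtain i1 where 1: "p = g * y + (1 - g) * v + m * i1" unfolding p_def halve_def by (rule mod_witness)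
    obtain i2 where 2: "double m p w = 2 * p - w + m * i2" unfolding double_def by (rule mod_witness)
    have "double m p w - (y + (g ^ 2 - 1) * d) =
        (2 * g - 1) * (y - u - g ^ 2 * d) + m * (2 * i1 + 2 * (1 - g) * j - i + i2)"
      unfolding 2 unfolding 1 unfolding i j using False by (simp add: algebra_simps inner_rate_def power2_eq_square)
    also have "\<dots> = m * (h * (y - u - g ^ 2 * d) + (2 * i1 + 2 * (1 - g) * j - i + i2))"
      unfolding h by (simp add: algebra_simps)
    finally show ?thesis using False by (simp add: act_def outer_rate_def p_def)
  qed
qed

abbreviation "col \<equiv> colored {0..<m} (double m) (halve m g)"
abbreviation "drift \<equiv> \<lambda>\<chi>. lock_end (double m) (halve m g) \<chi> - lock_start \<chi>"

lemmas quandle_mod = quandle_double_halve[OF m g]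

text \<open>
  The first half of a tower is the eyelet strand of the outermost tie; the second half runs
  through both loops and both halves of the inner tower.
\<close>

lemma tower_drift:
  assumes "col \<chi> (fst (tower 0 (Suc k) lock)) y y'" "col \<chi> (snd (tower 0 (Suc k) lock)) u z"
  shows "m dvd y' - (y + outer_drift g (Suc k) * drift \<chi>) \<and>
    m dvd z - (u + inner_drift g (Suc k) * drift \<chi>)"
proof -
  have tie: "m dvd y' - (y + outer_drift g (Suc k) * drift \<chi>) \<and>
      m dvd z - (u + inner_drift g (Suc k) * drift \<chi>)"
    if c: "col \<chi> (fst (tie N (even k) (P, Q))) y y'" "col \<chi> (snd (tie N (even k) (P, Q))) u z"
      and P: "\<And>w v. col \<chi> P u w \<Longrightarrow> col \<chi> Q v z \<Longrightarrow> m dvd w - (u + outer_drift g k * drift \<chi>)"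
      and Q: "\<And>w v. col \<chi> P u w \<Longrightarrow> col \<chi> Q v z \<Longrightarrow> m dvd v - (u + inner_rate g (even k) * (outer_drift g k * drift \<chi>))
        \<Longrightarrow> m dvd z - (v + inner_drift g k * drift \<chi>)"
    for N P Q y y' u z k
  proof -
    obtain w where w: "col \<chi> P u w"
      "col \<chi> Q (act (double m) (halve m g) (even k) (act (double m) (halve m g) (even k) w u) u) z"
      "y' = act (double m) (halve m g) (\<not> even k) (act (double m) (halve m g) (even k) y
        (act (double m) (halve m g) (even k) (act (double m) (halve m g) (even k) w u) u)) w"
      by (rule colored_tieD[OF quandle_mod c])
    define v where "v = act (double m) (halve m g) (even k) (act (double m) (halve m g) (even k) w u) u"
    have wd: "m dvd w - (u + outer_drift g k * drift \<chi>)" using P w by blast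
    have vd: "m dvd v - (u + inner_rate g (even k) * (outer_drift g k * drift \<chi>))"
      unfolding v_def by (rule inner_drift_tie[OF wd])
    have "m dvd z - (v + inner_drift g k * drift \<chi>)" using Q w(1,2) vd unfolding v_def by blast
    then have "m dvd (z - (v + inner_drift g k * drift \<chi>)) + (v - (u + inner_rate g (even k) * (outer_drift g k * drift \<chi>)))"
      using vd by (rule dvd_add)
    then have "m dvd z - (u + inner_drift g (Suc k) * drift \<chi>)" by (simp add: algebra_simps)
    moreover have "m dvd y' - (y + outer_drift g (Suc k) * drift \<chi>)"
      using outer_drift_tie[OF wd vd, of y] w(3) unfolding v_def by (simp add: mult.assoc)
    ultimately show ?thesis by blast
  qed
  show ?thesis using assms
  proof (induction k arbitrary: y y' u z)
    case 0
    have t: "tower 0 (Suc 0) lock = tie 16 (even (0::nat)) (fst lock, snd lock)" by simp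
    show ?case
    proof (rule tie)
      show "col \<chi> (fst (tie 16 (even (0::nat)) (fst lock, snd lock))) y y'"
        "col \<chi> (snd (tie 16 (even (0::nat)) (fst lock, snd lock))) u z" using 0 unfolding t by simp_all
      show "m dvd w - (u + outer_drift g 0 * drift \<chi>)" if "col \<chi> (fst lock) u w" for w
        using colored_lockD[OF that] by simp
      fix w v assume c: "col \<chi> (fst lock) u w" "col \<chi> (snd lock) v z"
        and v: "m dvd v - (u + inner_rate g (even (0::nat)) * (outer_drift g 0 * drift \<chi>))"
      obtain i where i: "v = u + 4 * drift \<chi> + m * i"
        using v by (simp add: inner_rate_def) (metis add.commute diff_add_cancel dvd_def)
      obtain h where h: "2 * g = 1 + m * h" using g by (metis add.commute diff_add_cancel dvd_def)
      obtain j where j: "z = g * v + (1 - g) * u + m * j"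
        using mod_witness[of "g * v + (1 - g) * u" m] colored_lockD2(4)[OF c(2)] colored_lockD(1)[OF c(1)]
        by (metis act_def halve_def)
      have "z - (v + inner_drift g 0 * drift \<chi>) = (2 * g - 1) * 2 * drift \<chi> + m * (j + g * i - i)"
        unfolding j unfolding i by (simp add: algebra_simps)
      also have "\<dots> = m * (h * 2 * drift \<chi> + (j + g * i - i))" unfolding h by (simp add: algebra_simps)
      finally show "m dvd z - (v + inner_drift g 0 * drift \<chi>)" by (rule dvdI)
    qed
  next
    case (Suc k)
    define T where "T = tower 0 (Suc k) lock"
    have t: "tower 0 (Suc (Suc k)) lock = tie (16 * (Suc k + 1)) (even (Suc k)) (fst T, snd T)"
      unfolding T_def tower0_Suc[of "Suc k"] by simp
    note IH = Suc.IH[folded T_def]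
    show ?case
    proof (rule tie)
      show "col \<chi> (fst (tie (16 * (Suc k + 1)) (even (Suc k)) (fst T, snd T))) y y'"
        "col \<chi> (snd (tie (16 * (Suc k + 1)) (even (Suc k)) (fst T, snd T))) u z"
        using Suc.prems[unfolded t] by simp_all
      show "m dvd w - (u + outer_drift g (Suc k) * drift \<chi>)" if "col \<chi> (fst T) u w" "col \<chi> (snd T) v z" for w v
        using IH[OF that] by blast
      show "m dvd z - (v + inner_drift g (Suc k) * drift \<chi>)" if "col \<chi> (fst T) u w" "col \<chi> (snd T) v z" for w v
        using IH[OF that] by blast
    qed
  qed
qed

text \<open>
  Along the whole chain the color has to come back to its initial value.
\<close>

lemma chain_drift:
  assumes "col \<chi> (chain (Suc k)) a a"
  shows "m dvd (outer_drift g (Suc k) + inner_drift g (Suc k)) * drift \<chi>"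
proof -
  obtain b where b: "col \<chi> (fst (tower 0 (Suc k) lock)) a b" "col \<chi> (snd (tower 0 (Suc k) lock)) b a"
    using assms unfolding chain_def word_def colored_append by blast
  have "m dvd (b - (a + outer_drift g (Suc k) * drift \<chi>)) + (a - (b + inner_drift g (Suc k) * drift \<chi>))"
    using tower_drift[OF b] by (blast intro: dvd_add)
  then have "m dvd - ((outer_drift g (Suc k) + inner_drift g (Suc k)) * drift \<chi>)" by (simp add: algebra_simps)
  then show ?thesis by simp
qed

lemma lock_in_tower: "set (word lock) \<subseteq> set (word (tower 0 k lock))"
proof (induction k)
  case (Suc k)
  have "set (word X) \<subseteq> set (word (tie N s X))" for X N s
    by (cases X) (auto simp: word_def tie_def with_tips_def fingers_def)
  then show ?case using Suc by (metis order_trans tower0_Suc)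
qed simp

text \<open>
  The change of color in the lock and the first colors of the two halves can be prescribed. In the
  step the inner tower is colored with the first color of its second half chosen as the tie
  requires; this color is known in advance, since \<open>tower_drift\<close> determines the end of
  the first half.
\<close>

lemma tower_coloring:
  assumes d: "d \<in> {0..<m}" and "y \<in> {0..<m}" "u \<in> {0..<m}"
  shows "\<exists>\<chi> y' z. col \<chi> (fst (tower 0 (Suc k) lock)) y y' \<and> col \<chi> (snd (tower 0 (Suc k) lock)) u z \<and>
    m dvd drift \<chi> - d"
proof -
  have fits: "below (16 * (k + 1)) (fst X @ snd X)" "\<And>p. p \<in> set (fst X @ snd X) \<Longrightarrow> opp p \<in> set (fst X @ snd X)"
    if "X = tower 0 k lock" for X k
    using fits_chain[of k] that by (auto simp: fits_def joinable_def virtual_diagram_def gauss_word_iff)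
  have keep: "drift \<chi>' = drift \<chi>" if "\<And>p. p \<in> set (word (tower 0 k lock)) \<Longrightarrow> \<chi>' p = \<chi> p" for \<chi> \<chi>' k
  proof -
    have "Passage 0 Over True \<in> set (word lock)" "Passage 1 Over True \<in> set (word lock)" by (simp_all add: word_def lock_def)
    then have "\<chi>' (Passage 0 Over True) = \<chi> (Passage 0 Over True)" "\<chi>' (Passage 1 Over True) = \<chi> (Passage 1 Over True)"
      using that lock_in_tower[of k] by blast+
    then show ?thesis by (simp add: lock_start_def lock_end_def)
  qed
  show ?thesis using assms(2,3)
  proof (induction k arbitrary: y u)
    case 0
    define w where "w = (u + d) mod m"
    define z where "z = double m w u"
    define v where "v = double m z u"
    have X: "w \<in> {0..<m}" "z \<in> {0..<m}" "v \<in> {0..<m}" using m by (simp_all add: w_def z_def v_def double_def)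
    have vz: "halve m g v u = z" using act_quandle(2)[OF quandle_mod X(2) 0(2), of True] by (simp add: act_def v_def)
    have uz: "halve m g u z = w"
    proof (rule mod_residue_eqI)
      show "halve m g u z \<in> {0..<m}" "w \<in> {0..<m}" using m X by (simp_all add: halve_def)
      obtain h where h: "2 * g = 1 + m * h" using g by (metis add.commute diff_add_cancel dvd_def)
      obtain i where i: "z = 2 * w - u + m * i" unfolding z_def double_def by (rule mod_witness)
      obtain j where j: "halve m g u z = g * u + (1 - g) * z + m * j" unfolding halve_def by (rule mod_witness)
      have "halve m g u z - w = (2 * g - 1) * (u - w) + m * (j + (1 - g) * i)"
        unfolding j unfolding i by (simp add: algebra_simps)
      also have "\<dots> = m * (h * (u - w) + (j + (1 - g) * i))" unfolding h by (simp add: algebra_simps)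
      finally show "m dvd halve m g u z - w" by simp
    qed
    define \<chi> where "\<chi> = (\<lambda>p. if p = Passage 0 Over True \<or> p = Passage 1 Under False then u
      else if p = Passage 2 Virtual True \<or> p = Passage 0 Under False then v else z)"
    have P: "col \<chi> (fst lock) u w" using X 0 uz by (simp add: lock_def \<chi>_def out_def act_def)
    have Q: "col \<chi> (snd lock) v z" using X 0 vz by (simp add: lock_def \<chi>_def out_def act_def)
    have Q': "col \<chi> (snd lock) (act (double m) (halve m g) True (act (double m) (halve m g) True w u) u) z"
      using Q by (simp add: act_def v_def z_def)
    have "below 16 (fst lock @ snd lock)" "\<And>p. p \<in> set (fst lock @ snd lock) \<Longrightarrow> opp p \<in> set (fst lock @ snd lock)"
      using fits[of lock 0] by simp_all
    from colored_tieI[OF quandle_mod this P Q' 0(1)]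
    obtain \<chi>' y' where "col \<chi>' (fst (tie 16 True (fst lock, snd lock))) y y'"
      "col \<chi>' (snd (tie 16 True (fst lock, snd lock))) u z" and e: "\<forall>p\<in>set (fst lock @ snd lock). \<chi>' p = \<chi> p"
      by blast
    moreover have "drift \<chi>' = drift \<chi>" by (rule keep[of 0]) (simp add: e word_def)
    moreover have "drift \<chi> = w - u" using uz by (simp add: lock_end_def lock_start_def act_def \<chi>_def)
    moreover have "m dvd w - u - d" using mod_witness[of "u + d" m] unfolding w_def by (metis add_diff_cancel_left' diff_diff_eq dvd_triv_left)
    ultimately show ?case by auto
  next
    case (Suc k)
    define T where "T = tower 0 (Suc k) lock"
    define s where "s = even (Suc k)"
    have t: "tower 0 (Suc (Suc k)) lock = tie (16 * (Suc k + 1)) s (fst T, snd T)"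
      unfolding T_def tower0_Suc[of "Suc k"] s_def by simp
    define w where "w = (u + outer_drift g (Suc k) * d) mod m"
    define v where "v = act (double m) (halve m g) s (act (double m) (halve m g) s w u) u"
    have w: "w \<in> {0..<m}" using m by (simp add: w_def)
    have v: "v \<in> {0..<m}" unfolding v_def by (intro act_quandle(1)[OF quandle_mod] w Suc.prems)
    obtain \<chi> w' z where c: "col \<chi> (fst T) u w'" "col \<chi> (snd T) v z" and d: "m dvd drift \<chi> - d"
      using Suc.IH[OF Suc.prems(2) v] unfolding T_def by blast
    have "w' = w"
    proof (rule mod_residue_eqI)
      show "w' \<in> {0..<m}" "w \<in> {0..<m}" using colored_X[OF c(1)] w by auto
      obtain i where i: "w = u + outer_drift g (Suc k) * d + m * i" unfolding w_def by (rule mod_witness)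
      have "m dvd (w' - (u + outer_drift g (Suc k) * drift \<chi>)) + (outer_drift g (Suc k) * (drift \<chi> - d)) - m * i"
        by (rule dvd_diff[OF dvd_add[OF _ dvd_mult[OF d]] dvd_triv_left]) (use tower_drift[OF c[unfolded T_def]] in blast)
      moreover have "(w' - (u + outer_drift g (Suc k) * drift \<chi>)) + (outer_drift g (Suc k) * (drift \<chi> - d)) - m * i = w' - w"
        unfolding i by (simp add: right_diff_distrib)
      ultimately show "m dvd w' - w" by metis
    qed
    then have P: "col \<chi> (fst T) u w" using c(1) by simp
    from colored_tieI[OF quandle_mod fits[of T "Suc k", OF T_def] P c(2)[unfolded v_def] Suc.prems(1)]
    obtain \<chi>' y' where "col \<chi>' (fst (tie (16 * (Suc k + 1)) s (fst T, snd T))) y y'"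
      "col \<chi>' (snd (tie (16 * (Suc k + 1)) s (fst T, snd T))) u z" and e: "\<forall>p\<in>set (fst T @ snd T). \<chi>' p = \<chi> p"
      by blast
    moreover have "drift \<chi>' = drift \<chi>" by (rule keep[of "Suc k"]) (simp add: e word_def T_def)
    ultimately show ?case unfolding t using d by metis
  qed
qed

text \<open>
  Extrapolating from \<open>c\<close> and \<open>c + 1\<close> reaches \<open>c + 2\<close>, and
  so on.
\<close>

lemma double_generates:
  assumes Y: "subquandle (double m) (halve m g) Y" "c \<in> Y" "(c + 1) mod m \<in> Y" and "Y \<subseteq> {0..<m}"
  shows "Y = {0..<m}"
proof -
  have "(c + int n) mod m \<in> Y \<and> (c + int n + 1) mod m \<in> Y" for n
  proof (induction n)
    case 0
    have "c \<in> {0..<m}" using assms by blast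
    then show ?case using Y by simp
  next
    case (Suc n)
    have "double m ((c + int n + 1) mod m) ((c + int n) mod m) \<in> Y"
      using Suc Y(1) unfolding subquandle_def by blast
    moreover have "double m ((c + int n + 1) mod m) ((c + int n) mod m) = (2 * (c + int n + 1) - (c + int n)) mod m"
      unfolding double_mod by (simp add: double_def)
    ultimately have "(2 * (c + int n + 1) - (c + int n)) mod m \<in> Y" by simp
    moreover have "2 * (c + int n + 1) - (c + int n) = c + int (Suc n) + 1" by simp
    ultimately have "(c + int (Suc n) + 1) mod m \<in> Y" by metis
    moreover have "c + int (Suc n) = c + int n + 1" by simp
    ultimately show ?case using Suc by metis
  qed
  note Yn = this
  have "x \<in> Y" if "x \<in> {0..<m}" for x
  proof -
    have "c < m" using assms by auto
    then have "c + int (nat (x + m - c)) = x + m" using that by auto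
    then show ?thesis using Yn[of "nat (x + m - c)"] that by simp
  qed
  then show ?thesis using assms(4) by blast
qed

text \<open>
  With the change of color in the lock equal to 1, two consecutive residues occur as colors.
\<close>

lemma chain_surjective_coloring:
  assumes "m dvd outer_drift g (Suc k) + inner_drift g (Suc k)"
  shows "surjective_coloring {0..<m} (double m) (halve m g) (chain (Suc k))"
proof -
  let ?T = "tower 0 (Suc k) lock"
  \<comment> \<open>The second half must start with the color in which the first half ends. Writing \<open>1 mod m\<close> covers the trivial case \<open>m = 1\<close>.\<close>
  have "1 mod m \<in> {0..<m}" "0 \<in> {0..<m}" "outer_drift g (Suc k) * (1 mod m) mod m \<in> {0..<m}" using m by auto
  then obtain \<chi> y' z where c: "col \<chi> (fst ?T) 0 y'" "col \<chi> (snd ?T) (outer_drift g (Suc k) * (1 mod m) mod m) z"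
    and d: "m dvd drift \<chi> - 1 mod m" using tower_coloring by blast
  define e where "e = outer_drift g (Suc k) * (1 mod m) mod m"
  obtain i where i: "drift \<chi> = 1 mod m + m * i" using d by (metis add.commute diff_add_cancel dvd_def)
  obtain j where j: "e = outer_drift g (Suc k) * (1 mod m) + m * j" unfolding e_def by (rule mod_witness)
  obtain n where n: "outer_drift g (Suc k) + inner_drift g (Suc k) = m * n" using assms by (rule dvdE)
  note t = tower_drift[OF c[folded e_def]]
  obtain i1 where 1: "y' = outer_drift g (Suc k) * drift \<chi> + m * i1" using t by (metis add.commute add_0 diff_add_cancel dvd_def)
  obtain i2 where 2: "z = e + inner_drift g (Suc k) * drift \<chi> + m * i2" using t by (metis add.commute diff_add_cancel dvd_def)
  have X: "y' \<in> {0..<m}" "z \<in> {0..<m}" "e \<in> {0..<m}" using colored_X[OF c(1)] colored_X[OF c(2)] by (simp_all add: e_def)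
  have "e - y' = m * (j - outer_drift g (Suc k) * i - i1)" unfolding 1 j i by (simp add: algebra_simps)
  then have ye: "e = y'" using mod_residue_eqI X by (metis dvd_triv_left)
  have "z - 0 = (outer_drift g (Suc k) + inner_drift g (Suc k)) * drift \<chi> + m * (j + i2 - outer_drift g (Suc k) * i)"
    unfolding 2 j unfolding i by (simp add: algebra_simps)
  then have "z - 0 = m * (n * drift \<chi> + j + i2 - outer_drift g (Suc k) * i)" unfolding n by (simp add: algebra_simps)
  then have z: "z = 0" using mod_residue_eqI[of z m 0] X m by (metis atLeastLessThan_iff dvd_triv_left order_refl)
  have "col \<chi> (chain (Suc k)) 0 0" unfolding chain_def word_def colored_append using c[folded e_def] ye z by blast
  then show ?thesis
  proof (rule surjective_coloringI)
    fix Y assume Y: "Y \<subseteq> {0..<m}" "subquandle (double m) (halve m g) Y" "\<chi> ` set (chain (Suc k)) \<subseteq> Y"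
    have "Passage 0 Over True \<in> set (word lock)" "Passage 1 Over True \<in> set (word lock)" by (simp_all add: word_def lock_def)
    then have "\<chi> (Passage 0 Over True) \<in> Y" "\<chi> (Passage 1 Over True) \<in> Y"
      using Y(3) lock_in_tower[of "Suc k"] unfolding chain_def by blast+
    then have s: "lock_start \<chi> \<in> Y" "lock_end (double m) (halve m g) \<chi> \<in> Y"
      using Y(2) unfolding lock_start_def lock_end_def subquandle_def act_def by auto
    have "lock_end (double m) (halve m g) \<chi> \<in> {0..<m}" using s Y(1) by blast
    moreover have "lock_end (double m) (halve m g) \<chi> = lock_start \<chi> + 1 mod m + m * i" using i by simp
    ultimately have "lock_end (double m) (halve m g) \<chi> = (lock_start \<chi> + 1) mod m"
      by (metis atLeastLessThan_iff mod_add_right_eq mod_mult_self2 mod_pos_pos_trivial)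
    then show "Y = {0..<m}" using double_generates[OF Y(2) s(1)] s(2) Y(1) by simp
  qed
qed

end

section \<open>Distinguishing the chains\<close>

lemma colored_map:
  assumes c: "colored X r l \<chi> w a b" and X: "\<And>p. p \<in> set w \<Longrightarrow> \<chi> (opp p) \<in> X"
    and f: "\<And>x. x \<in> X \<Longrightarrow> f x \<in> X'" "\<And>x y. x \<in> X \<Longrightarrow> y \<in> X \<Longrightarrow> f (r x y) = r' (f x) (f y) \<and> f (l x y) = l' (f x) (f y)"
  shows "colored X' r' l' (\<lambda>p. f (\<chi> p)) w (f a) (f b)"
  using c X
proof (induction w arbitrary: a)
  case (Cons p w)
  have "f (out r l \<chi> p a) = out r' l' (\<lambda>p. f (\<chi> p)) p (f a)"
    using f(2)[of a "\<chi> (opp p)"] Cons.prems by (auto simp: out_def act_def)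
  then show ?case using Cons.IH[of "out r l \<chi> p a"] Cons.prems f(1) by simp
qed (use f(1) in auto)

lemma constant_chain:
  assumes q: "quandle X r l" and c: "colored X r l \<chi> (chain (Suc k)) a a" and "lock_end r l \<chi> = lock_start \<chi>"
  shows "\<forall>p\<in>set (chain (Suc k)). \<chi> p = a"
proof -
  obtain b where b: "colored X r l \<chi> (fst (tower 0 (Suc k) lock)) a b" "colored X r l \<chi> (snd (tower 0 (Suc k) lock)) b a"
    using c unfolding chain_def word_def colored_append by blast
  show ?thesis using constant_coloring[OF q b assms(3)] unfolding chain_def word_def set_append by blast
qed

text \<open>
  Any coloring of a tower restricts to the lock, with the relation that the innermost tie imposes.
\<close>

lemma colored_tower_base:
  assumes q: "quandle X r l"
    and "colored X r l \<chi> (fst (tower 0 (Suc k) lock)) y y'" "colored X r l \<chi> (snd (tower 0 (Suc k) lock)) u z"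
  shows "\<exists>v. colored X r l \<chi> (fst lock) (lock_start \<chi>) (lock_end r l \<chi>) \<and>
    colored X r l \<chi> (snd lock) (r (r (lock_end r l \<chi>) (lock_start \<chi>)) (lock_start \<chi>)) v"
  using assms(2,3)
proof (induction k arbitrary: y y' u z)
  case 0
  have t: "tower 0 (Suc 0) lock = tie 16 True (fst lock, snd lock)" by simp
  obtain w where w: "colored X r l \<chi> (fst lock) u w" "colored X r l \<chi> (snd lock) (act r l True (act r l True w u) u) z"
    by (rule colored_tieD[OF q 0[unfolded t]])
  have "u = lock_start \<chi>" "w = lock_end r l \<chi>" using colored_lockD[OF w(1)] by blast+
  then show ?case using w by (auto simp: act_def)
next
  case (Suc k)
  define T where "T = tower 0 (Suc k) lock"
  have t: "tower 0 (Suc (Suc k)) lock = tie (16 * (Suc k + 1)) (even (Suc k)) (fst T, snd T)"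
    unfolding T_def tower0_Suc[of "Suc k"] by simp
  show ?case by (rule colored_tieD[OF q Suc.prems[unfolded t]]) (use Suc.IH[folded T_def] in blast)
qed

context
  fixes m g :: int
  assumes m: "0 < m" and g: "m dvd 2 * g - 1"
begin

text \<open>
  For the dual quandle the two undercrossings inside the lock force \<open>3 * (e - b) = 0\<close>
  for its end colors, so the coloring is constant.
\<close>

lemma chain_dual_coloring:
  assumes "coprime m 3" "surjective_coloring {0..<m} (halve m g) (double m) (chain (Suc k))"
  shows "m = 1"
proof -
  let ?col = "colored {0..<m} (halve m g) (double m)"
  note q = quandle_dual[OF quandle_double_halve[OF m g]]
  obtain \<chi> a where c: "?col \<chi> (chain (Suc k)) a a"
    and s: "\<And>Y. Y \<subseteq> {0..<m} \<Longrightarrow> subquandle (halve m g) (double m) Y \<Longrightarrow> a \<in> Y \<Longrightarrow> \<chi> ` set (chain (Suc k)) \<subseteq> Y \<Longrightarrow> Y = {0..<m}"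
    by (rule surjective_coloringE[OF assms(2)]) blast
  define e where "e = lock_end (halve m g) (double m) \<chi>"
  define b where "b = lock_start \<chi>"
  define d where "d = halve m g e b"
  obtain y where y: "?col \<chi> (fst (tower 0 (Suc k) lock)) a y" "?col \<chi> (snd (tower 0 (Suc k) lock)) y a"
    using c unfolding chain_def word_def colored_append by blast
  obtain v where v: "?col \<chi> (fst lock) b e" "?col \<chi> (snd lock) (halve m g d b) v"
    using colored_tower_base[OF q y] unfolding e_def b_def d_def by blast
  have X: "e \<in> {0..<m}" "b \<in> {0..<m}" using colored_X[OF v(1)] by simp_all
  have dX: "d \<in> {0..<m}" using m by (simp add: d_def halve_def)
  have "\<chi> (Passage 1 Over True) = double m (halve m g d b) b"
    using colored_lockD2(3)[OF v(2)] by (simp add: act_def b_def)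
  also have "\<dots> = d" using act_quandle(2)[OF q dX X(2), of True] by (simp add: act_def)
  finally have e: "e = double m b d" unfolding e_def lock_end_def by (simp add: act_def b_def)
  obtain i where i: "d = g * e + (1 - g) * b + m * i" unfolding d_def halve_def by (rule mod_witness)
  obtain j where j: "e = 2 * b - d + m * j" unfolding e double_def[of m b d] by (rule mod_witness)
  obtain h where h: "2 * g = 1 + m * h" using g by (metis add.commute diff_add_cancel dvd_def)
  \<comment> \<open>Here \<open>e = 2 * b - d\<close> and \<open>d\<close> is the midpoint of \<open>e\<close> and \<open>b\<close>.\<close>
  have "3 * (e - b) + (2 * g - 1) * (e - b) = 2 * (e - (2 * b - d)) - 2 * (d - (g * e + (1 - g) * b))"
    by (simp add: algebra_simps)
  also have "e - (2 * b - d) = m * j" using j by simp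
  also have "d - (g * e + (1 - g) * b) = m * i" using i by simp
  finally have "3 * (e - b) = 2 * (m * j) - 2 * (m * i) - (2 * g - 1) * (e - b)" by simp
  then have "3 * (e - b) = m * (2 * j - 2 * i - h * (e - b))" unfolding h by (simp add: algebra_simps)
  then have "m dvd 3 * (e - b)" by simp
  then have "m dvd e - b" using assms(1) coprime_dvd_mult_right_iff by blast
  then have "e = b" using mod_residue_eqI X by blast
  then have const: "\<forall>p\<in>set (chain (Suc k)). \<chi> p = a"
    using constant_chain[OF q c] unfolding e_def b_def by blast
  have aX: "a \<in> {0..<m}" using colored_X[OF c] by blast
  have "halve m g a a = a" "double m a a = a"
    using act_quandle(4)[OF q aX aX, of True] act_quandle(4)[OF q aX aX, of False] by (simp_all add: act_def)
  then have "subquandle (halve m g) (double m) {a}" unfolding subquandle_def by simp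
  then have "{a} = {0..<m}" by (rule s[rotated]) (use aX const in auto)
  then have "card {0..<m} = 1" by (metis card.empty card_insert_disjoint empty_iff finite.emptyI One_nat_def)
  then show "m = 1" using m by simp
qed

text \<open>
  Modulo \<open>n\<close>, the greatest common divisor of \<open>m\<close> and the change of color
  in the lock, the coloring is constant. Since it generates everything, \<open>n\<close> is 1, and
  the change can be cancelled from the closing condition.
\<close>

lemma chain_coloring_dvd:
  assumes "1 < m" "surjective_coloring {0..<m} (double m) (halve m g) (chain (Suc k))"
  shows "m dvd outer_drift g (Suc k) + inner_drift g (Suc k)"
proof -
  note q = quandle_double_halve[OF m g]
  obtain \<chi> a where c: "colored {0..<m} (double m) (halve m g) \<chi> (chain (Suc k)) a a"
    and s: "\<And>Y. Y \<subseteq> {0..<m} \<Longrightarrow> subquandle (double m) (halve m g) Y \<Longrightarrow> a \<in> Y \<Longrightarrow> \<chi> ` set (chain (Suc k)) \<subseteq> Y \<Longrightarrow> Y = {0..<m}"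
    by (rule surjective_coloringE[OF assms(2)]) blast
  define \<delta> where "\<delta> = lock_end (double m) (halve m g) \<chi> - lock_start \<chi>"
  define n where "n = gcd \<delta> m"
  have n: "0 < n" "n dvd m" "n dvd \<delta>" using m by (simp_all add: n_def)
  have gn: "n dvd 2 * g - 1" using n(2) g by (rule dvd_trans)
  have md: "x mod m mod n = x mod n" for x using n(2) by (rule mod_mod_cancel)
  have hom: "double m x y mod n = double n (x mod n) (y mod n)" "halve m g x y mod n = halve n g (x mod n) (y mod n)" for x y
    unfolding double_mod halve_mod by (simp_all add: double_def halve_def md)
  have opp: "opp p \<in> set (chain (Suc k))" if "p \<in> set (chain (Suc k))" for p
    using virtual_diagram_chain[of "Suc k"] that unfolding virtual_diagram_def gauss_word_iff by blast
  have cX: "\<chi> ` set (chain (Suc k)) \<subseteq> {0..<m}" using colored_X[OF c] by blast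
  have oppX: "\<chi> (opp p) \<in> {0..<m}" if "p \<in> set (chain (Suc k))" for p using opp[OF that] cX by blast
  define \<chi>' where "\<chi>' = (\<lambda>p. \<chi> p mod n)"
  have c': "colored {0..<n} (double n) (halve n g) \<chi>' (chain (Suc k)) (a mod n) (a mod n)"
    unfolding \<chi>'_def by (rule colored_map[OF c oppX]) (use n(1) hom in auto)
  have "lock_start \<chi>' = lock_start \<chi> mod n" by (simp add: lock_start_def \<chi>'_def)
  moreover have "lock_end (double n) (halve n g) \<chi>' = lock_end (double m) (halve m g) \<chi> mod n"
    by (simp add: lock_end_def lock_start_def \<chi>'_def act_def hom)
  moreover have "lock_end (double m) (halve m g) \<chi> mod n = lock_start \<chi> mod n"
    using n(3) by (simp add: mod_eq_dvd_iff \<delta>_def)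
  ultimately have "lock_end (double n) (halve n g) \<chi>' = lock_start \<chi>'" by simp
  then have const: "\<forall>p\<in>set (chain (Suc k)). \<chi>' p = a mod n"
    using constant_chain[OF quandle_double_halve[OF n(1) gn] c'] by blast
  define Y where "Y = {x \<in> {0..<m}. x mod n = a mod n}"
  have an: "a mod n \<in> {0..<n}" using n(1) by simp
  have "double n (a mod n) (a mod n) = a mod n" "halve n g (a mod n) (a mod n) = a mod n"
    using act_quandle(4)[OF quandle_double_halve[OF n(1) gn] an an, of True]
      act_quandle(4)[OF quandle_double_halve[OF n(1) gn] an an, of False] by (simp_all add: act_def)
  moreover have "double m x y \<in> {0..<m}" "halve m g x y \<in> {0..<m}" for x y using m by (simp_all add: double_def halve_def)
  ultimately have "subquandle (double m) (halve m g) Y" unfolding subquandle_def Y_def by (simp add: hom)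
  moreover have "a \<in> {0..<m}" using colored_X[OF c] by blast
  ultimately have "Y = {0..<m}" by (intro s) (use const cX in \<open>auto simp: Y_def \<chi>'_def\<close>)
  moreover have "0 \<in> {0..<m}" "1 \<in> {0..<m}" using assms(1) by simp_all
  ultimately have "0 mod n = a mod n" "1 mod n = a mod n" unfolding Y_def by blast+
  then have "1 mod n = 0 mod n" by simp
  then have "n dvd 1" by (simp only: mod_eq_dvd_iff) simp
  then have "coprime m \<delta>" unfolding n_def by (metis coprime_iff_gcd_eq_1 gcd.commute is_unit_gcd_iff)
  then show ?thesis using chain_drift[OF m g c] unfolding \<delta>_def[symmetric] by (simp add: coprime_dvd_mult_left_iff)
qed

text \<open>
  Two ties multiply the outer drift by \<open>(g\<^sup>2 - 1) * (1 - 5 * g)\<close>, which is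
  \<open>9 / 8\<close> if \<open>g\<close> is read as \<open>1 / 2\<close>. Multiplying by powers
  of 8 gives integers independent of \<open>g\<close>.
\<close>

lemma drift_even:
  "m dvd 8 ^ h * outer_drift g (2 * h) - 9 ^ h \<and> m dvd 8 ^ h * inner_drift g (2 * h) - (29 * 9 ^ h - 31 * 8 ^ h)"
proof (induction h)
  case (Suc h)
  obtain c where c: "2 * g = 1 + m * c" using g by (metis add.commute diff_add_cancel dvd_def)
  define D where "D = outer_drift g (2 * h)"
  define R where "R = inner_drift g (2 * h)"
  obtain i where i: "8 ^ h * D = 9 ^ h + m * i" using Suc unfolding D_def by (metis add.commute diff_add_cancel dvd_def)
  obtain j where j: "8 ^ h * R = 29 * 9 ^ h - 31 * 8 ^ h + m * j" using Suc unfolding R_def by (metis add.commute diff_add_cancel dvd_def)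
  have D: "outer_drift g (2 * Suc h) = (g ^ 2 - 1) * (1 - 5 * g) * D"
    by (simp add: D_def outer_rate_def)
  have R: "inner_drift g (2 * Suc h) = R + 4 * D + g ^ 2 * (1 - 5 * g) * D"
    by (simp add: D_def R_def outer_rate_def inner_rate_def)
  have c': "2 * g - 1 = m * c" using c by simp
  have "8 * ((g ^ 2 - 1) * (1 - 5 * g)) - 9 = (2 * g - 1) * (17 - 6 * g - 20 * g ^ 2)"
    by (simp add: algebra_simps power2_eq_square)
  then obtain k1 where k1: "8 * ((g ^ 2 - 1) * (1 - 5 * g)) = 9 + m * k1"
    unfolding c' by (metis add.commute diff_add_cancel mult.assoc)
  have "8 * (4 + g ^ 2 * (1 - 5 * g)) - 29 = (2 * g - 1) * (- 3 - 6 * g - 20 * g ^ 2)"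
    by (simp add: algebra_simps power2_eq_square)
  then obtain k2 where k2: "8 * (4 + g ^ 2 * (1 - 5 * g)) = 29 + m * k2"
    unfolding c' by (metis add.commute diff_add_cancel mult.assoc)
  have "8 ^ Suc h * outer_drift g (2 * Suc h) = (8 * ((g ^ 2 - 1) * (1 - 5 * g))) * (8 ^ h * D)"
    unfolding D by simp
  then have 1: "8 ^ Suc h * outer_drift g (2 * Suc h) - 9 ^ Suc h = m * (k1 * (9 ^ h + m * i) + 9 * i)"
    unfolding k1 i by (simp add: algebra_simps)
  have "8 ^ Suc h * inner_drift g (2 * Suc h) = 8 * (8 ^ h * R) + (8 * (4 + g ^ 2 * (1 - 5 * g))) * (8 ^ h * D)"
    unfolding R by (simp add: algebra_simps)
  then have 2: "8 ^ Suc h * inner_drift g (2 * Suc h) - (29 * 9 ^ Suc h - 31 * 8 ^ Suc h) =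
      m * (8 * j + 29 * i + k2 * (9 ^ h + m * i))"
    unfolding k2 i j by (simp add: algebra_simps)
  show ?case unfolding 1 2 by simp
qed simp

end

text \<open>
  Half of \<open>30 * 9 ^ (k + 1) - 31 * 8 ^ (k + 1)\<close>, the sum of the two drifts after
  \<open>2 * (k + 1)\<close> ties up to a power of 8.
\<close>

definition modulus :: "nat \<Rightarrow> int" where
  "modulus k = 135 * 9 ^ k - 124 * 8 ^ k"

text \<open>
  The factors 2 and \<open>8 ^ Suc k\<close> are invertible modulo \<open>m\<close>.
\<close>

lemma modulus_drift:
  assumes m: "0 < m" and g: "m dvd 2 * g - 1"
  shows "m dvd outer_drift g (2 * Suc k) + inner_drift g (2 * Suc k) \<longleftrightarrow> m dvd modulus k"
proof -
  let ?S = "outer_drift g (2 * Suc k) + inner_drift g (2 * Suc k)"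
  note d = drift_even[OF m g, of "Suc k"]
  have "coprime (2 * g - 1) 2" by simp
  then have c: "coprime m 2" using g by (metis coprime_divisors dvd_refl)
  have "coprime m (2 ^ (3 * Suc k))" using c by (rule coprime_power_right_iff[THEN iffD2, OF disjI1])
  moreover have "(2 :: int) ^ (3 * Suc k) = 8 ^ Suc k" unfolding power_mult by simp
  ultimately have c8: "coprime m (8 ^ Suc k)" by (simp only:)
  have "8 ^ Suc k * ?S - 2 * modulus k = (8 ^ Suc k * outer_drift g (2 * Suc k) - 9 ^ Suc k) +
      (8 ^ Suc k * inner_drift g (2 * Suc k) - (29 * 9 ^ Suc k - 31 * 8 ^ Suc k))"
    by (simp add: modulus_def algebra_simps del: outer_drift.simps inner_drift.simps)
  then have "m dvd 8 ^ Suc k * ?S - 2 * modulus k" using d by (simp only: dvd_add)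
  then have "m dvd 8 ^ Suc k * ?S \<longleftrightarrow> m dvd 2 * modulus k"
    by (metis diff_add_cancel dvd_add_right_iff)
  then show ?thesis using c c8 coprime_dvd_mult_right_iff by blast
qed

lemma modulus_mono: "modulus k < modulus (Suc k)"
proof -
  have "(8 :: int) ^ k \<le> 9 ^ k" by (rule power_mono) simp_all
  moreover have "(0 :: int) < 9 ^ k" by simp
  ultimately show ?thesis unfolding modulus_def power_Suc by linarith
qed

lemma modulus_less: "j < k \<Longrightarrow> modulus j < modulus k"
  using lift_Suc_mono_less[of modulus, OF modulus_mono] by blast

lemma modulus_gt_1: "1 < modulus k"
  using modulus_less[of 0 k] by (cases "k = 0") (simp_all add: modulus_def)

lemma coprime_modulus_3: "coprime (modulus k) 3"
proof -
  have "coprime (3 :: int) 124" "coprime (3 :: int) 8" by (simp_all add: coprime_iff_gcd_eq_1 gcd_code_int)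
  then have "coprime 3 (124 * 8 ^ k :: int)" by simp
  moreover have "c dvd 124 * 8 ^ k" if "c dvd modulus k" "c dvd 3" for c
  proof -
    have "c dvd 3 * (45 * 9 ^ k) - modulus k" using that by (intro dvd_diff dvd_mult2)
    then show ?thesis by (simp add: modulus_def)
  qed
  ultimately show ?thesis by (meson coprimeI coprime_common_divisor)
qed

lemma odd_modulus: "odd (modulus k)"
  by (simp add: modulus_def)

text \<open>
  Surjective colorings by the dual quandle do not exist, so the closing condition alone decides.
\<close>

lemma chain_quandle_quotient_iff:
  "quandle_quotient {0..<modulus j} (double (modulus j)) (halve (modulus j) ((modulus j + 1) div 2)) (chain (2 * Suc k))
    \<longleftrightarrow> modulus j dvd modulus k"
proof -
  define m where "m = modulus j"
  define g where "g = (m + 1) div 2"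
  have m: "0 < m" "1 < m" "coprime m 3" using modulus_gt_1[of j] coprime_modulus_3[of j] by (simp_all add: m_def)
  have "odd m" by (simp add: m_def odd_modulus)
  then have "2 * g = m + 1" unfolding g_def by (intro dvd_mult_div_cancel) simp
  then have g: "m dvd 2 * g - 1" by simp
  have e: "2 * Suc k = Suc (2 * k + 1)" by simp
  have "\<not> surjective_coloring {0..<m} (halve m g) (double m) (chain (2 * Suc k))"
    using chain_dual_coloring[OF m(1) g m(3)] m(2) unfolding e by fastforce
  moreover have "surjective_coloring {0..<m} (double m) (halve m g) (chain (2 * Suc k)) \<longleftrightarrow> m dvd modulus k"
    using chain_coloring_dvd[OF m(1) g m(2), of "2 * k + 1"] chain_surjective_coloring[OF m(1) g, of "2 * k + 1"]
    unfolding modulus_drift[OF m(1) g, of k, symmetric] e by blast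
  ultimately show ?thesis unfolding quandle_quotient_def m_def[symmetric] g_def[symmetric] by blast
qed

text \<open>
  The longer chain has a surjective coloring modulo \<open>modulus j\<close>; the shorter one
  cannot, since \<open>modulus k\<close> is positive and smaller.
\<close>

lemma chain_not_equiv:
  assumes "k < j"
  shows "virtual_equiv `` {chain (2 * Suc j)} \<noteq> virtual_equiv `` {chain (2 * Suc k)}"
proof
  let ?m = "modulus j"
  assume eq: "virtual_equiv `` {chain (2 * Suc j)} = virtual_equiv `` {chain (2 * Suc k)}"
  have "(chain (2 * Suc k), chain (2 * Suc k)) \<in> virtual_equiv"
    by (rule virtual_equiv_refl[OF virtual_diagram_chain])
  then have equiv: "(chain (2 * Suc j), chain (2 * Suc k)) \<in> virtual_equiv" using eq by blast
  have "quandle {0..<?m} (double ?m) (halve ?m ((?m + 1) div 2))"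
  proof (rule quandle_double_halve)
    have "2 * ((?m + 1) div 2) = ?m + 1" using odd_modulus[of j] by (intro dvd_mult_div_cancel) simp
    then show "?m dvd 2 * ((?m + 1) div 2) - 1" by simp
  qed (use modulus_gt_1[of j] in simp)
  from quandle_quotient_virtual_equiv[OF this equiv] have "?m dvd modulus k"
    unfolding chain_quandle_quotient_iff by simp
  then have "?m \<le> modulus k" using modulus_gt_1[of k] by (intro zdvd_imp_le) simp_all
  then show False using modulus_less[OF assms] by simp
qed

theorem theorem3p3:
  shows "\<exists>VK :: nat \<Rightarrow> passage list set.
           (\<forall>n\<ge>1. VK n \<in> virtual_knots) \<and> infinite (VK ` {1..}) \<and>
           (\<forall>t\<ge>1. \<forall>s\<ge>1. t \<noteq> s \<longrightarrow> arc_shift_distance (VK t) (VK s) = 1)"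
proof -
  \<comment> \<open>Odd numbers of ties are left out, as the drifts have a uniform closed form only after pairs of ties.\<close>
  define VK where "VK = (\<lambda>t. virtual_equiv `` {chain (2 * t)})"
  have ne: "VK t \<noteq> VK s" if "1 \<le> t" "1 \<le> s" "t \<noteq> s" for t s
  proof -
    have ts: "t = Suc (t - 1)" "s = Suc (s - 1)" using that by simp_all
    show ?thesis
    proof (cases "t < s")
      case True
      then have "t - 1 < s - 1" using that by simp
      from chain_not_equiv[OF this] show ?thesis unfolding VK_def ts[symmetric] by (rule not_sym)
    next
      case False
      then have "s - 1 < t - 1" using that by simp
      from chain_not_equiv[OF this] show ?thesis unfolding VK_def ts[symmetric] .
    qed
  qed
  have "VK t \<in> virtual_knots" for t
    unfolding VK_def virtual_knots_def by (rule quotientI) (simp add: virtual_diagram_chain)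
  moreover have "inj_on VK {1..}" using ne by (auto simp: inj_on_def)
  then have "infinite (VK ` {1..})" by (simp add: finite_image_iff infinite_Ici)
  moreover have "arc_shift_distance (VK t) (VK s) = 1" if "1 \<le> t" "1 \<le> s" "t \<noteq> s" for t s
    using arc_shift_distance_chain[of "2 * t" "2 * s"] ne[OF that] that unfolding VK_def by simp
  ultimately show ?thesis by (intro exI[of _ VK]) blast
qed

end
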